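(* Let $T$ be a nice t-minimal theory, $\mathbb{M}$ a monster model, and $(G,\cdot)$ a definable group. Let $\tau$ be a definable topology on $G$ such that (1) $(G,\tau)$ is a definable semimanifold, and (2) every left translation $x\mapsto a\cdot x$ ($a\in G$) is $\tau$-continuous. Then $(G,\tau)$ is a definable manifold, and $(G,\cdot,\tau)$ is a topological group.
   Context: A complete one-sorted theory $T$ is t-minimal if there is a Hausdorff topology on models $M$ of $T$ (on $M^1$) with a basis given by a definable family, such that every definable $D\subseteq M$ has non-empty interior iff $D$ is infinite. "Definable" means definable with parameters; $\mathbb{M}^n$ has the product topology. For definable $X\subseteq\mathbb{M}^n$, $\dim(X)=-\infty$ if $X=\emptyset$, and otherwise the largest $k$ such that some coordinate projection $\pi:\mathbb{M}^n\to\mathbb{M}^k$ has $\pi(X)$ with non-empty interior. A $k$-correspondence $f:X\rightrightarrows Y$ assigns to each $x$ a $k$-element set $f(x)\subseteq Y$; it is definable if its graph is definable, and continuous if locally $f(x)=\{g_1(x),\dots,g_k(x)\}$ with continuous $g_i$. $T$ is nice if for every definable open $U\subseteq\mathbb{M}^n$ and definable $k$-correspondence $f:U\rightrightarrows\mathbb{M}^m$ there is a definable open $U_0\subseteq U$ with $\dim(U\setminus U_0)<n$ and $f|_{U_0}$ continuous. A cell is a set $\sigma(\Gamma(f))\subseteq\mathbb{M}^n$ with $U\subseteq\mathbb{M}^i$ definable open, $f:U\rightrightarrows\mathbb{M}^{n-i}$ a continuous definable correspondence with graph $\Gamma(f)$, and $\sigma$ a coordinate permutation. A definable topological space is a definable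 set with a topology having a definable basis family. A definable manifold is a definable topological space covered by finitely many definable open subsets each definably homeomorphic to an open subset of a cell (with subspace topology). A definable semimanifold is a definable topological space covered by finitely many definable open subsets $U_i$, each definably homeomorphic to a definable subset of some $\mathbb{M}^{k_i}$ with the subspace topology. *)

theory Defs
  imports "HOL-Analysis.Analysis" "HOL-Algebra.Group"
begin

unbundle cardinal_syntax

section \<open>First-order logic\<close>

text \<open>A language is a set of function symbols and a set of relation symbols, each paired with its
  arity; constants are function symbols of arity 0. Symbol interpretations in a structure matter
  only at the arities that the language declares.\<close>

record ('f, 'r) language =
  Funs :: "('f \<times> nat) set"
  Rels :: "('r \<times> nat) set"

datatype 'f tm = Var nat | Fn 'f "'f tm list"

datatype ('f, 'r) fm =
    Equal "'f tm" "'f tm"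
  | Pred 'r "'f tm list"
  | Neg "('f, 'r) fm"
  | Conj "('f, 'r) fm" "('f, 'r) fm"
  | Forall nat "('f, 'r) fm"

record ('f, 'r, 'a) struct =
  Dom :: "'a set"
  Fun_of :: "'f \<Rightarrow> 'a list \<Rightarrow> 'a"
  Rel_of :: "'r \<Rightarrow> 'a list \<Rightarrow> bool"

fun fv_tm :: "'f tm \<Rightarrow> nat set" where
  "fv_tm (Var i) = {i}"
| "fv_tm (Fn f ts) = (\<Union>t\<in>set ts. fv_tm t)"

fun wf_tm :: "('f, 'r) language \<Rightarrow> 'f tm \<Rightarrow> bool" where
  "wf_tm L (Var i) \<longleftrightarrow> True"
| "wf_tm L (Fn f ts) \<longleftrightarrow> (f, length ts) \<in> Funs L \<and> (\<forall>t\<in>set ts. wf_tm L t)"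

fun eval_tm :: "('f, 'r, 'a) struct \<Rightarrow> (nat \<Rightarrow> 'a) \<Rightarrow> 'f tm \<Rightarrow> 'a" where
  "eval_tm M e (Var i) = e i"
| "eval_tm M e (Fn f ts) = Fun_of M f (map (eval_tm M e) ts)"

primrec fv :: "('f, 'r) fm \<Rightarrow> nat set" where
  "fv (Equal s t) = fv_tm s \<union> fv_tm t"
| "fv (Pred r ts) = (\<Union>t\<in>set ts. fv_tm t)"
| "fv (Neg \<phi>) = fv \<phi>"
| "fv (Conj \<phi> \<psi>) = fv \<phi> \<union> fv \<psi>"
| "fv (Forall i \<phi>) = fv \<phi> - {i}"

primrec wf_fm :: "('f, 'r) language \<Rightarrow> ('f, 'r) fm \<Rightarrow> bool" where
  "wf_fm L (Equal s t) \<longleftrightarrow> wf_tm L s \<and> wf_tm L t"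
| "wf_fm L (Pred r ts) \<longleftrightarrow> (r, length ts) \<in> Rels L \<and> (\<forall>t\<in>set ts. wf_tm L t)"
| "wf_fm L (Neg \<phi>) \<longleftrightarrow> wf_fm L \<phi>"
| "wf_fm L (Conj \<phi> \<psi>) \<longleftrightarrow> wf_fm L \<phi> \<and> wf_fm L \<psi>"
| "wf_fm L (Forall i \<phi>) \<longleftrightarrow> wf_fm L \<phi>"

primrec sat :: "('f, 'r, 'a) struct \<Rightarrow> (nat \<Rightarrow> 'a) \<Rightarrow> ('f, 'r) fm \<Rightarrow> bool" where
  "sat M e (Equal s t) \<longleftrightarrow> eval_tm M e s = eval_tm M e t"
| "sat M e (Pred r ts) \<longleftrightarrow> Rel_of M r (map (eval_tm M e) ts)"
| "sat M e (Neg \<phi>) \<longleftrightarrow> \<not> sat M e \<phi>"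
| "sat M e (Conj \<phi> \<psi>) \<longleftrightarrow> sat M e \<phi> \<and> sat M e \<psi>"
| "sat M e (Forall i \<phi>) \<longleftrightarrow> (\<forall>a\<in>Dom M. sat M (e(i := a)) \<phi>)"

definition sentence :: "('f, 'r) language \<Rightarrow> ('f, 'r) fm \<Rightarrow> bool" where
  "sentence L \<phi> \<longleftrightarrow> wf_fm L \<phi> \<and> fv \<phi> = {}"

definition is_structure :: "('f, 'r) language \<Rightarrow> ('f, 'r, 'a) struct \<Rightarrow> bool" where
  "is_structure L M \<longleftrightarrow> Dom M \<noteq> {} \<and>
     (\<forall>(f, n)\<in>Funs L. \<forall>xs. length xs = n \<and> set xs \<subseteq> Dom M \<longrightarrow> Fun_of M f xs \<in> Dom M)"

definition is_model :: "('f, 'r) language \<Rightarrow> ('f, 'r) fm set \<Rightarrow> ('f, 'r, 'a) struct \<Rightarrow> bool" where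
  "is_model L T M \<longleftrightarrow> is_structure L M \<and> (\<forall>\<phi>\<in>T. \<forall>e. range e \<subseteq> Dom M \<longrightarrow> sat M e \<phi>)"

text \<open>Models range over all structures whose domain is a subset of the type \<open>'a\<close>. If \<open>'a\<close> has at
  least as many elements as there are formulas, then by Loewenheim-Skolem this gives the usual
  notion of consequence.\<close>

definition entails ::
    "'a itself \<Rightarrow> ('f, 'r) language \<Rightarrow> ('f, 'r) fm set \<Rightarrow> ('f, 'r) fm \<Rightarrow> bool" where
  "entails ty L T \<phi> \<longleftrightarrow>
     (\<forall>M :: ('f, 'r, 'a) struct. is_model L T M \<longrightarrow> (\<forall>e. range e \<subseteq> Dom M \<longrightarrow> sat M e \<phi>))"

definition complete_theory :: "'a itself \<Rightarrow> ('f, 'r) language \<Rightarrow> ('f, 'r) fm set \<Rightarrow> bool" where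
  "complete_theory ty L T \<longleftrightarrow>
     (\<forall>\<phi>\<in>T. sentence L \<phi>) \<and>
     (\<exists>M :: ('f, 'r, 'a) struct. is_model L T M) \<and>
     (\<forall>\<phi>. sentence L \<phi> \<longrightarrow> entails ty L T \<phi> \<or> entails ty L T (Neg \<phi>))"


section \<open>Monster models\<close>

text \<open>A partial type over \<open>A\<close> in the variable 0 is a set of pairs of a formula and a valuation that
  assigns parameters from \<open>A\<close> to the other free variables.\<close>

definition saturated ::
    "'k rel \<Rightarrow> ('f, 'r) language \<Rightarrow> ('f, 'r, 'a) struct \<Rightarrow> bool" where
  "saturated \<kappa> L M \<longleftrightarrow>
     (\<forall>A p. A \<subseteq> Dom M \<and> |A| <o \<kappa> \<and>
        (\<forall>(\<phi>, e)\<in>p. wf_fm L \<phi> \<and> e ` (fv \<phi> - {0}) \<subseteq> A) \<and>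
        (\<forall>q. finite q \<and> q \<subseteq> p \<longrightarrow> (\<exists>a\<in>Dom M. \<forall>(\<phi>, e)\<in>q. sat M (e(0 := a)) \<phi>)) \<longrightarrow>
        (\<exists>a\<in>Dom M. \<forall>(\<phi>, e)\<in>p. sat M (e(0 := a)) \<phi>))"

definition partial_elementary ::
    "('f, 'r) language \<Rightarrow> ('f, 'r, 'a) struct \<Rightarrow> 'a set \<Rightarrow> ('a \<Rightarrow> 'a) \<Rightarrow> bool" where
  "partial_elementary L M A h \<longleftrightarrow> A \<subseteq> Dom M \<and> h ` A \<subseteq> Dom M \<and>
     (\<forall>\<phi> e. wf_fm L \<phi> \<and> e ` fv \<phi> \<subseteq> A \<longrightarrow> (sat M e \<phi> \<longleftrightarrow> sat M (h \<circ> e) \<phi>))"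

definition automorphism ::
    "('f, 'r) language \<Rightarrow> ('f, 'r, 'a) struct \<Rightarrow> ('a \<Rightarrow> 'a) \<Rightarrow> bool" where
  "automorphism L M g \<longleftrightarrow> bij_betw g (Dom M) (Dom M) \<and>
     (\<forall>(f, n)\<in>Funs L. \<forall>xs. length xs = n \<and> set xs \<subseteq> Dom M \<longrightarrow>
        g (Fun_of M f xs) = Fun_of M f (map g xs)) \<and>
     (\<forall>(r, n)\<in>Rels L. \<forall>xs. length xs = n \<and> set xs \<subseteq> Dom M \<longrightarrow>
        (Rel_of M r xs \<longleftrightarrow> Rel_of M r (map g xs)))"

definition strongly_homogeneous ::
    "'k rel \<Rightarrow> ('f, 'r) language \<Rightarrow> ('f, 'r, 'a) struct \<Rightarrow> bool" where
  "strongly_homogeneous \<kappa> L M \<longleftrightarrow>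
     (\<forall>A h. |A| <o \<kappa> \<and> partial_elementary L M A h \<longrightarrow>
        (\<exists>g. automorphism L M g \<and> (\<forall>a\<in>A. g a = h a)))"

text \<open>The cardinal \<open>\<kappa>\<close> is above the number of formulas, i.e. \<open>|L| + \<aleph>\<^sub>0\<close>. It is no restriction to
  represent it on the type \<open>'a\<close>: an infinite \<open>\<kappa>\<close>-saturated model has at least \<open>\<kappa>\<close> elements.\<close>

definition monster_model ::
    "('f, 'r) language \<Rightarrow> ('f, 'r) fm set \<Rightarrow> ('f, 'r, 'a) struct \<Rightarrow> bool" where
  "monster_model L T M \<longleftrightarrow> is_model L T M \<and>
     (\<exists>\<kappa> :: 'a rel. Card_order \<kappa> \<and> |{\<phi> :: ('f, 'r) fm. wf_fm L \<phi>}| <o \<kappa> \<and>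
        saturated \<kappa> L M \<and> strongly_homogeneous \<kappa> L M)"


section \<open>Definable sets\<close>

text \<open>Points of \<open>M\<^sup>n\<close> are extensional functions on \<open>{..<n}\<close>, the points of the library's
  product topology.\<close>

type_synonym 'a point = "nat \<Rightarrow> 'a"

definition pow :: "('f, 'r, 'a) struct \<Rightarrow> nat \<Rightarrow> 'a point set" where
  "pow M n = {..<n} \<rightarrow>\<^sub>E Dom M"

definition append_pt :: "nat \<Rightarrow> nat \<Rightarrow> 'a point \<Rightarrow> 'a point \<Rightarrow> 'a point" where
  "append_pt n m x y = (\<lambda>i\<in>{..<n + m}. if i < n then x i else y (i - n))"

text \<open>The variables below \<open>n\<close> are the coordinates; the valuation \<open>e\<close> supplies the parameters.\<close>

definition definable ::
    "('f, 'r) language \<Rightarrow> ('f, 'r, 'a) struct \<Rightarrow> nat \<Rightarrow> 'a point set \<Rightarrow> bool" where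
  "definable L M n X \<longleftrightarrow> (\<exists>\<phi> e. wf_fm L \<phi> \<and> range e \<subseteq> Dom M \<and>
     X = {x \<in> pow M n. sat M (\<lambda>i. if i < n then x i else e i) \<phi>})"

definition definable_family ::
    "('f, 'r) language \<Rightarrow> ('f, 'r, 'a) struct \<Rightarrow> nat \<Rightarrow> 'a point set set \<Rightarrow> bool" where
  "definable_family L M n \<F> \<longleftrightarrow> (\<exists>k Y R. definable L M k Y \<and> definable L M (n + k) R \<and>
     \<F> = {{x \<in> pow M n. append_pt n k x b \<in> R} | b. b \<in> Y})"

definition base_of :: "'b topology \<Rightarrow> 'b set set \<Rightarrow> bool" where
  "base_of \<tau> \<B> \<longleftrightarrow> openin \<tau> = arbitrary union_of (\<lambda>B. B \<in> \<B>)"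


section \<open>t-minimal theories\<close>

text \<open>\<open>\<TT>\<close> assigns to each model of \<open>T\<close> its topology. The basis is given by one formula in all
  models: variable 0 is the element, variables \<open>1..k\<close> are the index of the family, and the
  remaining variables receive parameters \<open>e\<close>, which may depend on the model.\<close>

definition t_minimal ::
    "('f, 'r) language \<Rightarrow> ('f, 'r) fm set \<Rightarrow> (('f, 'r, 'a) struct \<Rightarrow> 'a topology) \<Rightarrow> bool" where
  "t_minimal L T \<TT> \<longleftrightarrow>
     (\<exists>\<phi> k. wf_fm L \<phi> \<and> (\<forall>M. is_model L T M \<longrightarrow> (\<exists>e. range e \<subseteq> Dom M \<and>
        base_of (\<TT> M)
          {{a \<in> Dom M. sat M (case_nat a (\<lambda>i. if i < k then b i else e i)) \<phi>} | b. b \<in> pow M k}))) \<and>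
     (\<forall>M. is_model L T M \<longrightarrow>
        topspace (\<TT> M) = Dom M \<and> Hausdorff_space (\<TT> M) \<and>
        (\<forall>D\<subseteq>Dom M. definable L M 1 {x \<in> pow M 1. x 0 \<in> D} \<longrightarrow>
           (\<TT> M interior_of D \<noteq> {} \<longleftrightarrow> infinite D)))"

text \<open>From here on, \<open>S\<close> is a topology on \<open>Dom M\<close>.\<close>

definition pow_top :: "'a topology \<Rightarrow> nat \<Rightarrow> 'a point topology" where
  "pow_top S n = product_topology (\<lambda>_. S) {..<n}"

definition coord_proj :: "nat \<Rightarrow> (nat \<Rightarrow> nat) \<Rightarrow> 'a point \<Rightarrow> 'a point" where
  "coord_proj k s x = (\<lambda>i\<in>{..<k}. x (s i))"

definition dim :: "'a topology \<Rightarrow> nat \<Rightarrow> 'a point set \<Rightarrow> ereal" where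
  "dim S n X = (if X = {} then - \<infinity> else ereal (real
     (GREATEST k. \<exists>s. strict_mono_on {..<k} s \<and> s ` {..<k} \<subseteq> {..<n} \<and>
        pow_top S k interior_of (coord_proj k s ` X) \<noteq> {})))"

definition correspondence :: "nat \<Rightarrow> 'b set \<Rightarrow> 'c set \<Rightarrow> ('b \<Rightarrow> 'c set) \<Rightarrow> bool" where
  "correspondence k X Y f \<longleftrightarrow> (\<forall>x\<in>X. f x \<subseteq> Y \<and> finite (f x) \<and> card (f x) = k)"

definition corr_graph ::
    "nat \<Rightarrow> nat \<Rightarrow> 'a point set \<Rightarrow> ('a point \<Rightarrow> 'a point set) \<Rightarrow> 'a point set" where
  "corr_graph n m X f = {append_pt n m x y | x y. x \<in> X \<and> y \<in> f x}"

definition continuous_corr ::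
    "nat \<Rightarrow> 'b topology \<Rightarrow> 'c topology \<Rightarrow> ('b \<Rightarrow> 'c set) \<Rightarrow> bool" where
  "continuous_corr k X Y f \<longleftrightarrow> (\<forall>x\<in>topspace X. \<exists>V g. openin X V \<and> x \<in> V \<and>
     (\<forall>i<k. continuous_map (subtopology X V) Y (g i)) \<and>
     (\<forall>x'\<in>V. f x' = {g i x' | i. i < k}))"

definition nice ::
    "('f, 'r) language \<Rightarrow> ('f, 'r, 'a) struct \<Rightarrow> 'a topology \<Rightarrow> bool" where
  "nice L M S \<longleftrightarrow> (\<forall>n m k U f.
     definable L M n U \<and> openin (pow_top S n) U \<and>
     correspondence k U (pow M m) f \<and> definable L M (n + m) (corr_graph n m U f) \<longrightarrow>
     (\<exists>U0\<subseteq>U. definable L M n U0 \<and> openin (pow_top S n) U0 \<and> dim S n (U - U0) < ereal (real n) \<and>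
        continuous_corr k (subtopology (pow_top S n) U0) (pow_top S m) f))"

definition cell ::
    "('f, 'r) language \<Rightarrow> ('f, 'r, 'a) struct \<Rightarrow> 'a topology \<Rightarrow> nat \<Rightarrow> 'a point set \<Rightarrow> bool" where
  "cell L M S n C \<longleftrightarrow> (\<exists>i k U f \<sigma>. i \<le> n \<and>
     definable L M i U \<and> openin (pow_top S i) U \<and>
     correspondence k U (pow M (n - i)) f \<and>
     definable L M n (corr_graph i (n - i) U f) \<and>
     continuous_corr k (subtopology (pow_top S i) U) (pow_top S (n - i)) f \<and>
     \<sigma> permutes {..<n} \<and> C = coord_proj n \<sigma> ` corr_graph i (n - i) U f)"


section \<open>Definable spaces, manifolds and groups\<close>

definition definable_space ::
    "('f, 'r) language \<Rightarrow> ('f, 'r, 'a) struct \<Rightarrow> nat \<Rightarrow> 'a point set \<Rightarrow> 'a point topology \<Rightarrow> bool" where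
  "definable_space L M n X \<tau> \<longleftrightarrow> definable L M n X \<and> topspace \<tau> = X \<and>
     (\<exists>\<B>. definable_family L M n \<B> \<and> base_of \<tau> \<B>)"

text \<open>\<open>U \<subseteq> M\<^sup>n\<close> carries the topology induced by \<open>\<tau>\<close>, and \<open>V \<subseteq> M\<^sup>m\<close> the one induced by \<open>M\<^sup>m\<close>.\<close>

definition definable_chart ::
    "('f, 'r) language \<Rightarrow> ('f, 'r, 'a) struct \<Rightarrow> 'a topology \<Rightarrow> nat \<Rightarrow> 'a point topology \<Rightarrow>
     'a point set \<Rightarrow> nat \<Rightarrow> 'a point set \<Rightarrow> ('a point \<Rightarrow> 'a point) \<Rightarrow> bool" where
  "definable_chart L M S n \<tau> U m V h \<longleftrightarrow>
     homeomorphic_map (subtopology \<tau> U) (subtopology (pow_top S m) V) h \<and>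
     definable L M (n + m) {append_pt n m x (h x) | x. x \<in> U}"

definition definable_manifold ::
    "('f, 'r) language \<Rightarrow> ('f, 'r, 'a) struct \<Rightarrow> 'a topology \<Rightarrow> nat \<Rightarrow> 'a point set \<Rightarrow>
     'a point topology \<Rightarrow> bool" where
  "definable_manifold L M S n X \<tau> \<longleftrightarrow> definable_space L M n X \<tau> \<and>
     (\<exists>\<U>. finite \<U> \<and> \<Union>\<U> = X \<and>
        (\<forall>U\<in>\<U>. definable L M n U \<and> openin \<tau> U \<and>
           (\<exists>m C V h. cell L M S m C \<and> openin (subtopology (pow_top S m) C) V \<and>
              definable_chart L M S n \<tau> U m V h)))"

definition definable_semimanifold ::
    "('f, 'r) language \<Rightarrow> ('f, 'r, 'a) struct \<Rightarrow> 'a topology \<Rightarrow> nat \<Rightarrow> 'a point set \<Rightarrow>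
     'a point topology \<Rightarrow> bool" where
  "definable_semimanifold L M S n X \<tau> \<longleftrightarrow> definable_space L M n X \<tau> \<and>
     (\<exists>\<U>. finite \<U> \<and> \<Union>\<U> = X \<and>
        (\<forall>U\<in>\<U>. definable L M n U \<and> openin \<tau> U \<and>
           (\<exists>m V h. definable L M m V \<and> definable_chart L M S n \<tau> U m V h)))"

definition definable_group ::
    "('f, 'r) language \<Rightarrow> ('f, 'r, 'a) struct \<Rightarrow> nat \<Rightarrow> 'a point monoid \<Rightarrow> bool" where
  "definable_group L M n G \<longleftrightarrow> group G \<and> definable L M n (carrier G) \<and>
     definable L M (n + n + n)
       {append_pt (n + n) n (append_pt n n x y) (x \<otimes>\<^bsub>G\<^esub> y) | x y. x \<in> carrier G \<and> y \<in> carrier G}"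

definition topological_group :: "'b monoid \<Rightarrow> 'b topology \<Rightarrow> bool" where
  "topological_group G \<tau> \<longleftrightarrow> group G \<and> topspace \<tau> = carrier G \<and>
     continuous_map (prod_topology \<tau> \<tau>) \<tau> (\<lambda>(x, y). x \<otimes>\<^bsub>G\<^esub> y) \<and>
     continuous_map \<tau> \<tau> (\<lambda>x. inv\<^bsub>G\<^esub> x)"

end

theory Submission
  imports Defs
begin

text \<open>The monster model makes the topology rich: a countable intersection of neighbourhoods is a
  neighbourhood, and a definable subset of \<open>M\<^sup>n\<close> has interior as soon as it contains a grid
  \<open>A\<^sub>1 \<times> \<dots> \<times> A\<^sub>n\<close> of infinite sets. Hence a definable set without interior is a finite union of sets
  that are finite in some coordinate direction, which together with niceness gives cell
  decomposition. Cells are locally closed graphs, so every definable set has a dense relatively open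
  subset that is locally Euclidean, and definable maps are continuous at many points.

  In the group, multiplication is therefore continuous at some points \<open>(a, b)\<close>; by left translation
  this depends only on \<open>b\<close>, and the set \<open>B\<close> of good \<open>b\<close> is dense, definable and closed under products.
  A grid cannot lie in the complement of a translate of \<open>B\<close>, so by saturation some finite \<open>F\<close> meets
  every translate \<open>hB\<close>, i.e. \<open>F B\<inverse>\<close> is the whole group. So \<open>B\<inverse>\<close> has interior and \<open>B B\<close> is everything.
  The same finiteness lets finitely many translates of a dense open union of charts cover the group.\<close>

section \<open>Definable predicates\<close>

text \<open>Niceness controls correspondences only outside sets with empty interior, and
  t-minimality speaks only of one variable. Two tools bridge the gap. Applied to a two-valued map,
  niceness shows that a finite union of definable sets without interior has no interior. Grids carry
  interior from one variable to \<open>n\<close> variables; they are taken countable where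
  saturation, used for decreasing sequences of definable sets, has to handle all their points.

  Only left translations are assumed continuous, so the right factor of a product cannot be moved
  topologically. Continuity at every \<open>(\<one>, g)\<close> is therefore reached by algebra: for
  a suitable good \<open>y\<close> the element \<open>inv y \<otimes> g\<close> is good as well, and
  \<open>g\<close> is their product. Inversion, continuous somewhere by generic continuity, is
  carried elsewhere by \<open>inv x = inv (c \<otimes> x) \<otimes> c\<close>, which needs
  continuous multiplication. The covering result yields \<open>inv h \<otimes> f\<close> rather than
  its inverse, so for the charts it is applied to the inverse of their dense union; that this is
  still dense rests on continuity of inversion. Hence the group comes before the manifold.\<close>

lemma finite_fv_tm: "finite (fv_tm t)"
  by (induction t) auto

lemma finite_fv: "finite (fv \<phi>)"
  by (induction \<phi>) (auto simp: finite_fv_tm)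

lemma eval_tm_cong: "(\<And>i. i \<in> fv_tm t \<Longrightarrow> e i = e' i) \<Longrightarrow> eval_tm M e t = eval_tm M e' t"
proof (induction t)
  case (Fn f ts)
  have "eval_tm M e t = eval_tm M e' t" if "t \<in> set ts" for t
    using that by (intro Fn.IH Fn.prems) auto
  then have "map (eval_tm M e) ts = map (eval_tm M e') ts"
    by (simp add: map_eq_conv)
  then show ?case by (simp only: eval_tm.simps)
qed simp

lemma sat_cong: "(\<And>i. i \<in> fv \<phi> \<Longrightarrow> e i = e' i) \<Longrightarrow> sat M e \<phi> \<longleftrightarrow> sat M e' \<phi>"
proof (induction \<phi> arbitrary: e e')
  case (Equal s t)
  then show ?case using eval_tm_cong[of s e e' M] eval_tm_cong[of t e e' M] by auto
next
  case (Pred r ts)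
  have "eval_tm M e t = eval_tm M e' t" if "t \<in> set ts" for t
    using that by (intro eval_tm_cong Pred.prems) auto
  then have "map (eval_tm M e) ts = map (eval_tm M e') ts"
    by (simp add: map_eq_conv)
  then show ?case by (simp only: sat.simps)
next
  case (Neg \<phi>)
  have "sat M e \<phi> \<longleftrightarrow> sat M e' \<phi>"
    by (rule Neg.IH) (simp add: Neg.prems)
  then show ?case by simp
next
  case (Conj \<phi> \<psi>)
  have "sat M e \<phi> \<longleftrightarrow> sat M e' \<phi>" "sat M e \<psi> \<longleftrightarrow> sat M e' \<psi>"
    by (rule Conj.IH; simp add: Conj.prems)+
  then show ?case by simp
next
  case (Forall i \<phi>)
  have "sat M (e(i := a)) \<phi> \<longleftrightarrow> sat M (e'(i := a)) \<phi>" for a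
    by (rule Forall.IH) (simp add: Forall.prems)
  then show ?case by simp
qed

section \<open>Renaming the variables of a formula\<close>

primrec ren_tm :: "(nat \<Rightarrow> nat) \<Rightarrow> 'f tm \<Rightarrow> 'f tm" where
  "ren_tm r (Var i) = Var (r i)"
| "ren_tm r (Fn f ts) = Fn f (map (ren_tm r) ts)"

lemma wf_ren_tm: "wf_tm L t \<Longrightarrow> wf_tm L (ren_tm r t)"
  by (induction t) auto

lemma eval_ren_tm: "eval_tm M e (ren_tm r t) = eval_tm M (\<lambda>v. e (r v)) t"
proof (induction t)
  case (Fn f ts)
  then have "map (eval_tm M e) (map (ren_tm r) ts) = map (eval_tm M (\<lambda>v. e (r v))) ts"
    by (simp add: map_eq_conv)
  then show ?case by (simp only: eval_tm.simps ren_tm.simps)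
qed simp

text \<open>The renaming \<open>\<rho>\<close> may identify variables, so the new formula is
  described only by its semantics. Induction for all \<open>\<rho>\<close> at once lets each
  quantifier rename its own bound variable.\<close>

lemma substitution_formula:
  "wf_fm L \<phi> \<Longrightarrow> \<exists>\<phi>'. wf_fm L \<phi>' \<and> (\<forall>e. sat M e \<phi>' \<longleftrightarrow> sat M (\<lambda>v. e (\<rho> v)) \<phi>)"
proof (induction \<phi> arbitrary: \<rho>)
  case (Equal s t)
  then show ?case
    by (intro exI[of _ "Equal (ren_tm \<rho> s) (ren_tm \<rho> t)"]) (auto simp: wf_ren_tm eval_ren_tm)
next
  case (Pred r ts)
  then show ?case
    by (intro exI[of _ "Pred r (map (ren_tm \<rho>) ts)"]) (auto simp: wf_ren_tm eval_ren_tm comp_def)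
next
  case (Neg \<phi>)
  have "wf_fm L \<phi>" using Neg.prems by simp
  from Neg.IH[OF this, of \<rho>]
  obtain \<phi>' where "wf_fm L \<phi>'" "\<forall>e. sat M e \<phi>' \<longleftrightarrow> sat M (\<lambda>v. e (\<rho> v)) \<phi>"
    by (elim exE conjE)
  then show ?case by (intro exI[of _ "Neg \<phi>'"]) auto
next
  case (Conj \<phi> \<psi>)
  have wf: "wf_fm L \<phi>" "wf_fm L \<psi>" using Conj.prems by auto
  from Conj.IH(1)[OF wf(1), of \<rho>]
  obtain \<phi>' where "wf_fm L \<phi>'" "\<forall>e. sat M e \<phi>' \<longleftrightarrow> sat M (\<lambda>v. e (\<rho> v)) \<phi>"
    by (elim exE conjE)
  moreover from Conj.IH(2)[OF wf(2), of \<rho>]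
  obtain \<psi>' where "wf_fm L \<psi>'" "\<forall>e. sat M e \<psi>' \<longleftrightarrow> sat M (\<lambda>v. e (\<rho> v)) \<psi>"
    by (elim exE conjE)
  ultimately show ?case by (intro exI[of _ "Conj \<phi>' \<psi>'"]) auto
next
  case (Forall i \<phi>)
  \<comment> \<open>A bound variable \<open>j\<close> outside the image of the free variables avoids
    capture.\<close>
  have "finite (\<rho> ` fv \<phi>)" by (simp add: finite_fv)
  then obtain j where j: "j \<notin> \<rho> ` fv \<phi>" using ex_new_if_finite infinite_UNIV_nat by blast
  have "wf_fm L \<phi>" using Forall.prems by simp
  from Forall.IH[OF this, of "\<rho>(i := j)"]
  obtain \<phi>' where \<phi>': "wf_fm L \<phi>'" "\<forall>e. sat M e \<phi>' \<longleftrightarrow> sat M (\<lambda>v. e ((\<rho>(i := j)) v)) \<phi>"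
    by (elim exE conjE)
  have "sat M (e(j := a)) \<phi>' \<longleftrightarrow> sat M ((\<lambda>v. e (\<rho> v))(i := a)) \<phi>" for e a
    unfolding \<phi>'(2)[rule_format] using j by (intro sat_cong) auto
  then show ?case using \<phi>' by (intro exI[of _ "Forall j \<phi>'"]) auto
qed

text \<open>A valuation \<open>w\<close> consists of countably many blocks of variables; block \<open>b\<close> has the
  entries \<open>w b i\<close>. Blocks work like de Bruijn indices: quantifying over a tuple uses block 0 and
  shifts the others. A source is either such a variable or a parameter.\<close>

definition look :: "(nat \<Rightarrow> nat \<Rightarrow> 'a) \<Rightarrow> (nat \<times> nat) + 'a \<Rightarrow> 'a" where
  "look w s = (case s of Inl p \<Rightarrow> w (fst p) (snd p) | Inr a \<Rightarrow> a)"

lemma look_simps [simp]: "look w (Inl (b, i)) = w b i" "look w (Inr a) = a"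
  by (auto simp: look_def)

locale fo_structure =
  fixes L :: "('f, 'r) language" and M :: "('f, 'r, 'a) struct"
  assumes is_struct: "is_structure L M"
begin

abbreviation "sources \<equiv> range Inl \<union> Inr ` Dom M"

abbreviation "envs \<equiv> {w :: nat \<Rightarrow> nat \<Rightarrow> 'a. \<forall>b i. w b i \<in> Dom M}"

text \<open>The formula and the source assignment \<open>\<sigma>\<close> are kept apart: parameters
  enter as \<open>Inr\<close> values of \<open>\<sigma>\<close>, and agreement is asked only for
  valuations inside the structure. In this form definability follows from closure rules instead of
  explicit formulas.\<close>

definition dfn :: "((nat \<Rightarrow> nat \<Rightarrow> 'a) \<Rightarrow> bool) \<Rightarrow> bool" where
  "dfn P \<longleftrightarrow> (\<exists>\<phi> \<sigma>. wf_fm L \<phi> \<and> (\<forall>v. \<sigma> v \<in> sources) \<and>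
     (\<forall>w\<in>envs. P w \<longleftrightarrow> sat M (\<lambda>v. look w (\<sigma> v)) \<phi>))"

text \<open>Only variables and parameters; values of definable functions are handled later by
  \<open>dterm\<close>, at the cost of a quantifier.\<close>

definition delt :: "((nat \<Rightarrow> nat \<Rightarrow> 'a) \<Rightarrow> 'a) \<Rightarrow> bool" where
  "delt t \<longleftrightarrow> (\<exists>s\<in>sources. \<forall>w\<in>envs. t w = look w s)"

definition dtup :: "nat \<Rightarrow> ((nat \<Rightarrow> nat \<Rightarrow> 'a) \<Rightarrow> 'a point) \<Rightarrow> bool" where
  "dtup n t \<longleftrightarrow> (\<forall>w\<in>envs. t w \<in> extensional {..<n}) \<and> (\<forall>i<n. delt (\<lambda>w. t w i))"

lemma Dom_ne: "Dom M \<noteq> {}"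
  using is_struct by (auto simp: is_structure_def)

lemma pow_nonempty: "pow M n \<noteq> {}"
  using Dom_ne by (auto simp: pow_def PiE_eq_empty_iff)

lemma ext_nth [simp]: "x \<in> pow M n \<Longrightarrow> i < n \<Longrightarrow> x i \<in> Dom M"
  by (auto simp: pow_def)

lemma look_in: "w \<in> envs \<Longrightarrow> s \<in> sources \<Longrightarrow> look w s \<in> Dom M"
  by (auto simp: look_def)

lemma delt_in: "delt t \<Longrightarrow> w \<in> envs \<Longrightarrow> t w \<in> Dom M"
  unfolding delt_def using look_in by fastforce

lemma dtup_in: "dtup n t \<Longrightarrow> w \<in> envs \<Longrightarrow> t w \<in> pow M n"
  unfolding dtup_def pow_def PiE_def using delt_in[of "\<lambda>w. t w i" w for i] by auto

lemma dfn_cong: "(\<And>w. w \<in> envs \<Longrightarrow> P w \<longleftrightarrow> Q w) \<Longrightarrow> dfn P \<longleftrightarrow> dfn Q"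
  unfolding dfn_def by auto

lemma dfn_congI: "dfn Q \<Longrightarrow> (\<And>w. w \<in> envs \<Longrightarrow> Q w \<longleftrightarrow> P w) \<Longrightarrow> dfn P"
  using dfn_cong[of P Q] by blast

lemma delt_var: "delt (\<lambda>w. w b i)"
  unfolding delt_def by (intro bexI[of _ "Inl (b, i)"]) auto

lemma delt_case_nat: "delt (\<lambda>w. case_nat (w c) w b i)"
  by (cases b) (auto simp: delt_var)

lemma delt_if: "(c \<Longrightarrow> delt s) \<Longrightarrow> (\<not> c \<Longrightarrow> delt t) \<Longrightarrow> delt (\<lambda>w. if c then s w else t w)"
  by (cases c) auto

lemma delt_const: "a \<in> Dom M \<Longrightarrow> delt (\<lambda>w. a)"
  unfolding delt_def by (intro bexI[of _ "Inr a"]) auto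

lemma delt_nth: "dtup n t \<Longrightarrow> i < n \<Longrightarrow> delt (\<lambda>w. t w i)"
  by (auto simp: dtup_def)

lemma delt_comp:
  assumes "delt t" "\<And>b i. delt (\<lambda>w. T w b i)"
  shows "delt (\<lambda>w. t (T w))"
proof -
  obtain s where s: "s \<in> sources" "\<forall>w\<in>envs. t w = look w s"
    using assms(1) by (auto simp: delt_def)
  have T: "T w \<in> envs" if "w \<in> envs" for w using delt_in[OF assms(2) that] by auto
  show ?thesis
  proof (cases s)
    case (Inl p)
    then have "t (T w) = T w (fst p) (snd p)" if "w \<in> envs" for w
      using s(2) T[OF that] by (auto simp: look_def)
    then show ?thesis using assms(2)[of "fst p" "snd p"] by (auto simp: delt_def)
  next
    case (Inr a)
    then have "t (T w) = a" if "w \<in> envs" for w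
      using s(2) T[OF that] by (auto simp: look_def)
    then show ?thesis using delt_const[of a] s(1) Inr by (auto simp: delt_def)
  qed
qed

lemma dfn_sat:
  assumes "wf_fm L \<phi>" "\<And>v. v \<in> fv \<phi> \<Longrightarrow> delt (\<lambda>w. t w v)"
  shows "dfn (\<lambda>w. sat M (t w) \<phi>)"
proof -
  obtain d where d: "d \<in> Dom M" using Dom_ne by auto
  have "\<exists>s. s \<in> sources \<and> (v \<in> fv \<phi> \<longrightarrow> (\<forall>w\<in>envs. t w v = look w s))" for v
    using assms(2)[of v] d unfolding delt_def by (cases "v \<in> fv \<phi>") blast+
  then have "\<exists>\<sigma>. \<forall>v. \<sigma> v \<in> sources \<and> (v \<in> fv \<phi> \<longrightarrow> (\<forall>w\<in>envs. t w v = look w (\<sigma> v)))"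
    by (intro choice allI)
  then obtain \<sigma> where \<sigma>: "\<And>v. \<sigma> v \<in> sources"
    "\<And>v w. v \<in> fv \<phi> \<Longrightarrow> w \<in> envs \<Longrightarrow> t w v = look w (\<sigma> v)"
    by blast
  show ?thesis unfolding dfn_def using assms(1) \<sigma>
    by (intro exI[of _ \<phi>] exI[of _ \<sigma>]) (auto intro!: sat_cong)
qed

lemma delt_look: "s \<in> sources \<Longrightarrow> (\<And>b i. delt (\<lambda>w. T w b i)) \<Longrightarrow>
    delt (\<lambda>w. look (T w) s)"
  by (cases s) (auto simp: look_def delt_const)

lemma dfn_comp:
  assumes "dfn P" "\<And>b i. delt (\<lambda>w. T w b i)"
  shows "dfn (\<lambda>w. P (T w))"
proof -
  obtain \<phi> \<sigma> where *: "wf_fm L \<phi>" "\<And>v. \<sigma> v \<in> sources"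
    "\<And>w. w \<in> envs \<Longrightarrow> P w \<longleftrightarrow> sat M (\<lambda>v. look w (\<sigma> v)) \<phi>"
    using assms(1) by (auto simp: dfn_def)
  have T: "T w \<in> envs" if "w \<in> envs" for w using delt_in[OF assms(2) that] by auto
  have "dfn (\<lambda>w. sat M (\<lambda>v. look (T w) (\<sigma> v)) \<phi>)"
    using * assms(2) by (intro dfn_sat delt_look) auto
  then show ?thesis by (rule dfn_congI) (rule *(3)[OF T, symmetric])
qed

lemma dfn_neg: "dfn P \<Longrightarrow> dfn (\<lambda>w. \<not> P w)"
proof -
  assume "dfn P"
  then obtain \<phi> \<sigma> where "wf_fm L \<phi>" "\<And>v. \<sigma> v \<in> sources"
    "\<And>w. w \<in> envs \<Longrightarrow> P w \<longleftrightarrow> sat M (\<lambda>v. look w (\<sigma> v)) \<phi>"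
    by (auto simp: dfn_def)
  then show ?thesis unfolding dfn_def by (intro exI[of _ "Neg \<phi>"] exI[of _ \<sigma>]) auto
qed

lemma dfn_conj:
  assumes "dfn P" "dfn Q"
  shows "dfn (\<lambda>w. P w \<and> Q w)"
proof -
  obtain \<phi> \<sigma> where \<phi>: "wf_fm L \<phi>" "\<And>v. \<sigma> v \<in> sources"
    "\<And>w. w \<in> envs \<Longrightarrow> P w \<longleftrightarrow> sat M (\<lambda>v. look w (\<sigma> v)) \<phi>"
    using assms(1) by (auto simp: dfn_def)
  obtain \<psi> \<tau> where \<psi>: "wf_fm L \<psi>" "\<And>v. \<tau> v \<in> sources"
    "\<And>w. w \<in> envs \<Longrightarrow> Q w \<longleftrightarrow> sat M (\<lambda>v. look w (\<tau> v)) \<psi>"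
    using assms(2) by (auto simp: dfn_def)
  \<comment> \<open>Even variables serve \<open>\<phi>\<close> and odd ones \<open>\<psi>\<close>,
    since the two formulas may use the same variable with different sources.\<close>
  obtain \<phi>' where \<phi>': "wf_fm L \<phi>'" "\<And>e. sat M e \<phi>' \<longleftrightarrow> sat M (\<lambda>v. e (2 * v)) \<phi>"
    using substitution_formula[OF \<phi>(1), of M "\<lambda>v. 2 * v"] by blast
  obtain \<psi>' where \<psi>': "wf_fm L \<psi>'" "\<And>e. sat M e \<psi>' \<longleftrightarrow> sat M (\<lambda>v. e (2 * v + 1)) \<psi>"
    using substitution_formula[OF \<psi>(1), of M "\<lambda>v. 2 * v + 1"] by blast
  define \<rho> where "\<rho> v = (if even v then \<sigma> (v div 2) else \<tau> (v div 2))" for v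
  have "dfn (\<lambda>w. sat M (\<lambda>v. look w (\<rho> v)) (Conj \<phi>' \<psi>'))"
    using \<phi>' \<psi>' \<phi>(2) \<psi>(2) by (intro dfn_sat delt_look delt_var) (auto simp: \<rho>_def)
  moreover have "sat M (\<lambda>v. look w (\<rho> v)) (Conj \<phi>' \<psi>') \<longleftrightarrow> P w \<and> Q w" if "w \<in> envs" for w
    using \<phi>(3)[OF that] \<psi>(3)[OF that] by (simp add: \<phi>'(2) \<psi>'(2) \<rho>_def)
  ultimately show ?thesis by (rule dfn_congI)
qed

lemma dfn_disj: "dfn P \<Longrightarrow> dfn Q \<Longrightarrow> dfn (\<lambda>w. P w \<or> Q w)"
  using dfn_neg[OF dfn_conj[OF dfn_neg dfn_neg, of P Q]] by simp

lemma dfn_imp: "dfn P \<Longrightarrow> dfn Q \<Longrightarrow> dfn (\<lambda>w. P w \<longrightarrow> Q w)"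
  unfolding imp_conv_disj by (intro dfn_disj dfn_neg)

lemma dfn_eq: "delt s \<Longrightarrow> delt t \<Longrightarrow> dfn (\<lambda>w. s w = t w)"
proof -
  assume "delt s" "delt t"
  then have "delt (\<lambda>w. if v = 0 then s w else t w)" for v :: nat
    by (cases "v = 0") auto
  then show ?thesis
    using dfn_sat[of "Equal (Var 0) (Var 1)" "\<lambda>w v. if v = 0 then s w else t w"] by auto
qed

lemma dfn_const: "dfn (\<lambda>w. c)"
proof -
  have "dfn (\<lambda>w. w 0 0 = w 0 0)" by (intro dfn_eq delt_var)
  then show ?thesis using dfn_neg[of "\<lambda>w. True"] by (cases c) auto
qed

text \<open>In the hypothesis the quantified element is \<open>w 0 0\<close> and the outer valuation
  is the tail \<open>\<lambda>b. w (Suc b)\<close>. All quantifier rules below follow this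
  convention.\<close>

lemma dfn_All:
  assumes "dfn (\<lambda>w. P (\<lambda>b. w (Suc b)) (w 0 0))"
  shows "dfn (\<lambda>w. \<forall>a\<in>Dom M. P w a)"
proof -
  obtain \<phi> \<sigma> where \<phi>: "wf_fm L \<phi>" "\<And>v. \<sigma> v \<in> sources"
    "\<And>w. w \<in> envs \<Longrightarrow> P (\<lambda>b. w (Suc b)) (w 0 0) \<longleftrightarrow> sat M (\<lambda>v. look w (\<sigma> v)) \<phi>"
    using assms(1) by (auto simp: dfn_def)
  \<comment> \<open>Every variable with a source in block 0 becomes the bound variable 0, whatever
    its entry. This is harmless: the predicate sees of block 0 only \<open>w 0 0\<close>, so it may
    be evaluated at a block that is constantly \<open>a\<close>.\<close>
  define \<rho> where "\<rho> v = (if \<exists>i. \<sigma> v = Inl (0, i) then 0 else Suc v)" for v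
  obtain \<phi>' where \<phi>': "wf_fm L \<phi>'" "\<And>e. sat M e \<phi>' \<longleftrightarrow> sat M (\<lambda>v. e (\<rho> v)) \<phi>"
    using substitution_formula[OF \<phi>(1), of M \<rho>] by blast
  have "dfn (\<lambda>w. sat M (\<lambda>v. look (case_nat (w 0) w) (\<sigma> (v - 1))) (Forall 0 \<phi>'))"
    using \<phi>(2) \<phi>'(1) by (intro dfn_sat delt_look delt_case_nat) auto
  moreover have "sat M (\<lambda>v. look (case_nat (w 0) w) (\<sigma> (v - 1))) (Forall 0 \<phi>') \<longleftrightarrow> (\<forall>a\<in>Dom M. P w a)"
    if w: "w \<in> envs" for w
  proof -
    have "sat M ((\<lambda>v. look (case_nat (w 0) w) (\<sigma> (v - 1)))(0 := a)) \<phi>' \<longleftrightarrow> P w a"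
      if a: "a \<in> Dom M" for a
    proof -
      have "sat M ((\<lambda>v. look (case_nat (w 0) w) (\<sigma> (v - 1)))(0 := a)) \<phi>' \<longleftrightarrow>
          sat M (\<lambda>v. look (case_nat (\<lambda>_. a) w) (\<sigma> v)) \<phi>"
        unfolding \<phi>'(2)
      proof (intro sat_cong)
          fix v
          show "((\<lambda>v. look (case_nat (w 0) w) (\<sigma> (v - 1)))(0 := a)) (\<rho> v) = look (case_nat (\<lambda>_. a) w) (\<sigma> v)"
          proof (cases "\<exists>i. \<sigma> v = Inl (0, i)")
            case False
            then show ?thesis
              by (cases "\<sigma> v") (auto simp: \<rho>_def look_def gr0_conv_Suc split: nat.split)
          qed (auto simp: \<rho>_def)
        qed
      also have "\<dots> \<longleftrightarrow> P w a"
        using \<phi>(3)[of "case_nat (\<lambda>_. a) w"] a w by (auto split: nat.split)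
      finally show ?thesis .
    qed
    then show ?thesis by simp
  qed
  ultimately show ?thesis by (rule dfn_congI)
qed

lemma pow_Suc_Ball: "(\<forall>u\<in>pow M (Suc n). Q u) \<longleftrightarrow> (\<forall>v\<in>pow M n. \<forall>a\<in>Dom M. Q (v(n := a)))"
  unfolding pow_def lessThan_Suc PiE_insert_eq by (auto simp: image_iff)

lemma pow_0: "pow M 0 = {\<lambda>_. undefined}"
  by (simp add: pow_def)

lemma dfn_Ball_pow:
  assumes "dfn (\<lambda>w. P (\<lambda>b. w (Suc b)) (restrict (w 0) {..<n}))"
  shows "dfn (\<lambda>w. \<forall>u\<in>pow M n. P w u)"
  using assms
proof (induction n arbitrary: P)
  case 0
  have "dfn (\<lambda>w. P w (\<lambda>_. undefined))"
    using dfn_comp[OF 0, of "\<lambda>w. case_nat (w 0) w"] delt_case_nat[of 0] by (simp add: restrict_def)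
  then show ?case by (simp add: pow_0)
next
  case (Suc n)
  have "dfn (\<lambda>w. \<forall>v\<in>pow M n. \<forall>a\<in>Dom M. P w (v(n := a)))"
  proof (intro Suc.IH dfn_All)
    \<comment> \<open>\<open>T\<close> fuses the quantified element with the tuple: block 1 below
      \<open>n\<close> and the entry \<open>w 0 0\<close> become one tuple of length
      \<open>Suc n\<close>, and the later blocks move down by one.\<close>
    define T :: "(nat \<Rightarrow> nat \<Rightarrow> 'a) \<Rightarrow> nat \<Rightarrow> nat \<Rightarrow> 'a" where
      "T w b i = (if b = 0 then if i < n then w 1 i else w 0 0 else w (Suc b) i)" for w b i
    have "dfn (\<lambda>w. P (\<lambda>b. T w (Suc b)) (restrict (T w 0) {..<Suc n}))"
      by (rule dfn_comp[OF Suc.prems]) (unfold T_def, intro delt_if delt_var)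
    moreover have "restrict (T w 0) {..<Suc n} = (restrict (w (Suc 0)) {..<n})(n := w 0 0)" for w
      by (auto simp: T_def)
    moreover have "(\<lambda>b. T w (Suc b)) = (\<lambda>b. w (Suc (Suc b)))" for w
      by (intro ext) (simp add: T_def)
    ultimately show "dfn (\<lambda>w. P (\<lambda>b. w (Suc (Suc b))) ((restrict (w (Suc 0)) {..<n})(n := w 0 0)))"
      by simp
  qed
  then show ?case by (simp add: pow_Suc_Ball)
qed

lemma dfn_Bex_pow:
  assumes "dfn (\<lambda>w. P (\<lambda>b. w (Suc b)) (restrict (w 0) {..<n}))"
  shows "dfn (\<lambda>w. \<exists>u\<in>pow M n. P w u)"
  using dfn_neg[OF dfn_Ball_pow[OF dfn_neg, of P n]] assms by simp

lemma dfn_mem: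
  assumes "definable L M n X" "dtup n t"
  shows "dfn (\<lambda>w. t w \<in> X)"
proof -
  obtain \<phi> e where \<phi>: "wf_fm L \<phi>" "range e \<subseteq> Dom M"
    "X = {x \<in> pow M n. sat M (\<lambda>i. if i < n then x i else e i) \<phi>}"
    using assms(1) by (auto simp: definable_def)
  have "dfn (\<lambda>w. sat M (\<lambda>i. if i < n then t w i else e i) \<phi>)"
  proof (intro dfn_sat \<phi>)
    fix v
    show "delt (\<lambda>w. if v < n then t w v else e v)"
      using assms(2) \<phi>(2) by (cases "v < n") (auto simp: dtup_def intro!: delt_const)
  qed
  then show ?thesis
    unfolding \<phi>(3) using dtup_in[OF assms(2)] by (subst dfn_cong) auto
qed

lemma definable_Collect:
  assumes "dfn (\<lambda>w. P (restrict (w 0) {..<n}))"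
  shows "definable L M n {x \<in> pow M n. P x}"
proof -
  obtain \<phi> \<sigma> where \<phi>: "wf_fm L \<phi>" "\<And>v. \<sigma> v \<in> sources"
    "\<And>w. w \<in> envs \<Longrightarrow> P (restrict (w 0) {..<n}) \<longleftrightarrow> sat M (\<lambda>v. look w (\<sigma> v)) \<phi>"
    using assms(1) by (auto simp: dfn_def)
  obtain d where d: "d \<in> Dom M" using Dom_ne by auto
  \<comment> \<open>\<open>definable\<close> reserves the variables below \<open>n\<close> for the
    coordinates, so the parameters are moved to \<open>n + v\<close>. Sources that are other
    variables do not influence \<open>P\<close> and receive the dummy value
    \<open>d\<close>.\<close>
  define \<rho> where "\<rho> v = (case \<sigma> v of Inl p \<Rightarrow> if fst p = 0 \<and> snd p < n then snd p else n + v | Inr a \<Rightarrow> n + v)" for v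
  obtain \<phi>' where \<phi>': "wf_fm L \<phi>'" "\<And>e. sat M e \<phi>' \<longleftrightarrow> sat M (\<lambda>v. e (\<rho> v)) \<phi>"
    using substitution_formula[OF \<phi>(1), of M \<rho>] by blast
  define e where "e v = look (\<lambda>_ _. d) (\<sigma> (v - n))" for v
  have e: "range e \<subseteq> Dom M" using \<phi>(2) look_in[of "\<lambda>_ _. d"] d by (auto simp: e_def)
  have "P x \<longleftrightarrow> sat M (\<lambda>i. if i < n then x i else e i) \<phi>'" if x: "x \<in> pow M n" for x
  proof -
    define w where "w = (\<lambda>b i. if b = (0::nat) \<and> i < n then x i else d)"
    have w: "w \<in> envs" using x d by (auto simp: w_def)
    have "restrict (w 0) {..<n} = x" using x by (auto simp: w_def pow_def PiE_def extensional_def)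
    then have "P x \<longleftrightarrow> sat M (\<lambda>v. look w (\<sigma> v)) \<phi>" using \<phi>(3)[OF w] by simp
    also have "\<dots> \<longleftrightarrow> sat M (\<lambda>v. if \<rho> v < n then x (\<rho> v) else e (\<rho> v)) \<phi>"
      by (intro sat_cong) (auto simp: \<rho>_def e_def w_def look_def split: sum.split)
    finally show ?thesis by (simp add: \<phi>'(2))
  qed
  then show ?thesis unfolding definable_def using \<phi>'(1) e by blast
qed

lemma definable_subset: "definable L M n X \<Longrightarrow> X \<subseteq> pow M n"
  by (auto simp: definable_def)

lemma dfn_Ball_set:
  assumes "definable L M n X" "dfn (\<lambda>w. P (\<lambda>b. w (Suc b)) (restrict (w 0) {..<n}))"
  shows "dfn (\<lambda>w. \<forall>u\<in>X. P w u)"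
proof -
  have "dtup n (\<lambda>w. restrict (w 0) {..<n})" by (auto simp: dtup_def delt_var)
  then have "dfn (\<lambda>w. \<forall>u\<in>pow M n. u \<in> X \<longrightarrow> P w u)"
    by (intro dfn_Ball_pow dfn_imp dfn_mem[OF assms(1)] assms(2))
  moreover have "(\<forall>u\<in>pow M n. u \<in> X \<longrightarrow> P w u) \<longleftrightarrow> (\<forall>u\<in>X. P w u)" for w
    using definable_subset[OF assms(1)] by auto
  ultimately show ?thesis by simp
qed

lemma dfn_Bex_set:
  assumes "definable L M n X" "dfn (\<lambda>w. P (\<lambda>b. w (Suc b)) (restrict (w 0) {..<n}))"
  shows "dfn (\<lambda>w. \<exists>u\<in>X. P w u)"
  using dfn_neg[OF dfn_Ball_set[OF assms(1) dfn_neg, of P]] assms by simp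

lemma dtup_var: "dtup n (\<lambda>w. restrict (w b) {..<n})"
  by (auto simp: dtup_def delt_var)

lemma dtup_const: "c \<in> pow M n \<Longrightarrow> dtup n (\<lambda>w. c)"
  by (auto simp: dtup_def pow_def PiE_def intro!: delt_const)

lemma dtup_append: "dtup n s \<Longrightarrow> dtup m t \<Longrightarrow> dtup (n + m) (\<lambda>w. append_pt n m (s w) (t w))"
proof -
  assume *: "dtup n s" "dtup m t"
  have "delt (\<lambda>w. if i < n then s w i else t w (i - n))" if "i < n + m" for i
    using * that by (cases "i < n") (auto simp: dtup_def)
  then show ?thesis unfolding dtup_def append_pt_def by simp
qed

lemma dtup_coord_proj: "dtup n t \<Longrightarrow> s ` {..<k} \<subseteq> {..<n} \<Longrightarrow> dtup k (\<lambda>w. coord_proj k s (t w))"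
  unfolding dtup_def coord_proj_def by (auto simp: image_subset_iff)

lemma dtup_upd: "dtup n s \<Longrightarrow> i < n \<Longrightarrow> delt t \<Longrightarrow> dtup n (\<lambda>w. (s w)(i := t w))"
proof -
  assume *: "dtup n s" "i < n" "delt t"
  have "delt (\<lambda>w. ((s w)(i := t w)) j)" if "j < n" for j
    using * that by (cases "j = i") (auto simp: dtup_def)
  then show ?thesis using * unfolding dtup_def by (auto simp: extensional_def)
qed

lemma dtup_restrict: "dtup n t \<Longrightarrow> k \<le> n \<Longrightarrow> dtup k (\<lambda>w. restrict (t w) {..<k})"
  by (auto simp: dtup_def)

lemma dtup_snoc: "dtup n s \<Longrightarrow> delt t \<Longrightarrow> dtup (Suc n) (\<lambda>w. (s w)(n := t w))"
proof -
  assume *: "dtup n s" "delt t"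
  have "delt (\<lambda>w. ((s w)(n := t w)) j)" if "j < Suc n" for j
    using * that by (cases "j = n") (auto simp: dtup_def)
  then show ?thesis using * unfolding dtup_def by (auto simp: extensional_def)
qed

lemma dtup_single: "delt t \<Longrightarrow> dtup 1 (\<lambda>w. \<lambda>i\<in>{..<1}. t w)"
  by (auto simp: dtup_def)

lemma dfn_tup_eq: "dtup n s \<Longrightarrow> dtup n t \<Longrightarrow> dfn (\<lambda>w. s w = t w)"
proof -
  assume *: "dtup n s" "dtup n t"
  have "dfn (\<lambda>w. \<forall>i<k. s w i = t w i)" if "k \<le> n" for k
    using that
  proof (induction k)
    case (Suc k)
    then have "dfn (\<lambda>w. (\<forall>i<k. s w i = t w i) \<and> s w k = t w k)"
      using * by (intro dfn_conj dfn_eq delt_nth) auto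
    moreover have "(\<forall>i<Suc k. s w i = t w i) \<longleftrightarrow> (\<forall>i<k. s w i = t w i) \<and> s w k = t w k" for w
      by (auto simp: less_Suc_eq)
    ultimately show ?case by simp
  qed (simp add: dfn_const)
  from this[of n] have "dfn (\<lambda>w. \<forall>i<n. s w i = t w i)" by simp
  moreover have "(\<forall>i<n. s w i = t w i) \<longleftrightarrow> s w = t w" if "w \<in> envs" for w
  proof
    assume "\<forall>i<n. s w i = t w i"
    then show "s w = t w" using * that unfolding dtup_def
      by (intro extensionalityI[of _ "{..<n}"]) auto
  qed simp
  ultimately show ?thesis by (rule dfn_congI)
qed

lemma dfn_finite_all:
  assumes "finite I" "\<And>i. i \<in> I \<Longrightarrow> dfn (P i)"
  shows "dfn (\<lambda>w. \<forall>i\<in>I. P i w)"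
  using assms
proof (induction I)
  case (insert i I)
  then have "dfn (\<lambda>w. P i w \<and> (\<forall>i\<in>I. P i w))" by (intro dfn_conj) auto
  then show ?case by simp
qed (simp add: dfn_const)

lemma definable_pow: "definable L M n (pow M n)"
  using definable_Collect[of "\<lambda>_. True" n] dfn_const by simp

lemma definable_empty: "definable L M n {}"
  using definable_Collect[of "\<lambda>_. False" n] dfn_const by simp

lemma definable_sub_Collect:
  assumes "definable L M n X" "dfn (\<lambda>w. P (restrict (w 0) {..<n}))"
  shows "definable L M n {x \<in> X. P x}"
proof -
  have "definable L M n {x \<in> pow M n. x \<in> X \<and> P x}"
    by (intro definable_Collect dfn_conj assms dfn_mem[OF assms(1)] dtup_var)
  moreover have "{x \<in> pow M n. x \<in> X \<and> P x} = {x \<in> X. P x}"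
    using definable_subset[OF assms(1)] by auto
  ultimately show ?thesis by simp
qed

lemma definable_Int: "definable L M n X \<Longrightarrow> definable L M n Y \<Longrightarrow> definable L M n (X \<inter> Y)"
  using definable_sub_Collect[of n X "\<lambda>x. x \<in> Y"] dfn_mem[of n Y] dtup_var
  by (auto simp: Int_def)

lemma definable_Diff: "definable L M n X \<Longrightarrow> definable L M n Y \<Longrightarrow> definable L M n (X - Y)"
  using definable_sub_Collect[of n X "\<lambda>x. x \<notin> Y"] dfn_neg[OF dfn_mem[of n Y]] dtup_var
  by (auto simp: set_diff_eq)

lemma definable_Un:
  assumes "definable L M n X" "definable L M n Y"
  shows "definable L M n (X \<union> Y)"
proof -
  have "definable L M n (pow M n - ((pow M n - X) \<inter> (pow M n - Y)))"
    by (intro definable_Diff definable_Int definable_pow assms)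
  moreover have "pow M n - ((pow M n - X) \<inter> (pow M n - Y)) = X \<union> Y"
    using assms[THEN definable_subset] by auto
  ultimately show ?thesis by simp
qed

lemma definable_UN:
  "finite I \<Longrightarrow> (\<And>i. i \<in> I \<Longrightarrow> definable L M n (X i)) \<Longrightarrow> definable L M n (\<Union>i\<in>I. X i)"
  by (induction I rule: finite_induct) (auto intro: definable_empty definable_Un)

end

section \<open>Saturation\<close>

context fo_structure
begin

text \<open>Brings a definable unary predicate into the shape that \<open>saturated\<close> speaks
  about: the element is variable 0, and one valuation holds the parameters.\<close>

lemma parameter_formula:
  assumes "dfn (\<lambda>w. Q (w 0 0))"
  shows "\<exists>\<phi> e. wf_fm L \<phi> \<and> range e \<subseteq> Dom M \<and> (\<forall>a\<in>Dom M. sat M (e(0 := a)) \<phi> \<longleftrightarrow> Q a)"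
proof -
  obtain \<phi> \<sigma> where \<phi>: "wf_fm L \<phi>" "\<And>v. \<sigma> v \<in> sources"
    "\<And>w. w \<in> envs \<Longrightarrow> Q (w 0 0) \<longleftrightarrow> sat M (\<lambda>v. look w (\<sigma> v)) \<phi>"
    using assms by (auto simp: dfn_def)
  obtain d where d: "d \<in> Dom M" using Dom_ne by auto
  define \<rho> where "\<rho> v = (if \<sigma> v = Inl (0, 0) then 0 else Suc v)" for v
  obtain \<phi>' where \<phi>': "wf_fm L \<phi>'" "\<And>e. sat M e \<phi>' \<longleftrightarrow> sat M (\<lambda>v. e (\<rho> v)) \<phi>"
    using substitution_formula[OF \<phi>(1), of M \<rho>] by blast
  define e where "e v = look (\<lambda>_ _. d) (\<sigma> (v - 1))" for v
  have e: "range e \<subseteq> Dom M" using \<phi>(2) look_in[of "\<lambda>_ _. d"] d by (auto simp: e_def)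
  have "sat M (e(0 := a)) \<phi>' \<longleftrightarrow> Q a" if a: "a \<in> Dom M" for a
  proof -
    define w where "w b i = (if b = 0 \<and> i = 0 then a else d)" for b i :: nat
    have w: "w \<in> envs" using a d by (auto simp: w_def)
    have "sat M (e(0 := a)) \<phi>' \<longleftrightarrow> sat M (\<lambda>v. look w (\<sigma> v)) \<phi>"
      unfolding \<phi>'(2)
    proof (rule sat_cong)
      fix v
      show "(e(0 := a)) (\<rho> v) = look w (\<sigma> v)"
        by (cases "\<sigma> v") (auto simp: \<rho>_def e_def w_def look_def)
    qed
    also have "\<dots> \<longleftrightarrow> Q a" using \<phi>(3)[OF w] by (simp add: w_def)
    finally show ?thesis .
  qed
  then show ?thesis using \<phi>'(1) e by blast
qed

text \<open>The formulas \<open>x_i = x_i\<close> are already infinitely many, so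
  \<open>\<kappa>\<close> exceeds every countable cardinal. Hence the parameters of countably many
  formulas form a small set.\<close>

lemma countable_less_card:
  assumes "|{\<phi> :: ('f, 'r) fm. wf_fm L \<phi>}| <o \<kappa>" "countable A"
  shows "|A| <o \<kappa>"
proof -
  have "inj_on (\<lambda>a. Equal (Var (to_nat_on A a)) (Var (to_nat_on A a)) :: ('f, 'r) fm) A"
    using inj_on_to_nat_on[OF assms(2)] by (auto simp: inj_on_def)
  then have "|A| \<le>o |{\<phi> :: ('f, 'r) fm. wf_fm L \<phi>}|"
    by (intro card_of_ordLeq[THEN iffD1] exI conjI) auto
  then show ?thesis using assms(1) ordLeq_ordLess_trans by blast
qed

lemma saturated_element:
  assumes "saturated \<kappa> L M" "|{\<phi> :: ('f, 'r) fm. wf_fm L \<phi>}| <o \<kappa>"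
    and Q: "\<And>j. dfn (\<lambda>w. Q j (w 0 0))"
    and ne: "\<And>j :: nat. \<exists>a\<in>Dom M. Q j a"
    and dec: "\<And>i j a. i \<le> j \<Longrightarrow> Q j a \<Longrightarrow> Q i a"
  shows "\<exists>a\<in>Dom M. \<forall>j. Q j a"
proof -
  have "\<forall>j. \<exists>\<phi>e. wf_fm L (fst \<phi>e) \<and> range (snd \<phi>e) \<subseteq> Dom M \<and>
      (\<forall>a\<in>Dom M. sat M ((snd \<phi>e)(0 := a)) (fst \<phi>e) \<longleftrightarrow> Q j a)"
    using parameter_formula[OF Q] by simp
  from choice[OF this] obtain F where F': "\<forall>j. wf_fm L (fst (F j)) \<and> range (snd (F j)) \<subseteq> Dom M \<and>
      (\<forall>a\<in>Dom M. sat M ((snd (F j))(0 := a)) (fst (F j)) \<longleftrightarrow> Q j a)" ..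
  have F: "wf_fm L (fst (F j))" "range (snd (F j)) \<subseteq> Dom M"
    "a \<in> Dom M \<Longrightarrow> sat M ((snd (F j))(0 := a)) (fst (F j)) \<longleftrightarrow> Q j a" for j a
    using F'[rule_format, of j] by auto
  define A where "A = (\<Union>j. range (snd (F j)))"
  have A: "A \<subseteq> Dom M" "|A| <o \<kappa>"
    using F(2) countable_less_card[OF assms(2), of A] by (auto simp: A_def)
  have "\<exists>a\<in>Dom M. \<forall>(\<phi>, e)\<in>q. sat M (e(0 := a)) \<phi>" if q: "finite q" "q \<subseteq> range F" for q
  proof -
    obtain J where J: "finite J" "q = F ` J" using q finite_subset_image by metis
    \<comment> \<open>As \<open>Q\<close> is decreasing, an element for the largest index realises
      the whole finite subtype; 0 is inserted for the case that \<open>J\<close> is empty.\<close>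
    obtain a where a: "a \<in> Dom M" "Q (Max (insert 0 J)) a" using ne by blast
    have "Q j a" if "j \<in> J" for j
      using dec[OF _ a(2), of j] J(1) that by simp
    then have "sat M ((snd x)(0 := a)) (fst x)" if "x \<in> q" for x
      using that J(2) F(3)[OF a(1)] by auto
    then show ?thesis using a(1) by (intro bexI[OF _ a(1)]) (auto split: prod.split)
  qed
  moreover have "\<forall>(\<phi>, e)\<in>range F. wf_fm L \<phi> \<and> e ` (fv \<phi> - {0}) \<subseteq> A"
  proof -
    have "wf_fm L (fst x) \<and> snd x ` (fv (fst x) - {0}) \<subseteq> A" if "x \<in> range F" for x
      using F(1) that by (auto simp: A_def)
    then show ?thesis by (simp add: case_prod_beta)
  qed
  ultimately have "\<exists>a\<in>Dom M. \<forall>(\<phi>, e)\<in>range F. sat M (e(0 := a)) \<phi>"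
    using A by (intro assms(1)[unfolded saturated_def, rule_format, of A "range F"] conjI allI impI) auto
  then obtain a where a: "a \<in> Dom M" "\<forall>x\<in>range F. sat M ((snd x)(0 := a)) (fst x)"
    by (auto simp: case_prod_beta)
  have "Q j a" for j
    using a(2) F(3)[OF a(1)] by auto
  then show ?thesis using a(1) by blast
qed

text \<open>Saturation realises types of single elements. The last coordinate is chosen first, so
  that every \<open>X j\<close> keeps a nonempty fibre over it; these fibres are again definable and
  decreasing, and induction on \<open>m\<close> supplies the other coordinates.\<close>

lemma saturated_decreasing:
  assumes "saturated \<kappa> L M" "|{\<phi> :: ('f, 'r) fm. wf_fm L \<phi>}| <o \<kappa>"
    and "\<And>j. definable L M m (X j)" "\<And>j :: nat. X j \<noteq> {}" "\<And>i j. i \<le> j \<Longrightarrow> X j \<subseteq> X i"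
  shows "(\<Inter>j. X j) \<noteq> {}"
  using assms(3-)
proof (induction m arbitrary: X)
  case 0
  have "X j = {\<lambda>_. undefined}" for j
    using definable_subset[OF 0(1), of j] 0(2)[of j] by (auto simp: pow_0)
  then show ?case by simp
next
  case (Suc m)
  have "\<exists>a\<in>Dom M. \<forall>j. \<exists>v\<in>pow M m. v(m := a) \<in> X j"
  proof (rule saturated_element[OF assms(1,2)])
    show "dfn (\<lambda>w. \<exists>v\<in>pow M m. v(m := w 0 0) \<in> X j)" for j
      by (intro dfn_Bex_pow dfn_mem[OF Suc.prems(1)] dtup_snoc dtup_var delt_var)
    show "\<exists>a\<in>Dom M. \<exists>v\<in>pow M m. v(m := a) \<in> X j" for j
      using pow_Suc_Ball[of m "\<lambda>x. x \<notin> X j"] definable_subset[OF Suc.prems(1), of j] Suc.prems(2)[of j]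
      by blast
    show "\<exists>v\<in>pow M m. v(m := a) \<in> X i" if "i \<le> j" "\<exists>v\<in>pow M m. v(m := a) \<in> X j" for i j a
      using that Suc.prems(3) by blast
  qed
  then obtain a where a: "a \<in> Dom M" "\<And>j. \<exists>v\<in>pow M m. v(m := a) \<in> X j" by blast
  have "(\<Inter>j. {v \<in> pow M m. v(m := a) \<in> X j}) \<noteq> {}"
  proof (rule Suc.IH)
    show "definable L M m {v \<in> pow M m. v(m := a) \<in> X j}" for j
      by (intro definable_Collect dfn_mem[OF Suc.prems(1)] dtup_snoc dtup_var delt_const a(1))
  qed (use a(2) Suc.prems(3) in blast)+
  then show ?case by blast
qed

end

section \<open>Topology on the powers of the structure\<close>

text \<open>\<open>decreasing\<close> is the form in which saturation is used from here on.
  \<open>Bs\<close> is the basis as a family indexed by \<open>kb\<close>-tuples, and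
  \<open>dfn_Bs\<close> allows formulas to quantify over basic open sets through their
  indices.\<close>

locale tame_structure = fo_structure L M for L :: "('f, 'r) language" and M :: "('f, 'r, 'a) struct" +
  fixes S :: "'a topology" and Bs :: "'a point \<Rightarrow> 'a set" and kb :: nat
  assumes decreasing: "(\<And>j. definable L M m (X j)) \<Longrightarrow> (\<And>j :: nat. X j \<noteq> {}) \<Longrightarrow>
      (\<And>i j. i \<le> j \<Longrightarrow> X j \<subseteq> X i) \<Longrightarrow> (\<Inter>j. X j) \<noteq> {}"
    and base: "base_of S (Bs ` pow M kb)"
    and dfn_Bs: "delt t \<Longrightarrow> dtup kb s \<Longrightarrow> dfn (\<lambda>w. t w \<in> Bs (s w))"
    and topspace_S: "topspace S = Dom M"
    and Hausdorff_S: "Hausdorff_space S"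
    and interior_iff: "D \<subseteq> Dom M \<Longrightarrow> definable L M 1 {x \<in> pow M 1. x 0 \<in> D} \<Longrightarrow>
      S interior_of D \<noteq> {} \<longleftrightarrow> infinite D"
    and nice_S: "nice L M S"
begin

lemma openin_Bs: "b \<in> pow M kb \<Longrightarrow> openin S (Bs b)"
  using base unfolding base_of_def by (auto intro: arbitrary_union_of_inc)

lemma openin_S_Bs: "openin S U \<Longrightarrow> a \<in> U \<Longrightarrow> \<exists>b\<in>pow M kb. a \<in> Bs b \<and> Bs b \<subseteq> U"
  using base unfolding base_of_def union_of_def arbitrary_def by auto blast

text \<open>\<open>interior_iff\<close> speaks of definable sets, hence the passage to a basic open
  subset.\<close>

lemma infinite_open:
  assumes "openin S U" "U \<noteq> {}" shows "infinite U"
proof -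
  obtain a where "a \<in> U" using assms by auto
  then obtain b where b: "b \<in> pow M kb" "a \<in> Bs b" "Bs b \<subseteq> U" using openin_S_Bs assms by blast
  have "definable L M 1 {x \<in> pow M 1. x 0 \<in> Bs b}"
    by (intro definable_Collect dfn_Bs dtup_const delt_nth[OF dtup_var] b) simp
  moreover have "S interior_of Bs b \<noteq> {}" "Bs b \<subseteq> Dom M"
    using interior_of_openin[OF openin_Bs[OF b(1)]] openin_subset[OF openin_Bs[OF b(1)]] b(2) topspace_S by auto
  ultimately have "infinite (Bs b)" using interior_iff by blast
  then show ?thesis using b(3) finite_subset by blast
qed

lemma infinite_Dom: "infinite (Dom M)"
  using infinite_open[OF openin_topspace] Dom_ne topspace_S by metis

lemma infinite_interior:
  assumes "dfn (\<lambda>w. w 0 0 \<in> D)" "D \<subseteq> Dom M" "infinite D"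
  shows "\<exists>b\<in>pow M kb. Bs b \<noteq> {} \<and> Bs b \<subseteq> D"
proof -
  have "definable L M 1 {x \<in> pow M 1. x 0 \<in> D}"
    using assms(1) by (intro definable_Collect) simp
  then have "S interior_of D \<noteq> {}" using interior_iff assms by blast
  then obtain a where a: "a \<in> S interior_of D" by auto
  obtain b where "b \<in> pow M kb" "a \<in> Bs b" "Bs b \<subseteq> S interior_of D"
    using openin_S_Bs[OF openin_interior_of a] by blast
  then show ?thesis using interior_of_subset[of S D] by blast
qed

lemma noint_finite:
  assumes "dfn (\<lambda>w. w 0 0 \<in> D)" "D \<subseteq> Dom M" "\<And>b. b \<in> pow M kb \<Longrightarrow> Bs b \<subseteq> D \<Longrightarrow> Bs b = {}"
  shows "finite D"
  using infinite_interior[OF assms(1,2)] assms(3) by blast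

text \<open>Each \<open>U j\<close> may be replaced by a basic set \<open>Bs (c j)\<close>. The
  indices of basic neighbourhoods of \<open>a\<close> that lie inside \<open>Bs (c 0)\<close> up to
  \<open>Bs (c N)\<close> then form a definable nonempty set that decreases with \<open>N\<close>,
  and saturation picks one index for all \<open>j\<close>.\<close>

lemma open_Int_nbhds:
  assumes "\<And>j :: nat. openin S (U j)" "\<And>j. a \<in> U j"
  shows "\<exists>b\<in>pow M kb. a \<in> Bs b \<and> (\<forall>j. Bs b \<subseteq> U j)"
proof -
  have "\<forall>j. \<exists>b. b \<in> pow M kb \<and> a \<in> Bs b \<and> Bs b \<subseteq> U j" using openin_S_Bs assms by blast
  from choice[OF this] obtain c where "\<forall>j. c j \<in> pow M kb \<and> a \<in> Bs (c j) \<and> Bs (c j) \<subseteq> U j" ..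
  then have c: "c j \<in> pow M kb" "a \<in> Bs (c j)" "Bs (c j) \<subseteq> U j" for j by auto
  have a: "a \<in> Dom M" using assms openin_subset topspace_S by blast
  define X where "X N = {b \<in> pow M kb. a \<in> Bs b \<and> (\<forall>j\<in>{..N}. \<forall>x\<in>Dom M. x \<in> Bs b \<longrightarrow> x \<in> Bs (c j))}" for N
  have "(\<Inter>N. X N) \<noteq> {}"
  proof (rule decreasing)
    show "definable L M kb (X N)" for N
      unfolding X_def by (intro definable_Collect dfn_conj dfn_finite_all dfn_All dfn_imp dfn_Bs
        dtup_var dtup_const delt_var delt_const a c finite_atMost)
    show "X N \<noteq> {}" for N
    proof -
      have "openin S (\<Inter>j\<in>{..N}. Bs (c j))" "a \<in> (\<Inter>j\<in>{..N}. Bs (c j))"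
        using c openin_Bs by (auto intro!: openin_INT2)
      from openin_S_Bs[OF this] obtain b where "b \<in> pow M kb" "a \<in> Bs b" "Bs b \<subseteq> (\<Inter>j\<in>{..N}. Bs (c j))"
        by (elim bexE conjE)
      then show ?thesis by (auto simp: X_def)
    qed
    show "X j \<subseteq> X i" if "i \<le> j" for i j using that by (auto simp: X_def)
  qed
  then obtain b where b: "\<And>N. b \<in> X N" by blast
  have "Bs b \<subseteq> Dom M" using b[of 0] openin_Bs[of b] openin_subset topspace_S by (auto simp: X_def)
  then have "Bs b \<subseteq> U j" for j using b[of j] c(3)[of j] by (auto simp: X_def)
  then show ?thesis using b[of 0] by (auto simp: X_def)
qed

lemma open_Int_countable:
  assumes "countable I" "\<And>i. i \<in> I \<Longrightarrow> openin S (U i)" "\<And>i. i \<in> I \<Longrightarrow> a \<in> U i" "a \<in> Dom M"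
  shows "\<exists>b\<in>pow M kb. a \<in> Bs b \<and> (\<forall>i\<in>I. Bs b \<subseteq> U i)"
proof (cases "I = {}")
  case True
  then show ?thesis using openin_S_Bs[OF openin_topspace, of a] assms(4) topspace_S by auto
next
  case False
  then have *: "range (from_nat_into I) = I" using assms(1) by (rule range_from_nat_into)
  then have "from_nat_into I j \<in> I" for j by blast
  then obtain b where "b \<in> pow M kb" "a \<in> Bs b" "\<forall>j. Bs b \<subseteq> U (from_nat_into I j)"
    using open_Int_nbhds[of "\<lambda>j. U (from_nat_into I j)" a] assms(2,3) by blast
  then show ?thesis using * by (metis rangeE)
qed

section \<open>Boxes and interiors in the powers\<close>

lemma topspace_pow_top: "topspace (pow_top S n) = pow M n"
  by (simp add: pow_top_def pow_def topspace_S)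

lemma Hausdorff_pow: "Hausdorff_space (pow_top S n)"
  by (simp add: pow_top_def Hausdorff_space_product_topology Hausdorff_S)

text \<open>A tuple of length \<open>n * kb\<close> codes \<open>n\<close> indices of basic sets,
  stored one after another. Thus a product of \<open>n\<close> basic sets has a single index, and a
  quantifier over boxes is a quantifier over one power of the structure.\<close>

definition crd :: "nat \<Rightarrow> 'a point \<Rightarrow> 'a point" where
  "crd i b = (\<lambda>j\<in>{..<kb}. b (i * kb + j))"

definition Box :: "nat \<Rightarrow> 'a point \<Rightarrow> 'a point set" where
  "Box n b = {x \<in> pow M n. \<forall>i\<in>{..<n}. x i \<in> Bs (crd i b)}"

lemma crd_bound: "i < n \<Longrightarrow> j < kb \<Longrightarrow> i * kb + j < n * (kb :: nat)"
  using mult_le_mono1[of "Suc i" n kb] by simp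

lemma dtup_crd: "dtup (n * kb) s \<Longrightarrow> i < n \<Longrightarrow> dtup kb (\<lambda>w. crd i (s w))"
  by (auto simp: dtup_def crd_def crd_bound)

lemma crd_in: "b \<in> pow M (n * kb) \<Longrightarrow> i < n \<Longrightarrow> crd i b \<in> pow M kb"
  by (auto simp: pow_def crd_def PiE_iff crd_bound)

lemma dfn_Box: "dtup n t \<Longrightarrow> dtup (n * kb) s \<Longrightarrow> dfn (\<lambda>w. t w \<in> Box n (s w))"
proof -
  assume *: "dtup n t" "dtup (n * kb) s"
  have "dfn (\<lambda>w. \<forall>i\<in>{..<n}. t w i \<in> Bs (crd i (s w)))"
    using * by (intro dfn_finite_all dfn_Bs delt_nth dtup_crd) auto
  then show ?thesis by (rule dfn_congI) (use dtup_in[OF *(1)] in \<open>auto simp: Box_def\<close>)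
qed

lemma definable_Box: "b \<in> pow M (n * kb) \<Longrightarrow> definable L M n (Box n b)"
  using definable_Collect[OF dfn_Box[OF dtup_var dtup_const], of b n] by (simp add: Box_def)

lemma Box_eq: "b \<in> pow M (n * kb) \<Longrightarrow> Box n b = Pi\<^sub>E {..<n} (\<lambda>i. Bs (crd i b))"
proof -
  assume b: "b \<in> pow M (n * kb)"
  have "Bs (crd i b) \<subseteq> Dom M" if "i < n" for i
    using openin_subset[OF openin_Bs[OF crd_in[OF b that]]] topspace_S by simp
  then show ?thesis
    unfolding Box_def pow_def set_eq_iff PiE_iff mem_Collect_eq lessThan_iff Ball_def by blast
qed

lemma open_Box: "b \<in> pow M (n * kb) \<Longrightarrow> openin (pow_top S n) (Box n b)"
  unfolding Box_eq pow_top_def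
  by (subst openin_PiE_gen) (auto intro!: disjI2 openin_Bs crd_in)

lemma Box_nbhd:
  assumes "openin (pow_top S n) U" "x \<in> U"
  shows "\<exists>b\<in>pow M (n * kb). x \<in> Box n b \<and> Box n b \<subseteq> U"
proof -
  from assms(1)[unfolded pow_top_def openin_product_topology_alt, rule_format, OF assms(2)]
  obtain V where V: "\<forall>i\<in>{..<n}. openin S (V i)" "x \<in> Pi\<^sub>E {..<n} V" "Pi\<^sub>E {..<n} V \<subseteq> U"
    by (elim exE conjE)
  have "\<forall>i. \<exists>c. i < n \<longrightarrow> c \<in> pow M kb \<and> x i \<in> Bs c \<and> Bs c \<subseteq> V i"
    using openin_S_Bs V(1,2) by (metis PiE_mem lessThan_iff)
  from choice[OF this] obtain c where
    c: "\<forall>i. i < n \<longrightarrow> c i \<in> pow M kb \<and> x i \<in> Bs (c i) \<and> Bs (c i) \<subseteq> V i" ..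
  define b where "b = (\<lambda>l\<in>{..<n * kb}. c (l div kb) (l mod kb))"
  have "l div kb < n \<and> l mod kb < kb" if "l < n * kb" for l
    using that by (simp add: less_mult_imp_div_less) (cases "kb = 0", auto)
  then have b: "b \<in> pow M (n * kb)" using c by (auto simp: b_def pow_def PiE_iff)
  have crd: "crd i b = c i" if "i < n" for i
  proof (rule extensionalityI[of _ "{..<kb}"])
    show "crd i b j = c i j" if "j \<in> {..<kb}" for j
      using that \<open>i < n\<close> crd_bound[of i n j] by (auto simp: crd_def b_def)
  qed (use c that in \<open>auto simp: crd_def pow_def PiE_def\<close>)
  have "x \<in> Box n b"
    unfolding Box_eq[OF b] using c V(2) crd by (simp add: PiE_iff)
  moreover have "Box n b \<subseteq> Pi\<^sub>E {..<n} V"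
    unfolding Box_eq[OF b] using c crd by (intro PiE_mono) simp
  ultimately have "x \<in> Box n b \<and> Box n b \<subseteq> U" using V(3) by blast
  then show ?thesis using b by blast
qed

definition hasint :: "nat \<Rightarrow> 'a point set \<Rightarrow> bool" where
  "hasint n X \<longleftrightarrow> (\<exists>b\<in>pow M (n * kb). Box n b \<noteq> {} \<and> Box n b \<subseteq> X)"

lemma hasint_iff_interior: "hasint n X \<longleftrightarrow> pow_top S n interior_of X \<noteq> {}"
proof
  assume "hasint n X"
  then show "pow_top S n interior_of X \<noteq> {}"
    unfolding hasint_def using interior_of_maximal[OF _ open_Box] by blast
next
  assume "pow_top S n interior_of X \<noteq> {}"
  then obtain x where x: "x \<in> pow_top S n interior_of X" by auto
  then obtain b where "b \<in> pow M (n * kb)" "x \<in> Box n b" "Box n b \<subseteq> pow_top S n interior_of X"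
    using Box_nbhd[OF openin_interior_of x] by blast
  then show "hasint n X" unfolding hasint_def using interior_of_subset[of "pow_top S n" X] by blast
qed

lemma hasintI: "openin (pow_top S n) U \<Longrightarrow> U \<noteq> {} \<Longrightarrow> U \<subseteq> X \<Longrightarrow> hasint n X"
  unfolding hasint_iff_interior by (metis interior_of_maximal subset_empty)

lemma hasintE:
  assumes "hasint n X"
  obtains U where "definable L M n U" "openin (pow_top S n) U" "U \<noteq> {}" "U \<subseteq> X"
  using assms open_Box definable_Box unfolding hasint_def by blast

lemma hasint_mono: "hasint n X \<Longrightarrow> X \<subseteq> Y \<Longrightarrow> hasint n Y"
  unfolding hasint_def by blast

lemma definable_interior:
  assumes "definable L M n X"
  shows "definable L M n (pow_top S n interior_of X)"
proof -
  have "definable L M n {x \<in> pow M n. \<exists>b\<in>pow M (n * kb). x \<in> Box n b \<and> (\<forall>y\<in>pow M n. y \<in> Box n b \<longrightarrow> y \<in> X)}"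
    by (intro definable_Collect dfn_Bex_pow dfn_conj dfn_Box dtup_var dfn_Ball_pow dfn_imp dfn_mem[OF assms])
  moreover have "{x \<in> pow M n. \<exists>b\<in>pow M (n * kb). x \<in> Box n b \<and> (\<forall>y\<in>pow M n. y \<in> Box n b \<longrightarrow> y \<in> X)} =
      pow_top S n interior_of X" (is "?A = _")
  proof
    show "?A \<subseteq> pow_top S n interior_of X"
      using interior_of_maximal[OF _ open_Box] by (auto simp: Box_def) blast
    show "pow_top S n interior_of X \<subseteq> ?A"
    proof
      fix x assume x: "x \<in> pow_top S n interior_of X"
      then obtain b where "b \<in> pow M (n * kb)" "x \<in> Box n b" "Box n b \<subseteq> pow_top S n interior_of X"
        using Box_nbhd[OF openin_interior_of x] by blast
      then show "x \<in> ?A" using interior_of_subset[of "pow_top S n" X] by (auto simp: Box_def)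
    qed
  qed
  ultimately show ?thesis by simp
qed

text \<open>Links \<open>dim\<close> with \<open>hasint\<close>: the bound \<open>dim < n\<close>
  that niceness gives for the exceptional set turns into emptiness of its interior. The identity
  projection attains \<open>k = n\<close>, and a strictly increasing \<open>s\<close> cannot embed
  more than \<open>n\<close> coordinates.\<close>

lemma dim_full:
  assumes "X \<subseteq> pow M n" "hasint n X"
  shows "dim S n X = ereal (real n)"
proof -
  let ?P = "\<lambda>k. \<exists>s. strict_mono_on {..<k} s \<and> s ` {..<k} \<subseteq> {..<n} \<and>
        pow_top S k interior_of (coord_proj k s ` X) \<noteq> {}"
  have "coord_proj n id x = x" if "x \<in> X" for x
    using assms(1) that by (force simp: coord_proj_def pow_def PiE_def extensional_restrict)
  then have "coord_proj n id ` X = X" by force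
  then have "?P n" using assms(2) hasint_iff_interior
    by (intro exI[of _ id]) (auto simp: strict_mono_on_def)
  moreover have "k \<le> n" if "?P k" for k
  proof -
    obtain s where s: "strict_mono_on {..<k} s" "s ` {..<k} \<subseteq> {..<n}" using \<open>?P k\<close> by blast
    then have "card {..<k} \<le> card {..<n}"
      by (intro card_inj_on_le[of s]) (auto intro: strict_mono_on_imp_inj_on)
    then show ?thesis by simp
  qed
  ultimately have "(GREATEST k. ?P k) = n" by (rule Greatest_equality)
  moreover have "X \<noteq> {}" using assms(2) by (auto simp: hasint_def)
  ultimately show ?thesis unfolding dim_def by simp
qed

section \<open>Generic continuity and unions of sets without interior\<close>

lemma generic_continuity_corr:
  assumes "definable L M n U" "openin (pow_top S n) U" "correspondence k U (pow M m) f"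
    "definable L M (n + m) (corr_graph n m U f)"
  obtains U0 where "U0 \<subseteq> U" "definable L M n U0" "openin (pow_top S n) U0" "\<not> hasint n (U - U0)"
    "continuous_corr k (subtopology (pow_top S n) U0) (pow_top S m) f"
proof -
  obtain U0 where U0: "U0 \<subseteq> U" "definable L M n U0" "openin (pow_top S n) U0"
      "dim S n (U - U0) < ereal (real n)"
      "continuous_corr k (subtopology (pow_top S n) U0) (pow_top S m) f"
    using nice_S[unfolded nice_def, rule_format, OF conjI[OF assms(1) conjI[OF assms(2) conjI[OF assms(3,4)]]]]
    by (elim exE conjE)
  have "\<not> hasint n (U - U0)"
  proof
    assume "hasint n (U - U0)"
    moreover have "U - U0 \<subseteq> pow M n" using definable_subset[OF assms(1)] by blast
    ultimately have "dim S n (U - U0) = ereal (real n)" by (intro dim_full)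
    then show False using U0(4) by simp
  qed
  then show ?thesis using that U0 by blast
qed

lemma continuous_map_local:
  assumes "\<And>x. x \<in> topspace X \<Longrightarrow> \<exists>V. openin X V \<and> x \<in> V \<and> continuous_map (subtopology X V) Y f"
  shows "continuous_map X Y f"
  unfolding continuous_map_atin limitin_def
proof (intro ballI conjI allI impI)
  fix x assume x: "x \<in> topspace X"
  obtain V where V: "openin X V" "x \<in> V" "continuous_map (subtopology X V) Y f" using assms[OF x] by blast
  have xV: "x \<in> topspace (subtopology X V)" using V x by simp
  show "f x \<in> topspace Y" using continuous_map_image_subset_topspace[OF V(3)] xV by blast
  fix W assume W: "openin Y W \<and> f x \<in> W"
  have "openin (subtopology X V) {y \<in> topspace (subtopology X V). f y \<in> W}"
    using V(3) W by (auto simp: continuous_map_def)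
  then have "openin X {y \<in> topspace (subtopology X V). f y \<in> W}"
    using V(1) openin_trans_full by blast
  moreover have "x \<in> {y \<in> topspace (subtopology X V). f y \<in> W}" using xV W by blast
  ultimately show "\<forall>\<^sub>F x in atin X x. f x \<in> W"
    unfolding eventually_atin by blast
qed

lemma generic_continuity:
  assumes "definable L M n U" "openin (pow_top S n) U" "F ` U \<subseteq> pow M m"
    "definable L M (n + m) {append_pt n m x (F x) | x. x \<in> U}"
  obtains U0 where "U0 \<subseteq> U" "definable L M n U0" "openin (pow_top S n) U0" "\<not> hasint n (U - U0)"
    "continuous_map (subtopology (pow_top S n) U0) (pow_top S m) F"
proof -
  have "corr_graph n m U (\<lambda>x. {F x}) = {append_pt n m x (F x) | x. x \<in> U}"
    by (auto simp: corr_graph_def)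
  then have 2: "definable L M (n + m) (corr_graph n m U (\<lambda>x. {F x}))" using assms(4) by simp
  have 1: "correspondence 1 U (pow M m) (\<lambda>x. {F x})"
    using assms(3) by (auto simp: correspondence_def)
  obtain U0 where U0: "U0 \<subseteq> U" "definable L M n U0" "openin (pow_top S n) U0" "\<not> hasint n (U - U0)"
    "continuous_corr 1 (subtopology (pow_top S n) U0) (pow_top S m) (\<lambda>x. {F x})"
    by (rule generic_continuity_corr[OF assms(1,2) 1 2])
  have "continuous_map (subtopology (pow_top S n) U0) (pow_top S m) F"
  proof (rule continuous_map_local)
    fix x assume x: "x \<in> topspace (subtopology (pow_top S n) U0)"
    from U0(5)[unfolded continuous_corr_def, rule_format, OF x] obtain V g where Vg: "openin (subtopology (pow_top S n) U0) V" "x \<in> V"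
      "\<forall>i<1. continuous_map (subtopology (subtopology (pow_top S n) U0) V) (pow_top S m) (g i)"
      "\<forall>x'\<in>V. {F x'} = {g i x' | i. i < (1::nat)}"
      by (elim exE conjE)
    then have "\<forall>x'\<in>V. F x' = g 0 x'" by auto
    then have "continuous_map (subtopology (subtopology (pow_top S n) U0) V) (pow_top S m) F"
      using Vg(3) by (auto elim!: continuous_map_eq)
    then show "\<exists>V. openin (subtopology (pow_top S n) U0) V \<and> x \<in> V \<and>
      continuous_map (subtopology (subtopology (pow_top S n) U0) V) (pow_top S m) F" using Vg by blast
  qed
  then show ?thesis using that U0 by blast
qed

text \<open>Niceness is applied to the map that is \<open>c\<close> on \<open>A\<close> and
  \<open>d\<close> elsewhere. Where this map is continuous, the Hausdorff property makes both
  \<open>A\<close> and its complement open, and one of them is nonempty there.\<close>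

lemma hasint_Un:
  assumes "definable L M n A" "definable L M n B" "hasint n (A \<union> B)"
  shows "hasint n A \<or> hasint n B"
proof -
  obtain U where U: "definable L M n U" "openin (pow_top S n) U" "U \<noteq> {}" "U \<subseteq> A \<union> B"
    using assms(3) by (rule hasintE)
  obtain c d where cd: "c \<in> Dom M" "d \<in> Dom M" "c \<noteq> d"
    using infinite_Dom by (metis finite.simps finite_subset insertI1 subsetI)
  define F where "F x = (\<lambda>_\<in>{..<1::nat}. if x \<in> A then c else d)" for x
  have F: "F ` U \<subseteq> pow M 1" using cd by (auto simp: F_def pow_def PiE_iff extensional_def split: if_splits)
  have "definable L M (n + 1) {z \<in> pow M (n + 1). \<exists>x\<in>pow M n. x \<in> U \<and>
      (x \<in> A \<longrightarrow> z = append_pt n 1 x (\<lambda>_\<in>{..<1}. c)) \<and> (x \<notin> A \<longrightarrow> z = append_pt n 1 x (\<lambda>_\<in>{..<1}. d))}"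
    by (intro definable_Collect dfn_Bex_pow dfn_conj dfn_imp dfn_neg dfn_mem[OF U(1)] dfn_mem[OF assms(1)]
      dtup_var dfn_tup_eq[where n = "n + 1"] dtup_append dtup_single delt_const cd)
  moreover have "{z \<in> pow M (n + 1). \<exists>x\<in>pow M n. x \<in> U \<and>
      (x \<in> A \<longrightarrow> z = append_pt n 1 x (\<lambda>_\<in>{..<1}. c)) \<and> (x \<notin> A \<longrightarrow> z = append_pt n 1 x (\<lambda>_\<in>{..<1}. d))} =
      {append_pt n 1 x (F x) | x. x \<in> U}" (is "?A = ?B")
  proof
    show "?A \<subseteq> ?B" by (auto simp: F_def)
    show "?B \<subseteq> ?A"
    proof
      fix z assume "z \<in> ?B"
      then obtain x where x: "z = append_pt n 1 x (F x)" "x \<in> U" by blast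
      have "x \<in> pow M n" using definable_subset[OF U(1)] x by blast
      moreover have "z \<in> pow M (n + 1)"
        unfolding x(1) using \<open>x \<in> pow M n\<close> cd by (auto simp: append_pt_def pow_def F_def PiE_iff)
      ultimately show "z \<in> ?A" using x by (auto simp: F_def)
    qed
  qed
  ultimately have "definable L M (n + 1) {append_pt n 1 x (F x) | x. x \<in> U}" by simp
  with U(1,2) F obtain U0 where U0: "U0 \<subseteq> U" "definable L M n U0" "openin (pow_top S n) U0" "\<not> hasint n (U - U0)"
    "continuous_map (subtopology (pow_top S n) U0) (pow_top S 1) F"
    by (rule generic_continuity)
  \<comment> \<open>If \<open>U0\<close> were empty, the exceptional set would be all of the
    nonempty open set \<open>U\<close>.\<close>
  have "U0 \<noteq> {}" using U0(4) U(2,3) hasintI[of n U "U - U0"] by auto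
  then obtain x where x: "x \<in> U0" by auto
  have "continuous_map (subtopology (pow_top S n) U0) S (\<lambda>x. F x 0)"
    using continuous_map_compose[OF U0(5)[unfolded pow_top_def[of S 1]] continuous_map_product_projection[of 0]]
    by (simp add: comp_def pow_top_def)
  moreover have "openin S (Dom M - {c})" "openin S (Dom M - {d})"
    using closedin_Hausdorff_singleton[OF Hausdorff_S] cd topspace_S openin_diff openin_topspace by metis+
  ultimately have *: "openin (subtopology (pow_top S n) U0) {y \<in> topspace (subtopology (pow_top S n) U0). F y 0 \<in> Dom M - {c}}"
    "openin (subtopology (pow_top S n) U0) {y \<in> topspace (subtopology (pow_top S n) U0). F y 0 \<in> Dom M - {d}}"
    by (auto simp: continuous_map_def)
  have "{y \<in> topspace (subtopology (pow_top S n) U0). F y 0 \<in> Dom M - {c}} = U0 - A"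
    "{y \<in> topspace (subtopology (pow_top S n) U0). F y 0 \<in> Dom M - {d}} = U0 \<inter> A"
    using U0(2)[THEN definable_subset] topspace_pow_top cd by (auto simp: F_def)
  then have "openin (pow_top S n) (U0 - A)" "openin (pow_top S n) (U0 \<inter> A)"
    using * U0(3) openin_trans_full by metis+
  moreover have "U0 - A \<subseteq> B" "U0 \<inter> A \<subseteq> A" using U0(1) U(4) by auto
  moreover have "U0 - A \<noteq> {} \<or> U0 \<inter> A \<noteq> {}" using x by auto
  ultimately show ?thesis using hasintI by metis
qed

lemma not_hasint_empty: "\<not> hasint n {}"
  by (auto simp: hasint_def)

lemma hasint_UN:
  assumes "finite I" "\<And>i. i \<in> I \<Longrightarrow> definable L M n (X i)" "hasint n (\<Union>i\<in>I. X i)"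
  shows "\<exists>i\<in>I. hasint n (X i)"
  using assms
proof (induction I)
  case (insert i I)
  have "hasint n (X i) \<or> hasint n (\<Union>i\<in>I. X i)"
    using insert by (intro hasint_Un definable_UN) auto
  then show ?case using insert by auto
qed (simp add: not_hasint_empty)

lemma not_hasint_frontier:
  assumes "definable L M n X"
  shows "\<not> hasint n (X - pow_top S n interior_of X)"
proof
  assume "hasint n (X - pow_top S n interior_of X)"
  then obtain U where U: "definable L M n U" "openin (pow_top S n) U" "U \<noteq> {}"
      "U \<subseteq> X - pow_top S n interior_of X"
    by (rule hasintE)
  then have "U \<subseteq> pow_top S n interior_of X" by (intro interior_of_maximal) auto
  then show False using U by blast
qed

end

section \<open>Sets without interior\<close>

context tame_structure
begin

lemma continuous_coord_proj:
  assumes "s ` {..<k} \<subseteq> {..<n}"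
  shows "continuous_map (pow_top S n) (pow_top S k) (coord_proj k s)"
proof -
  have "continuous_map (pow_top S n) S (\<lambda>x. x (s i))" if "i < k" for i
    using assms that unfolding pow_top_def by (intro continuous_map_product_projection) auto
  then show ?thesis
    unfolding pow_top_def[of S k] continuous_map_componentwise by (auto simp: coord_proj_def)
qed

lemma continuous_nth: "i < n \<Longrightarrow> continuous_map (pow_top S n) S (\<lambda>x. x i)"
  unfolding pow_top_def by (intro continuous_map_product_projection) auto

lemma continuous_append:
  assumes "continuous_map X (pow_top S n) f" "continuous_map X (pow_top S m) g"
  shows "continuous_map X (pow_top S (n + m)) (\<lambda>x. append_pt n m (f x) (g x))"
proof -
  have "continuous_map X S (\<lambda>x. if i < n then f x i else g x (i - n))" if "i < n + m" for i
  proof (cases "i < n")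
    case True
    then show ?thesis using assms(1) unfolding pow_top_def continuous_map_componentwise by simp
  next
    case False
    then have "i - n \<in> {..<m}" using that by auto
    then show ?thesis using assms(2) False unfolding pow_top_def continuous_map_componentwise by simp
  qed
  then show ?thesis
    unfolding pow_top_def[of S "n + m"] continuous_map_componentwise by (auto simp: append_pt_def)
qed

lemma restrict_eq_coord_proj: "restrict x {..<k} = coord_proj k id x"
  by (simp add: coord_proj_def)

lemma openin_preimage: "continuous_map X Y f \<Longrightarrow> openin Y V \<Longrightarrow> openin X {x \<in> topspace X. f x \<in> V}"
  by (simp add: continuous_map_def)

lemma open_snoc:
  assumes "openin (pow_top S n) U" "openin S V"
  shows "openin (pow_top S (Suc n)) {z \<in> pow M (Suc n). restrict z {..<n} \<in> U \<and> z n \<in> V}"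
proof -
  have "openin (pow_top S (Suc n)) ({z \<in> topspace (pow_top S (Suc n)). coord_proj n id z \<in> U} \<inter>
      {z \<in> topspace (pow_top S (Suc n)). z n \<in> V})"
    using assms by (intro openin_Int openin_preimage[OF continuous_coord_proj] openin_preimage[OF continuous_nth]) auto
  then show ?thesis
    by (simp add: restrict_eq_coord_proj topspace_pow_top Int_def conj_ac cong: conj_cong)
qed

lemma restrict_upd_self:
  assumes "z \<in> pow M (Suc n)"
  shows "(restrict z {..<n})(n := z n) = z"
proof
  fix i
  show "((restrict z {..<n})(n := z n)) i = z i"
    using assms by (cases "i < Suc n") (auto simp: pow_def PiE_def extensional_def less_Suc_eq)
qed

lemma upd_in_pow_Suc: "x \<in> pow M n \<Longrightarrow> a \<in> Dom M \<Longrightarrow> x(n := a) \<in> pow M (Suc n)"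
  by (auto simp: pow_def PiE_def extensional_def less_Suc_eq)

lemma upd_in_pow: "x \<in> pow M n \<Longrightarrow> a \<in> Dom M \<Longrightarrow> i < n \<Longrightarrow> x(i := a) \<in> pow M n"
  by (auto simp: pow_def PiE_def extensional_def)

text \<open>Take a sequence \<open>t\<close> of distinct elements of the last factor. By induction,
  for each \<open>N\<close> some box of dimension \<open>n\<close> lies in the slices of
  \<open>E\<close> at \<open>t 0\<close>, ..., \<open>t N\<close>. The indices of such boxes
  decrease with \<open>N\<close>, so saturation gives one box that lies in the slices at all
  \<open>t j\<close>.\<close>

lemma hasint_grid:
  assumes "definable L M n E" "\<And>i. i < n \<Longrightarrow> infinite (A i)" "\<And>i. i < n \<Longrightarrow> A i \<subseteq> Dom M"
    "{x \<in> pow M n. \<forall>i<n. x i \<in> A i} \<subseteq> E"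
  shows "hasint n E"
  using assms
proof (induction n arbitrary: E)
  case 0
  then have "pow M 0 \<subseteq> E" by simp
  then show ?case
    using hasintI[of 0 "pow M 0"] openin_topspace[of "pow_top S 0"] pow_nonempty
    by (simp add: topspace_pow_top)
next
  case (Suc n)
  obtain t :: "nat \<Rightarrow> 'a" where t: "inj t" "range t \<subseteq> A n"
    using infinite_countable_subset[OF Suc.prems(2)[of n]] by auto
  have tD: "t j \<in> Dom M" for j using t(2) Suc.prems(3)[of n] by auto
  define X where "X N = {b \<in> pow M (n * kb). (\<exists>x\<in>pow M n. x \<in> Box n b) \<and>
      (\<forall>j\<in>{..N}. \<forall>y\<in>pow M n. y \<in> Box n b \<longrightarrow> y(n := t j) \<in> E)}" for N
  have "(\<Inter>N. X N) \<noteq> {}"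
  proof (rule decreasing)
    show "definable L M (n * kb) (X N)" for N
      unfolding X_def
      by (intro definable_Collect dfn_conj dfn_finite_all dfn_Bex_pow dfn_Ball_pow dfn_imp dfn_Box
        dfn_mem[OF Suc.prems(1)] dtup_snoc dtup_var delt_const tD finite_atMost)
    show "X N \<noteq> {}" for N
    proof -
      have "hasint n {x \<in> pow M n. \<forall>j\<in>{..N}. x(n := t j) \<in> E}"
      proof (rule Suc.IH)
        show "definable L M n {x \<in> pow M n. \<forall>j\<in>{..N}. x(n := t j) \<in> E}"
          by (intro definable_Collect dfn_finite_all dfn_mem[OF Suc.prems(1)] dtup_snoc dtup_var
            delt_const tD finite_atMost)
        show "{x \<in> pow M n. \<forall>i<n. x i \<in> A i} \<subseteq> {x \<in> pow M n. \<forall>j\<in>{..N}. x(n := t j) \<in> E}"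
        proof clarify
          fix x j assume x: "x \<in> pow M n" "\<forall>i<n. x i \<in> A i"
          have "x(n := t j) \<in> {x \<in> pow M (Suc n). \<forall>i<Suc n. x i \<in> A i}"
            using x t(2) tD by (auto intro!: upd_in_pow_Suc simp: less_Suc_eq)
          then show "x(n := t j) \<in> E" using Suc.prems(4) by blast
        qed
      qed (use Suc.prems in auto)
      then obtain b where b: "b \<in> pow M (n * kb)" "Box n b \<noteq> {}"
          "Box n b \<subseteq> {x \<in> pow M n. \<forall>j\<in>{..N}. x(n := t j) \<in> E}"
        unfolding hasint_def by (elim bexE conjE)
      have "b \<in> X N" unfolding X_def
      proof (intro CollectI conjI ballI impI b(1))
        show "\<exists>x\<in>pow M n. x \<in> Box n b" using b(2) unfolding Box_def by blast
        show "y(n := t j) \<in> E" if "y \<in> Box n b" "j \<in> {..N}" for y j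
          using subsetD[OF b(3) that(1)] that(2) by simp
      qed
      then show ?thesis by blast
    qed
    show "X j \<subseteq> X i" if "i \<le> j" for i j
      using that by (auto simp: X_def)
  qed
  then obtain b where b: "\<And>N. b \<in> X N" by blast
  have b1: "b \<in> pow M (n * kb)" "Box n b \<noteq> {}" using b[of 0] by (auto simp: X_def)
  \<comment> \<open>The elements whose slice contains the whole box. This set is definable and
    contains the infinite set \<open>range t\<close>, so by t-minimality it contains a basic open
    set, the last side of the box in dimension \<open>Suc n\<close>.\<close>
  define D where "D = {a \<in> Dom M. \<forall>y\<in>pow M n. y \<in> Box n b \<longrightarrow> y(n := a) \<in> E}"
  have "range t \<subseteq> D"
  proof clarify
    fix j show "t j \<in> D" using b[of j] tD by (auto simp: D_def X_def)
  qed
  then have "infinite D" using t(1) by (meson finite_subset range_inj_infinite)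
  moreover have "dfn (\<lambda>w. w 0 0 \<in> D)"
  proof (rule dfn_congI)
    show "dfn (\<lambda>w. \<forall>y\<in>pow M n. y \<in> Box n b \<longrightarrow> y(n := w 0 0) \<in> E)"
      by (intro dfn_Ball_pow dfn_imp dfn_Box dfn_mem[OF Suc.prems(1)] dtup_snoc dtup_var dtup_const
        delt_var b1)
  qed (simp add: D_def)
  ultimately obtain c where c: "c \<in> pow M kb" "Bs c \<noteq> {}" "Bs c \<subseteq> D"
    using infinite_interior[of D] by (auto simp: D_def)
  let ?U = "{z \<in> pow M (Suc n). restrict z {..<n} \<in> Box n b \<and> z n \<in> Bs c}"
  show ?case
  proof (rule hasintI)
    show "openin (pow_top S (Suc n)) ?U" by (intro open_snoc open_Box openin_Bs b1 c)
    obtain x a where "x \<in> Box n b" "a \<in> Bs c" using b1 c by blast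
    moreover have "restrict (x(n := a)) {..<n} = x" if "x \<in> pow M n"
      using that by (auto simp: pow_def PiE_def extensional_def)
    ultimately have "x(n := a) \<in> ?U" using c(3) by (auto simp: Box_def D_def intro!: upd_in_pow_Suc)
    then show "?U \<noteq> {}" by blast
    show "?U \<subseteq> E"
    proof clarify
      fix z assume z: "z \<in> pow M (Suc n)" "restrict z {..<n} \<in> Box n b" "z n \<in> Bs c"
      have "\<forall>y\<in>pow M n. y \<in> Box n b \<longrightarrow> y(n := z n) \<in> E"
        using z(3) c(3) by (auto simp: D_def)
      moreover have "restrict z {..<n} \<in> pow M n" using z(2) by (simp add: Box_def)
      ultimately have "(restrict z {..<n})(n := z n) \<in> E" using z(2) by blast
      then show "z \<in> E" using restrict_upd_self[OF z(1)] by simp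
    qed
  qed
qed

text \<open>Fibres of \<open>core n E\<close> need not be neighbourhoods within \<open>core n E\<close> itself, so the operator is
  iterated; by saturation the intersection of all iterates behaves like a fixed point.\<close>

definition core :: "nat \<Rightarrow> 'a point set \<Rightarrow> 'a point set" where
  "core n E = {x \<in> E. \<forall>i\<in>{..<n}. \<exists>c\<in>pow M kb. x i \<in> Bs c \<and> (\<forall>t\<in>Dom M. t \<in> Bs c \<longrightarrow> x(i := t) \<in> E)}"

lemma definable_core:
  assumes "definable L M n E" shows "definable L M n (core n E)"
  unfolding core_def
proof (intro definable_sub_Collect dfn_finite_all finite_lessThan assms)
  fix i assume "i \<in> {..<n}"
  then show "dfn (\<lambda>w. \<exists>c\<in>pow M kb. restrict (w 0) {..<n} i \<in> Bs c \<and>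
      (\<forall>t\<in>Dom M. t \<in> Bs c \<longrightarrow> (restrict (w 0) {..<n})(i := t) \<in> E))"
    by (intro dfn_Bex_pow dfn_conj dfn_Bs dfn_All dfn_imp dfn_mem[OF assms] dtup_upd dtup_var delt_var
      delt_nth[of n]) auto
qed

text \<open>In every direction, a point in all iterates has a neighbourhood that stays in all
  iterates. Starting from \<open>x\<close>, these neighbourhoods supply the factors of a grid one
  coordinate after another.\<close>

lemma core_iterates_grid:
  assumes "x \<in> pow M n" "\<And>k. x \<in> (core n ^^ k) E"
  shows "\<exists>A. (\<forall>i<n. infinite (A i) \<and> A i \<subseteq> Dom M) \<and> {x \<in> pow M n. \<forall>i<n. x i \<in> A i} \<subseteq> E"
proof -
  let ?P = "{y \<in> pow M n. \<forall>k. y \<in> (core n ^^ k) E}"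
  \<comment> \<open>There is one neighbourhood for each iterate; the countable intersection contains
    a neighbourhood that serves all of them.\<close>
  have nbhd: "\<exists>c\<in>pow M kb. y i \<in> Bs c \<and> (\<forall>t\<in>Bs c. y(i := t) \<in> ?P)" if y: "y \<in> ?P" "i < n" for y i
  proof -
    have "\<forall>k. \<exists>c. c \<in> pow M kb \<and> y i \<in> Bs c \<and> (\<forall>t\<in>Dom M. t \<in> Bs c \<longrightarrow> y(i := t) \<in> (core n ^^ k) E)"
    proof
      fix k
      have "y \<in> core n ((core n ^^ k) E)" using y(1) by (auto dest: spec[of _ "Suc k"])
      then show "\<exists>c. c \<in> pow M kb \<and> y i \<in> Bs c \<and> (\<forall>t\<in>Dom M. t \<in> Bs c \<longrightarrow> y(i := t) \<in> (core n ^^ k) E)"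
        using y(2) unfolding core_def by auto
    qed
    from choice[OF this] obtain c where c: "\<forall>k. c k \<in> pow M kb \<and> y i \<in> Bs (c k) \<and>
        (\<forall>t\<in>Dom M. t \<in> Bs (c k) \<longrightarrow> y(i := t) \<in> (core n ^^ k) E)" ..
    obtain b where b: "b \<in> pow M kb" "y i \<in> Bs b" "\<forall>k. Bs b \<subseteq> Bs (c k)"
      using open_Int_nbhds[of "\<lambda>k. Bs (c k)" "y i"] c openin_Bs by auto
    have "y(i := t) \<in> ?P" if "t \<in> Bs b" for t
    proof -
      have "t \<in> Dom M" using that openin_subset[OF openin_Bs[OF b(1)]] topspace_S by auto
      then show ?thesis using that b(3) c y by (auto intro!: upd_in_pow)
    qed
    then show ?thesis using b by blast
  qed
  \<comment> \<open>The coordinates from \<open>m\<close> on stay frozen at those of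
    \<open>x\<close>. The factors are kept countable so that the next coordinate meets only
    countably many points of the partial grid.\<close>
  have "\<exists>A. (\<forall>i<m. infinite (A i) \<and> countable (A i) \<and> A i \<subseteq> Dom M) \<and>
      {y \<in> pow M n. (\<forall>i<m. y i \<in> A i) \<and> (\<forall>i\<ge>m. y i = x i)} \<subseteq> ?P" if "m \<le> n" for m
    using that
  proof (induction m)
    case 0
    have "{y \<in> pow M n. (\<forall>i<0. y i \<in> undefined i) \<and> (\<forall>i\<ge>0. y i = x i)} \<subseteq> ?P"
    proof
      fix y assume "y \<in> {y \<in> pow M n. (\<forall>i<0. y i \<in> undefined i) \<and> (\<forall>i\<ge>0. y i = x i)}"
      then have "y = x" by auto
      then show "y \<in> ?P" using assms by simp
    qed
    then show ?case by (intro exI[of _ undefined]) simp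
  next
    case (Suc m)
    then obtain A where A: "\<forall>i<m. infinite (A i) \<and> countable (A i) \<and> A i \<subseteq> Dom M"
      "{y \<in> pow M n. (\<forall>i<m. y i \<in> A i) \<and> (\<forall>i\<ge>m. y i = x i)} \<subseteq> ?P" by auto
    let ?Y = "{y \<in> pow M n. (\<forall>i<m. y i \<in> A i) \<and> (\<forall>i\<ge>m. y i = x i)}"
    have "countable (Pi\<^sub>E {..<m} A)" using A(1) by (intro countable_PiE) auto
    moreover have "?Y \<subseteq> (\<lambda>f i. if i < m then f i else x i) ` Pi\<^sub>E {..<m} A"
    proof
      fix y assume y: "y \<in> ?Y"
      then have "y = (\<lambda>f i. if i < m then f i else x i) (restrict y {..<m})" by auto
      moreover have "restrict y {..<m} \<in> Pi\<^sub>E {..<m} A" using y by auto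
      ultimately show "y \<in> (\<lambda>f i. if i < m then f i else x i) ` Pi\<^sub>E {..<m} A" by blast
    qed
    ultimately have Y: "countable ?Y" by (meson countable_image countable_subset)
    have "\<forall>y. \<exists>c. y \<in> ?Y \<longrightarrow> c \<in> pow M kb \<and> y m \<in> Bs c \<and> (\<forall>t\<in>Bs c. y(m := t) \<in> ?P)"
    proof
      fix y
      show "\<exists>c. y \<in> ?Y \<longrightarrow> c \<in> pow M kb \<and> y m \<in> Bs c \<and> (\<forall>t\<in>Bs c. y(m := t) \<in> ?P)"
      proof (cases "y \<in> ?Y")
        case True
        then have "y \<in> ?P" using A(2) by (rule subsetD[rotated])
        with nbhd[OF this, of m] Suc.prems show ?thesis by auto
      qed auto
    qed
    from choice[OF this] obtain c where
      c: "\<forall>y. y \<in> ?Y \<longrightarrow> c y \<in> pow M kb \<and> y m \<in> Bs (c y) \<and> (\<forall>t\<in>Bs (c y). y(m := t) \<in> ?P)" ..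
    \<comment> \<open>All points of the partial grid share the coordinate \<open>x m\<close>, so
      what is intersected are countably many neighbourhoods of this one element.\<close>
    have "\<exists>b\<in>pow M kb. x m \<in> Bs b \<and> (\<forall>y\<in>?Y. Bs b \<subseteq> Bs (c y))"
    proof (rule open_Int_countable[OF Y])
      show "openin S (Bs (c y))" if "y \<in> ?Y" for y using c that openin_Bs by blast
      show "x m \<in> Bs (c y)" if "y \<in> ?Y" for y
      proof -
        have "y m \<in> Bs (c y)" "y m = x m" using c that by blast+
        then show ?thesis by simp
      qed
      show "x m \<in> Dom M" using assms(1) Suc.prems by auto
    qed
    then obtain b where b: "b \<in> pow M kb" "x m \<in> Bs b" "\<forall>y\<in>?Y. Bs b \<subseteq> Bs (c y)" by blast
    have "infinite (Bs b)" using infinite_open[OF openin_Bs[OF b(1)]] b(2) by blast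
    then obtain B where B: "B \<subseteq> Bs b" "infinite B" "countable B"
      using infinite_countable_subset' by metis
    have BD: "B \<subseteq> Dom M" using B(1) openin_subset[OF openin_Bs[OF b(1)]] topspace_S by auto
    have "y \<in> ?P" if y: "y \<in> pow M n" "\<forall>i<Suc m. y i \<in> (A(m := B)) i" "\<forall>i\<ge>Suc m. y i = x i" for y
    proof -
      have m: "x m \<in> Dom M" "m < n" using assms(1) Suc.prems by auto
      have Ym: "y(m := x m) \<in> ?Y"
        using y m by (auto intro!: upd_in_pow simp: less_Suc_eq)
      have "y m \<in> Bs b" using y(2)[rule_format, of m] B(1) by auto
      then have "y m \<in> Bs (c (y(m := x m)))" using bspec[OF b(3) Ym] by (rule subsetD[rotated])
      then have "(y(m := x m))(m := y m) \<in> ?P" using c[rule_format, OF Ym] by (elim conjE) (rule bspec)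
      then show ?thesis by simp
    qed
    then have "{y \<in> pow M n. (\<forall>i<Suc m. y i \<in> (A(m := B)) i) \<and> (\<forall>i\<ge>Suc m. y i = x i)} \<subseteq> ?P" by blast
    moreover have "\<forall>i<Suc m. infinite ((A(m := B)) i) \<and> countable ((A(m := B)) i) \<and> (A(m := B)) i \<subseteq> Dom M"
      using A(1) B BD by (auto simp: less_Suc_eq)
    ultimately show ?case by (intro exI[of _ "A(m := B)"] conjI)
  qed
  from this[OF order_refl] obtain A where A: "\<forall>i<n. infinite (A i) \<and> countable (A i) \<and> A i \<subseteq> Dom M"
      "{y \<in> pow M n. (\<forall>i<n. y i \<in> A i) \<and> (\<forall>i\<ge>n. y i = x i)} \<subseteq> ?P" by blast
  have "{y \<in> pow M n. \<forall>i<n. y i \<in> A i} \<subseteq> E"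
  proof clarify
    fix y assume y: "y \<in> pow M n" "\<forall>i<n. y i \<in> A i"
    have "\<forall>i\<ge>n. y i = x i" using y(1) assms(1) by (simp add: pow_def PiE_def extensional_def)
    then have "y \<in> ?P" using y A(2) by blast
    then have "y \<in> (core n ^^ 0) E" by blast
    then show "y \<in> E" by simp
  qed
  then show ?thesis using A(1) by blast
qed

text \<open>If every iterate of \<open>core\<close> were nonempty, saturation would give a point in
  all of them, hence a grid inside \<open>E\<close> and an interior. So some iterate is empty, and
  each point of \<open>E\<close> is expelled at one of finitely many stages, on account of one of
  \<open>n\<close> directions.\<close>

lemma noint_cover:
  assumes "definable L M n E" "\<not> hasint n E"
  shows "\<exists>\<D>. finite \<D> \<and> E = (\<Union>(i, D)\<in>\<D>. D) \<and>
    (\<forall>(i, D)\<in>\<D>. i < n \<and> definable L M n D \<and> (\<forall>x\<in>pow M n. finite {a \<in> Dom M. x(i := a) \<in> D}))"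
proof -
  let ?E = "\<lambda>k. (core n ^^ k) E"
  have defE: "definable L M n (?E k)" for k
    by (induction k) (auto intro: assms definable_core)
  have dec: "?E j \<subseteq> ?E i" if "i \<le> j" for i j
    using that by (induction rule: dec_induct) (auto simp: core_def)
  have "\<exists>k. ?E k = {}"
  proof (rule ccontr)
    assume "\<nexists>k. ?E k = {}"
    then have "(\<Inter>k. ?E k) \<noteq> {}" by (intro decreasing[OF defE] dec) auto
    then obtain x where x: "\<And>k. x \<in> ?E k" by blast
    have "x \<in> pow M n" using x[of 0] definable_subset[OF assms(1)] by auto
    from core_iterates_grid[OF this x] obtain A where
      "\<forall>i<n. infinite (A i) \<and> A i \<subseteq> Dom M" "{x \<in> pow M n. \<forall>i<n. x i \<in> A i} \<subseteq> E" by blast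
    then show False using hasint_grid[OF assms(1), of A] assms(2) by blast
  qed
  then obtain k where k: "?E k = {}" by blast
  \<comment> \<open>The points of the \<open>j\<close>-th iterate that are expelled at the next
    stage because of direction \<open>i\<close>.\<close>
  define F where "F j i = {x \<in> ?E j. \<not> (\<exists>c\<in>pow M kb. x i \<in> Bs c \<and> (\<forall>t\<in>Dom M. t \<in> Bs c \<longrightarrow> x(i := t) \<in> ?E j))}" for j i
  have defF: "definable L M n (F j i)" if "i < n" for j i
    unfolding F_def using that
    by (intro definable_sub_Collect defE dfn_neg dfn_Bex_pow dfn_conj dfn_Bs dfn_All dfn_imp
      dfn_mem[OF defE] dtup_upd dtup_var delt_var delt_nth[of n]) auto
  have fin: "finite {a \<in> Dom M. x(i := a) \<in> F j i}" if "i < n" "x \<in> pow M n" for x i j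
  proof (rule noint_finite)
    show "dfn (\<lambda>w. w 0 0 \<in> {a \<in> Dom M. x(i := a) \<in> F j i})"
    proof (rule dfn_congI)
      show "dfn (\<lambda>w. x(i := w 0 0) \<in> F j i)"
        using that by (intro dfn_mem[OF defF] dtup_upd dtup_const delt_var)
    qed simp
    \<comment> \<open>A nonempty basic open set inside such a fibre would itself be the
      neighbourhood whose absence defines \<open>F j i\<close>. So the fibre has no interior and is
      finite by t-minimality.\<close>
    fix b assume b: "b \<in> pow M kb" "Bs b \<subseteq> {a \<in> Dom M. x(i := a) \<in> F j i}"
    show "Bs b = {}"
    proof (rule ccontr)
      assume "Bs b \<noteq> {}"
      then obtain t where t: "t \<in> Bs b" by blast
      then have "x(i := t) \<in> F j i" using b by blast
      moreover have "(x(i := t))(i := t') \<in> ?E j" if "t' \<in> Bs b" for t'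
        using b(2) that by (auto simp: F_def)
      ultimately show False using b(1) t unfolding F_def by auto
    qed
  qed auto
  let ?D = "(\<lambda>(j, i). (i, F j i)) ` ({..<k} \<times> {..<n})"
  have "E \<subseteq> (\<Union>(i, D)\<in>?D. D)"
  proof
    fix x assume x: "x \<in> E"
    have "\<exists>j<k. x \<in> ?E j \<and> x \<notin> ?E (Suc j)"
    proof (rule ccontr)
      assume *: "\<not> (\<exists>j<k. x \<in> ?E j \<and> x \<notin> ?E (Suc j))"
      have "x \<in> ?E j" if "j \<le> k" for j
        using that by (induction j) (use * x in auto)
      then show False using k by auto
    qed
    then obtain j where j: "j < k" "x \<in> ?E j" "x \<notin> core n (?E j)" by auto
    then obtain i where "i < n" "x \<in> F j i" unfolding core_def F_def by blast
    then show "x \<in> (\<Union>(i, D)\<in>?D. D)" using j(1) by auto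
  qed
  moreover have "F j i \<subseteq> E" for j i using dec[of 0 j] by (auto simp: F_def)
  ultimately have "E = (\<Union>(i, D)\<in>?D. D)" by auto
  then show ?thesis using defF fin by (intro exI[of _ ?D]) auto
qed

section \<open>Cardinalities of finite fibres\<close>

lemma dfn_card_ge:
  assumes "dfn (\<lambda>w. P (\<lambda>b. w (Suc b)) (restrict (w 0) {..<m}))"
  shows "dfn (\<lambda>w. \<exists>Y. finite Y \<and> card Y = N \<and> Y \<subseteq> {y \<in> pow M m. P w y})"
  using assms
proof (induction N arbitrary: P)
  case 0
  have "\<exists>Y. finite Y \<and> card Y = 0 \<and> Y \<subseteq> {y \<in> pow M m. P w y}" for w
    by (intro exI[of _ "{}"]) auto
  then show ?case by (simp add: dfn_const)
next
  case (Suc N)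
  have eq: "(\<exists>Y. finite Y \<and> card Y = Suc N \<and> Y \<subseteq> {y \<in> pow M m. P w y}) \<longleftrightarrow>
      (\<exists>y\<in>pow M m. P w y \<and> (\<exists>Y. finite Y \<and> card Y = N \<and> Y \<subseteq> {y' \<in> pow M m. P w y' \<and> y' \<noteq> y}))" (is "?A \<longleftrightarrow> ?B") for w
  proof
    assume ?A
    then obtain Y where Y: "finite Y" "card Y = Suc N" "Y \<subseteq> {y \<in> pow M m. P w y}" by blast
    then obtain y where y: "y \<in> Y" by fastforce
    then have "card (Y - {y}) = N" "finite (Y - {y})" "Y - {y} \<subseteq> {y' \<in> pow M m. P w y' \<and> y' \<noteq> y}"
      using Y by auto
    then show ?B using y Y(3) by blast
  next
    assume ?B
    then obtain y Y where y: "y \<in> pow M m" "P w y" "finite Y" "card Y = N"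
      "Y \<subseteq> {y' \<in> pow M m. P w y' \<and> y' \<noteq> y}" by blast
    then have "y \<notin> Y" by auto
    then have "finite (insert y Y)" "card (insert y Y) = Suc N" "insert y Y \<subseteq> {y \<in> pow M m. P w y}"
      using y by auto
    then show ?A by blast
  qed
  \<comment> \<open>Here the predicate is applied to a second bound tuple; block 1, which holds the
    removed point \<open>y\<close>, has to be skipped.\<close>
  have 1: "dfn (\<lambda>w. P (\<lambda>b. w (Suc (Suc b))) (restrict (w 0) {..<m}))"
    using dfn_comp[OF Suc.prems, of "\<lambda>w b. if b = 0 then w 0 else w (Suc b)"]
    by (simp add: if_distrib[of "\<lambda>f. f _"] delt_if delt_var restrict_def)
  show ?case
    unfolding eq by (intro dfn_Bex_pow dfn_conj Suc.prems Suc.IH dfn_neg 1 dfn_tup_eq[where n = m] dtup_var)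
qed

definition fib :: "nat \<Rightarrow> nat \<Rightarrow> 'a point set \<Rightarrow> 'a point \<Rightarrow> 'a point set" where
  "fib d m A v = {y \<in> pow M m. append_pt d m v y \<in> A}"

lemma definable_fib_ge:
  assumes "definable L M (d + m) A"
  shows "definable L M d {v \<in> pow M d. \<exists>Y. finite Y \<and> card Y = N \<and> Y \<subseteq> fib d m A v}"
  unfolding fib_def
  by (intro definable_Collect dfn_card_ge dfn_mem[OF assms] dtup_append dtup_var)

text \<open>The sets of all \<open>v\<close> with at least \<open>N\<close> points in the fibre are
  definable and decrease with \<open>N\<close>. Were all of them nonempty, saturation would give a
  single \<open>v\<close> whose fibre has finite subsets of every size.\<close>

lemma fib_bound:
  assumes A: "definable L M (d + m) A" and fin: "\<And>v. v \<in> pow M d \<Longrightarrow> finite (fib d m A v)"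
  shows "\<exists>K. \<forall>v\<in>pow M d. card (fib d m A v) < K"
proof (rule ccontr)
  assume *: "\<not> ?thesis"
  let ?X = "\<lambda>N. {v \<in> pow M d. \<exists>Y. finite Y \<and> card Y = N \<and> Y \<subseteq> fib d m A v}"
  have "(\<Inter>N. ?X N) \<noteq> {}"
  proof (rule decreasing)
    show "?X N \<noteq> {}" for N
    proof -
      obtain v where v: "v \<in> pow M d" "N \<le> card (fib d m A v)" using * not_less by blast
      then obtain Y where "Y \<subseteq> fib d m A v" "card Y = N" "finite Y"
        using obtain_subset_with_card_n by metis
      then show ?thesis using v(1) by blast
    qed
    show "?X j \<subseteq> ?X i" if ij: "i \<le> j" for i j
    proof
      fix v assume "v \<in> ?X j"
      then obtain Y where Y: "v \<in> pow M d" "finite Y" "card Y = j" "Y \<subseteq> fib d m A v" by blast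
      then have "i \<le> card Y" using ij by simp
      then obtain Z where "Z \<subseteq> Y" "card Z = i" "finite Z"
        by (rule obtain_subset_with_card_n)
      then show "v \<in> ?X i" using Y by blast
    qed
  qed (rule definable_fib_ge[OF A])
  then obtain v where v: "\<And>N. v \<in> ?X N" by blast
  then have "v \<in> pow M d" by blast
  have "\<exists>Y. finite Y \<and> card Y = Suc (card (fib d m A v)) \<and> Y \<subseteq> fib d m A v"
    using v[of "Suc (card (fib d m A v))"] by (simp only: mem_Collect_eq)
  then obtain Y where "card Y = Suc (card (fib d m A v))" "Y \<subseteq> fib d m A v"
    by (elim exE conjE)
  then show False using card_mono[OF fin[OF \<open>v \<in> pow M d\<close>], of Y] by simp
qed

lemma definable_fib_card:
  assumes A: "definable L M (d + m) A" and fin: "\<And>v. v \<in> pow M d \<Longrightarrow> finite (fib d m A v)"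
  shows "definable L M d {v \<in> pow M d. card (fib d m A v) = N}"
proof -
  let ?X = "\<lambda>N. {v \<in> pow M d. \<exists>Y. finite Y \<and> card Y = N \<and> Y \<subseteq> fib d m A v}"
  have ge: "(\<exists>Y. finite Y \<and> card Y = N \<and> Y \<subseteq> fib d m A v) \<longleftrightarrow> N \<le> card (fib d m A v)" if "v \<in> pow M d" for v N
    using card_mono[OF fin[OF that]] obtain_subset_with_card_n[of N "fib d m A v"] by metis
  have "?X N = {v \<in> pow M d. N \<le> card (fib d m A v)}" for N using ge by blast
  then have "?X N - ?X (Suc N) = {v \<in> pow M d. card (fib d m A v) = N}" by auto
  then show ?thesis using definable_Diff[OF definable_fib_ge[OF A, of N] definable_fib_ge[OF A, of "Suc N"]] by simp
qed

end

section \<open>Cell decomposition\<close>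

lemma coord_proj_in: "x \<in> pow M n \<Longrightarrow> s ` {..<k} \<subseteq> {..<n} \<Longrightarrow> coord_proj k s x \<in> pow M k"
  by (auto simp: pow_def coord_proj_def PiE_iff image_subset_iff)

lemma coord_proj_comp: "s ` {..<k} \<subseteq> {..<n} \<Longrightarrow> coord_proj k s (coord_proj n t x) = coord_proj k (t \<circ> s) x"
  by (auto simp: coord_proj_def image_subset_iff)

lemma coord_proj_id: "x \<in> pow M n \<Longrightarrow> (\<And>i. i < n \<Longrightarrow> s i = i) \<Longrightarrow> coord_proj n s x = x"
  by (auto simp: coord_proj_def pow_def PiE_def extensional_def)

lemma append_in: "x \<in> pow M n \<Longrightarrow> y \<in> pow M m \<Longrightarrow> append_pt n m x y \<in> pow M (n + m)"
  by (auto simp: append_pt_def pow_def PiE_iff)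

lemma restrict_append: "x \<in> pow M n \<Longrightarrow> restrict (append_pt n m x y) {..<n} = x"
  by (auto simp: append_pt_def pow_def PiE_def extensional_def fun_eq_iff)

lemma drop_append: "y \<in> pow M m \<Longrightarrow> coord_proj m ((+) n) (append_pt n m x y) = y"
  by (auto simp: append_pt_def coord_proj_def pow_def PiE_def extensional_def)

lemma append_split: "z \<in> pow M (n + m) \<Longrightarrow> append_pt n m (restrict z {..<n}) (coord_proj m ((+) n) z) = z"
  by (auto simp: append_pt_def coord_proj_def pow_def PiE_def extensional_def fun_eq_iff)

lemma restrict_in: "z \<in> pow M n \<Longrightarrow> k \<le> n \<Longrightarrow> restrict z {..<k} \<in> pow M k"
  by (auto simp: pow_def PiE_iff)

lemma drop_in: "z \<in> pow M (n + m) \<Longrightarrow> coord_proj m ((+) n) z \<in> pow M m"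
  by (rule coord_proj_in) auto

lemma permutes_lessThan: "\<sigma> permutes {..<n :: nat} \<Longrightarrow> k \<le> n \<Longrightarrow> \<sigma> ` {..<k} \<subseteq> {..<n}"
proof (rule image_subsetI)
  fix i assume "\<sigma> permutes {..<n}" "k \<le> n" "i \<in> {..<k}"
  then have "i < n" by simp
  then show "\<sigma> i \<in> {..<n}" using permutes_in_image[OF \<open>\<sigma> permutes {..<n}\<close>, of i] by simp
qed

lemma cell_permute:
  assumes "cell L M S n C" "\<tau> permutes {..<n}"
  shows "cell L M S n (coord_proj n \<tau> ` C)"
proof -
  obtain i k U f \<sigma> where *: "i \<le> n" "definable L M i U" "openin (pow_top S i) U"
     "correspondence k U (pow M (n - i)) f" "definable L M n (corr_graph i (n - i) U f)"
     "continuous_corr k (subtopology (pow_top S i) U) (pow_top S (n - i)) f"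
     "\<sigma> permutes {..<n}" "C = coord_proj n \<sigma> ` corr_graph i (n - i) U f"
    using assms(1) unfolding cell_def by (elim exE conjE)
  have "coord_proj n \<tau> ` C = coord_proj n (\<sigma> \<circ> \<tau>) ` corr_graph i (n - i) U f"
    unfolding *(8) image_image
    using coord_proj_comp[OF permutes_lessThan[OF assms(2) order_refl]] by (intro image_cong) auto
  moreover have "\<sigma> \<circ> \<tau> permutes {..<n}" using assms(2) *(7) by (rule permutes_compose)
  ultimately show ?thesis unfolding cell_def using *(1-6) by blast
qed

context tame_structure
begin

lemma definable_preimage_coord_proj:
  assumes "definable L M k X" "s ` {..<k} \<subseteq> {..<n}"
  shows "definable L M n {x \<in> pow M n. coord_proj k s x \<in> X}"
  using assms by (intro definable_Collect dfn_mem[of k X] dtup_coord_proj[of n] dtup_var)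

lemma open_preimage_coord_proj:
  assumes "openin (pow_top S k) X" "s ` {..<k} \<subseteq> {..<n}"
  shows "openin (pow_top S n) {x \<in> pow M n. coord_proj k s x \<in> X}"
  using openin_preimage[OF continuous_coord_proj[OF assms(2)] assms(1)] by (simp add: topspace_pow_top)

text \<open>As a preimage under the inverse permutation, the image inherits definability without a
  quantifier.\<close>

lemma image_permute:
  assumes "\<sigma> permutes {..<n}" "X \<subseteq> pow M n"
  shows "coord_proj n \<sigma> ` X = {z \<in> pow M n. coord_proj n (inv_into UNIV \<sigma>) z \<in> X}"
proof
  have inv: "inv_into UNIV \<sigma> permutes {..<n}" using assms(1) by (rule permutes_inv)
  have 1: "coord_proj n (inv_into UNIV \<sigma>) (coord_proj n \<sigma> x) = x" if "x \<in> pow M n" for x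
    unfolding coord_proj_comp[OF permutes_lessThan[OF inv order_refl]]
    using that by (rule coord_proj_id) (simp add: permutes_inverses[OF assms(1)])
  have 2: "coord_proj n \<sigma> (coord_proj n (inv_into UNIV \<sigma>) x) = x" if "x \<in> pow M n" for x
    unfolding coord_proj_comp[OF permutes_lessThan[OF assms(1) order_refl]]
    using that by (rule coord_proj_id) (simp add: permutes_inverses[OF assms(1)])
  show "coord_proj n \<sigma> ` X \<subseteq> {z \<in> pow M n. coord_proj n (inv_into UNIV \<sigma>) z \<in> X}"
  proof
    fix z assume "z \<in> coord_proj n \<sigma> ` X"
    then obtain x where x: "x \<in> X" "z = coord_proj n \<sigma> x" by blast
    then have "x \<in> pow M n" using assms(2) by blast
    then show "z \<in> {z \<in> pow M n. coord_proj n (inv_into UNIV \<sigma>) z \<in> X}"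
      using x 1 coord_proj_in[OF _ permutes_lessThan[OF assms(1) order_refl]] by simp
  qed
  show "{z \<in> pow M n. coord_proj n (inv_into UNIV \<sigma>) z \<in> X} \<subseteq> coord_proj n \<sigma> ` X"
  proof
    fix z assume z: "z \<in> {z \<in> pow M n. coord_proj n (inv_into UNIV \<sigma>) z \<in> X}"
    then have "z = coord_proj n \<sigma> (coord_proj n (inv_into UNIV \<sigma>) z)" using 2 by simp
    then show "z \<in> coord_proj n \<sigma> ` X" using z by blast
  qed
qed

lemma definable_permute:
  assumes "\<sigma> permutes {..<n}" "definable L M n X"
  shows "definable L M n (coord_proj n \<sigma> ` X)"
  unfolding image_permute[OF assms(1) definable_subset[OF assms(2)]]
  by (intro definable_preimage_coord_proj assms permutes_lessThan[OF permutes_inv] order_refl)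

lemma definable_cell: "cell L M S n C \<Longrightarrow> definable L M n C"
  unfolding cell_def using definable_permute by blast

lemma corr_graph_fib:
  assumes "A \<subseteq> pow M (d + m)" "U \<subseteq> pow M d"
  shows "corr_graph d m U (fib d m A) = {x \<in> A. restrict x {..<d} \<in> U}"
proof
  show "corr_graph d m U (fib d m A) \<subseteq> {x \<in> A. restrict x {..<d} \<in> U}"
    using assms by (auto simp: corr_graph_def fib_def restrict_append dest: subsetD)
  show "{x \<in> A. restrict x {..<d} \<in> U} \<subseteq> corr_graph d m U (fib d m A)"
  proof clarify
    fix x assume x: "x \<in> A" "restrict x {..<d} \<in> U"
    have "x \<in> pow M (d + m)" using x assms by blast
    note sp = append_split[OF this] drop_in[OF this]
    then have "coord_proj m ((+) d) x \<in> fib d m A (restrict x {..<d})"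
      using x(1) by (simp add: fib_def)
    then show "x \<in> corr_graph d m U (fib d m A)"
      unfolding corr_graph_def using sp(1) x(2) by (metis (mono_tags, lifting) mem_Collect_eq)
  qed
qed

text \<open>Over \<open>D\<close>, coordinate \<open>i\<close> takes only finitely many values once
  the other coordinates below \<open>d\<close> are fixed. The transposition moves it to position
  \<open>d - 1\<close>, so the rearranged set is finite over its first \<open>d - 1\<close>
  coordinates.\<close>

lemma finite_over_swap:
  assumes "A \<subseteq> pow M n" "d \<le> n" "i < d" "D \<subseteq> pow M d"
    and finA: "\<And>v. finite {x \<in> A. restrict x {..<d} = v}"
    and finD: "\<And>u. u \<in> pow M d \<Longrightarrow> finite {a \<in> Dom M. u(i := a) \<in> D}"
  shows "finite {z \<in> coord_proj n (Transposition.transpose i (d - 1)) ` {x \<in> A. restrict x {..<d} \<in> D}. restrict z {..<d - 1} = v}"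
    (is "finite ?F")
proof (cases "?F = {}")
  case False
  define \<sigma> where "\<sigma> = Transposition.transpose i (d - 1)"
  have \<sigma>: "\<sigma> ` {..<n} \<subseteq> {..<n}" using assms(2,3) by (auto simp: \<sigma>_def Transposition.transpose_def)
  have idem: "coord_proj n \<sigma> (coord_proj n \<sigma> x) = x" if "x \<in> pow M n" for x
    unfolding coord_proj_comp[OF \<sigma>] using that by (rule coord_proj_id) (simp add: \<sigma>_def)
  obtain x0 where x0: "x0 \<in> A" "restrict x0 {..<d} \<in> D" "restrict (coord_proj n \<sigma> x0) {..<d - 1} = v"
    using False unfolding \<sigma>_def by blast
  \<comment> \<open>All points of the fibre over \<open>v\<close> agree with \<open>x0\<close> below
    \<open>d\<close> except in coordinate \<open>i\<close>, so they lie over points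
    \<open>u0(i := a)\<close> of \<open>D\<close>.\<close>
  define u0 where "u0 = restrict x0 {..<d}"
  have u0: "u0 \<in> pow M d" using x0 assms by (auto simp: u0_def)
  have "?F \<subseteq> coord_proj n \<sigma> ` (\<Union>a\<in>{a \<in> Dom M. u0(i := a) \<in> D}. {x \<in> A. restrict x {..<d} = u0(i := a)})"
  proof
    fix z assume "z \<in> ?F"
    then obtain x where x: "x \<in> A" "restrict x {..<d} \<in> D" "z = coord_proj n \<sigma> x"
      "restrict (coord_proj n \<sigma> x) {..<d - 1} = v" unfolding \<sigma>_def by blast
    have eq: "x j = x0 j" if j: "j < d" "j \<noteq> i" for j
    proof -
      have "\<sigma> j < d - 1" using j assms(3) by (auto simp: \<sigma>_def Transposition.transpose_def)
      then have "coord_proj n \<sigma> x (\<sigma> j) = coord_proj n \<sigma> x0 (\<sigma> j)"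
        using x(4) x0(3) by (metis lessThan_iff restrict_apply')
      moreover have "\<sigma> j < n" "\<sigma> (\<sigma> j) = j" using \<open>\<sigma> j < d - 1\<close> assms(2) by (auto simp: \<sigma>_def)
      ultimately show ?thesis by (simp add: coord_proj_def)
    qed
    have "restrict x {..<d} = u0(i := x i)"
      using eq assms(3) by (auto simp: u0_def fun_eq_iff)
    moreover have "x i \<in> Dom M" using x(1) assms(1,2,3) by auto
    ultimately show "z \<in> coord_proj n \<sigma> ` (\<Union>a\<in>{a \<in> Dom M. u0(i := a) \<in> D}. {x \<in> A. restrict x {..<d} = u0(i := a)})"
      using x by auto
  qed
  moreover have "finite (\<Union>a\<in>{a \<in> Dom M. u0(i := a) \<in> D}. {x \<in> A. restrict x {..<d} = u0(i := a)})"
    using finD[OF u0] finA by blast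
  ultimately show ?thesis using finite_subset finite_imageI by blast
qed (simp only: finite.emptyI)

text \<open>Finiteness over the first \<open>d\<close> coordinates is the invariant of a strong
  induction on \<open>d\<close>. Where the fibre size is locally constant, the fibres form a
  correspondence, and niceness yields a cell. The rest of the base has no interior, so
  \<open>noint_cover\<close> splits it into sets that are finite in one direction, over which
  \<open>finite_over_swap\<close> lowers \<open>d\<close>.\<close>

lemma cell_decomposition_finite_over:
  assumes "d \<le> n" "definable L M n A" "\<And>v. finite {x \<in> A. restrict x {..<d} = v}"
  shows "\<exists>\<C>. finite \<C> \<and> (\<forall>C\<in>\<C>. cell L M S n C) \<and> \<Union>\<C> = A"
  using assms
proof (induction d arbitrary: A rule: less_induct)
  case (less d)
  define m where "m = n - d"
  have n: "n = d + m" using less.prems(1) by (simp add: m_def)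
  note A = less.prems(2)
  have Asub: "A \<subseteq> pow M (d + m)" using definable_subset[OF A] n by simp
  have A': "definable L M (d + m) A" using A n by simp
  have fin: "finite (fib d m A v)" if "v \<in> pow M d" for v
  proof -
    have "fib d m A v \<subseteq> coord_proj m ((+) d) ` {x \<in> A. restrict x {..<d} = v}"
    proof
      fix y assume y: "y \<in> fib d m A v"
      then have "y = coord_proj m ((+) d) (append_pt d m v y)" "append_pt d m v y \<in> {x \<in> A. restrict x {..<d} = v}"
        using that by (auto simp: fib_def drop_append restrict_append)
      then show "y \<in> coord_proj m ((+) d) ` {x \<in> A. restrict x {..<d} = v}" by blast
    qed
    then show ?thesis using less.prems(3) finite_surj by blast
  qed
  obtain K where K: "\<And>v. v \<in> pow M d \<Longrightarrow> card (fib d m A v) < K" using fib_bound[OF A' fin] by blast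
  define P where "P k = {v \<in> pow M d. card (fib d m A v) = k}" for k
  define U where "U k = pow_top S d interior_of P k" for k
  have defP: "definable L M d (P k)" for k unfolding P_def by (rule definable_fib_card[OF A' fin])
  have defU: "definable L M d (U k)" for k unfolding U_def by (rule definable_interior[OF defP])
  have openU: "openin (pow_top S d) (U k)" for k by (simp add: U_def)
  have UP: "U k \<subseteq> P k" for k by (simp add: U_def interior_of_subset)
  have corr: "correspondence k (U k) (pow M m) (fib d m A)" for k
    using UP fin by (fastforce simp: correspondence_def P_def fib_def)
  have graph: "corr_graph d m V (fib d m A) = {x \<in> A. restrict x {..<d} \<in> V}" if "V \<subseteq> pow M d" for V
    by (rule corr_graph_fib[OF Asub that])
  have def_over: "definable L M n {x \<in> A. restrict x {..<d} \<in> V}" if "definable L M d V" for V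
    using less.prems(1) by (intro definable_sub_Collect A dfn_mem[OF that] dtup_restrict[of n] dtup_var)
  have Usub: "U k \<subseteq> pow M d" for k using UP by (auto simp: P_def)
  have "\<forall>k. \<exists>U0. U0 \<subseteq> U k \<and> definable L M d U0 \<and> openin (pow_top S d) U0 \<and> \<not> hasint d (U k - U0) \<and>
      continuous_corr k (subtopology (pow_top S d) U0) (pow_top S m) (fib d m A)"
  proof
    fix k
    have "definable L M (d + m) (corr_graph d m (U k) (fib d m A))"
      unfolding graph[OF Usub] using def_over[OF defU] n by simp
    with defU openU corr obtain U0 where
      "U0 \<subseteq> U k" "definable L M d U0" "openin (pow_top S d) U0" "\<not> hasint d (U k - U0)"
      "continuous_corr k (subtopology (pow_top S d) U0) (pow_top S m) (fib d m A)"
      by (rule generic_continuity_corr)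
    then show "\<exists>U0. U0 \<subseteq> U k \<and> definable L M d U0 \<and> openin (pow_top S d) U0 \<and> \<not> hasint d (U k - U0) \<and>
      continuous_corr k (subtopology (pow_top S d) U0) (pow_top S m) (fib d m A)" by blast
  qed
  from choice[OF this] obtain U0 where U0': "\<forall>k. U0 k \<subseteq> U k \<and> definable L M d (U0 k) \<and>
      openin (pow_top S d) (U0 k) \<and> \<not> hasint d (U k - U0 k) \<and>
      continuous_corr k (subtopology (pow_top S d) (U0 k)) (pow_top S m) (fib d m A)" ..
  have U0: "U0 k \<subseteq> U k" "definable L M d (U0 k)" "openin (pow_top S d) (U0 k)" "\<not> hasint d (U k - U0 k)"
      "continuous_corr k (subtopology (pow_top S d) (U0 k)) (pow_top S m) (fib d m A)" for k
    using U0'[rule_format, of k] by blast+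
  define C where "C k = {x \<in> A. restrict x {..<d} \<in> U0 k}" for k
  have graphC: "corr_graph d m (U0 k) (fib d m A) = C k" for k
    by (simp only: C_def graph[OF order_trans[OF U0(1) Usub]])
  have cellC: "cell L M S n (C k)" for k
    unfolding cell_def
  proof (rule exI[of _ d], rule exI[of _ k], rule exI[of _ "U0 k"], rule exI[of _ "fib d m A"],
      rule exI[of _ id], intro conjI)
    show "definable L M n (corr_graph d (n - d) (U0 k) (fib d m A))"
      using def_over[OF U0(2)] by (simp add: m_def[symmetric] graphC C_def)
    show "correspondence k (U0 k) (pow M (n - d)) (fib d m A)"
      using corr[of k] U0(1)[of k] by (auto simp: correspondence_def m_def)
    have "coord_proj n id x = x" if "x \<in> C k" for x
      using that definable_subset[OF A] by (intro coord_proj_id[of x M]) (auto simp: C_def)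
    then show "C k = coord_proj n id ` corr_graph d (n - d) (U0 k) (fib d m A)"
      by (simp add: m_def[symmetric] graphC)
  qed (use U0 less.prems(1) in \<open>auto simp: m_def[symmetric]\<close>)
  define R where "R = pow M d - (\<Union>k\<in>{..<K}. U0 k)"
  have defR: "definable L M d R" unfolding R_def by (intro definable_Diff definable_UN definable_pow U0) simp
  have "\<not> hasint d R"
  proof
    assume "hasint d R"
    \<comment> \<open>A base point outside all \<open>U0 k\<close> has some fibre size
      \<open>k < K\<close>. Either this size is not locally constant there, or the fibre
      correspondence is not yet known to be continuous.\<close>
    moreover have "R \<subseteq> (\<Union>k\<in>{..<K}. (P k - U k) \<union> (U k - U0 k))"
      using K by (auto simp: R_def P_def)
    ultimately have "hasint d (\<Union>k\<in>{..<K}. (P k - U k) \<union> (U k - U0 k))" by (rule hasint_mono)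
    then have "\<exists>k\<in>{..<K}. hasint d ((P k - U k) \<union> (U k - U0 k))"
      by (intro hasint_UN definable_Un definable_Diff defP defU U0) auto
    then obtain k where "hasint d ((P k - U k) \<union> (U k - U0 k))" by blast
    then have "hasint d (P k - U k) \<or> hasint d (U k - U0 k)"
      by (intro hasint_Un definable_Diff defP defU U0)
    then show False using U0(4) not_hasint_frontier[OF defP] by (auto simp: U_def)
  qed
  from noint_cover[OF defR this] obtain \<D> where \<D>: "finite \<D>" "R = (\<Union>(i, D)\<in>\<D>. D)"
    "\<forall>(i, D)\<in>\<D>. i < d \<and> definable L M d D \<and> (\<forall>x\<in>pow M d. finite {a \<in> Dom M. x(i := a) \<in> D})"
    by (elim exE conjE)
  have "\<forall>p. \<exists>\<C>. p \<in> \<D> \<longrightarrow> finite \<C> \<and> (\<forall>C\<in>\<C>. cell L M S n C) \<and> \<Union>\<C> = {x \<in> A. restrict x {..<d} \<in> snd p}"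
  proof
    fix p :: "nat \<times> 'a point set"
    obtain i D where p: "p = (i, D)" by (cases p)
    show "\<exists>\<C>. p \<in> \<D> \<longrightarrow> finite \<C> \<and> (\<forall>C\<in>\<C>. cell L M S n C) \<and> \<Union>\<C> = {x \<in> A. restrict x {..<d} \<in> snd p}"
    proof (cases "p \<in> \<D>")
      case True
      then have i: "i < d" and D: "definable L M d D"
        and finD: "\<And>x. x \<in> pow M d \<Longrightarrow> finite {a \<in> Dom M. x(i := a) \<in> D}"
        using \<D>(3) p by auto
      define \<sigma> where "\<sigma> = Transposition.transpose i (d - 1)"
      define B where "B = {x \<in> A. restrict x {..<d} \<in> D}"
      have \<sigma>: "\<sigma> permutes {..<n}" unfolding \<sigma>_def using i less.prems(1) by (intro permutes_swap_id) auto
      have B: "definable L M n B" unfolding B_def by (rule def_over[OF D])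
      have "\<exists>\<C>. finite \<C> \<and> (\<forall>C\<in>\<C>. cell L M S n C) \<and> \<Union>\<C> = coord_proj n \<sigma> ` B"
      proof (rule less.IH[of "d - 1"])
        show "finite {x \<in> coord_proj n \<sigma> ` B. restrict x {..<d - 1} = v}" for v
          unfolding B_def \<sigma>_def using definable_subset[OF A] less.prems(1) i definable_subset[OF D] less.prems(3) finD
          by (rule finite_over_swap)
      qed (use i less.prems(1) definable_permute[OF \<sigma> B] in auto)
      then obtain \<C> where \<C>: "finite \<C>" "\<forall>C\<in>\<C>. cell L M S n C" "\<Union>\<C> = coord_proj n \<sigma> ` B"
        by (elim exE conjE)
      have "coord_proj n \<sigma> (coord_proj n \<sigma> x) = x" if "x \<in> pow M n" for x
        unfolding coord_proj_comp[OF permutes_lessThan[OF \<sigma> order_refl]]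
        using that by (rule coord_proj_id) (simp add: \<sigma>_def)
      then have "coord_proj n \<sigma> ` coord_proj n \<sigma> ` B = B"
        unfolding image_image using definable_subset[OF B] by (auto simp: subset_eq)
      then have "\<Union>((`) (coord_proj n \<sigma>) ` \<C>) = B" using \<C>(3) by (simp add: image_Union[symmetric])
      moreover have "\<forall>C\<in>(`) (coord_proj n \<sigma>) ` \<C>. cell L M S n C" using \<C>(2) cell_permute[OF _ \<sigma>] by blast
      ultimately show ?thesis using \<C>(1) p unfolding B_def by (intro exI[of _ "(`) (coord_proj n \<sigma>) ` \<C>"]) simp
    qed simp
  qed
  from choice[OF this] obtain \<C> where
    \<C>: "\<forall>p. p \<in> \<D> \<longrightarrow> finite (\<C> p) \<and> (\<forall>C\<in>\<C> p. cell L M S n C) \<and> \<Union>(\<C> p) = {x \<in> A. restrict x {..<d} \<in> snd p}" ..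
  have "\<Union>(C ` {..<K} \<union> (\<Union>p\<in>\<D>. \<C> p)) = (\<Union>k\<in>{..<K}. C k) \<union> (\<Union>p\<in>\<D>. \<Union>(\<C> p))"
    by auto
  also have "(\<Union>p\<in>\<D>. \<Union>(\<C> p)) = (\<Union>p\<in>\<D>. {x \<in> A. restrict x {..<d} \<in> snd p})"
    by (intro SUP_cong refl \<C>[rule_format, THEN conjunct2, THEN conjunct2])
  also have "(\<Union>k\<in>{..<K}. C k) \<union> (\<Union>p\<in>\<D>. {x \<in> A. restrict x {..<d} \<in> snd p}) = A"
  proof
    show "A \<subseteq> (\<Union>k\<in>{..<K}. C k) \<union> (\<Union>p\<in>\<D>. {x \<in> A. restrict x {..<d} \<in> snd p})"
    proof
      fix x assume x: "x \<in> A"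
      then have "restrict x {..<d} \<in> pow M d" using Asub by (intro restrict_in[of x M "d + m"]) auto
      then have "restrict x {..<d} \<in> R \<or> restrict x {..<d} \<in> (\<Union>k\<in>{..<K}. U0 k)" by (auto simp: R_def)
      then show "x \<in> (\<Union>k\<in>{..<K}. C k) \<union> (\<Union>p\<in>\<D>. {x \<in> A. restrict x {..<d} \<in> snd p})"
        unfolding \<D>(2) C_def using x by fastforce
    qed
  qed (auto simp: C_def)
  finally have "\<Union>(C ` {..<K} \<union> (\<Union>p\<in>\<D>. \<C> p)) = A" .
  moreover have "finite (C ` {..<K} \<union> (\<Union>p\<in>\<D>. \<C> p))" using \<C> \<D>(1) by auto
  moreover have "\<forall>C\<in>C ` {..<K} \<union> (\<Union>p\<in>\<D>. \<C> p). cell L M S n C" using \<C> cellC by auto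
  ultimately show ?case by blast
qed

theorem cell_decomposition:
  assumes "definable L M n A"
  shows "\<exists>\<C>. finite \<C> \<and> (\<forall>C\<in>\<C>. cell L M S n C) \<and> \<Union>\<C> = A"
proof (rule cell_decomposition_finite_over[OF order_refl assms])
  fix v
  have "restrict x {..<n} = x" if "x \<in> A" for x
    using that definable_subset[OF assms] by (fastforce simp: pow_def PiE_def extensional_restrict)
  then have "{x \<in> A. restrict x {..<n} = v} \<subseteq> {v}" by auto
  then show "finite {x \<in> A. restrict x {..<n} = v}" by (rule finite_subset) simp
qed

text \<open>A piece \<open>Z\<close> parametrised by \<open>\<theta>\<close>, with the coordinate
  projection along \<open>s\<close> as inverse. Since the neighbourhood \<open>N\<close> projects
  into \<open>V\<close>, the map \<open>\<theta> (coord_proj d s x)\<close> is defined on all of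
  \<open>N\<close>, and its fixed points in \<open>N\<close> are exactly the points of
  \<open>Z\<close>.\<close>

definition graph_over ::
    "nat \<Rightarrow> nat \<Rightarrow> (nat \<Rightarrow> nat) \<Rightarrow> 'a point set \<Rightarrow> ('a point \<Rightarrow> 'a point) \<Rightarrow> 'a point set \<Rightarrow> 'a point set \<Rightarrow> bool" where
  "graph_over n d s V \<theta> N Z \<longleftrightarrow>
     definable L M d V \<and> openin (pow_top S d) V \<and> s ` {..<d} \<subseteq> {..<n} \<and>
     continuous_map (subtopology (pow_top S d) V) (pow_top S n) \<theta> \<and> \<theta> ` V = Z \<and>
     (\<forall>v\<in>V. coord_proj d s (\<theta> v) = v) \<and>
     definable L M n N \<and> openin (pow_top S n) N \<and> (\<forall>x\<in>N. coord_proj d s x \<in> V) \<and> Z \<subseteq> N \<and> definable L M n Z"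

lemma continuous_subtopology_openin:
  assumes "continuous_map (subtopology X V) Y f" "openin X V" "openin Y W"
  shows "openin X {x \<in> V. f x \<in> W}"
proof -
  have "openin (subtopology X V) {x \<in> topspace (subtopology X V). f x \<in> W}"
    using assms by (simp add: continuous_map_def)
  moreover have "topspace (subtopology X V) = V"
    using openin_subset[OF assms(2)] by (simp add: inf.absorb2)
  ultimately show ?thesis using assms(2) openin_trans_full by metis
qed

lemma graph_over_shrink:
  assumes g: "graph_over n d s V \<theta> N Z" and N': "definable L M n N'" "openin (pow_top S n) N'"
  shows "\<exists>V' N''. graph_over n d s V' \<theta> N'' (Z \<inter> N') \<and> N'' \<subseteq> N \<inter> N'"
proof -
  have V: "definable L M d V" "openin (pow_top S d) V" and s: "s ` {..<d} \<subseteq> {..<n}"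
    and cont: "continuous_map (subtopology (pow_top S d) V) (pow_top S n) \<theta>" and im: "\<theta> ` V = Z"
    and inv: "\<And>v. v \<in> V \<Longrightarrow> coord_proj d s (\<theta> v) = v"
    and N: "definable L M n N" "openin (pow_top S n) N" "\<And>x. x \<in> N \<Longrightarrow> coord_proj d s x \<in> V"
    and Z: "Z \<subseteq> N" "definable L M n Z"
    using g unfolding graph_over_def by auto
  define V' where "V' = {v \<in> V. \<theta> v \<in> N'}"
  define N'' where "N'' = {x \<in> pow M n. coord_proj d s x \<in> V'} \<inter> (N \<inter> N')"
  have open_V': "openin (pow_top S d) V'"
    unfolding V'_def using cont V(2) N'(2) by (rule continuous_subtopology_openin)
  \<comment> \<open>No graph of \<open>\<theta>\<close> is given as a definable set, so
    \<open>V'\<close> is defined as the projection of the definable set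
    \<open>Z \<inter> N'\<close>.\<close>
  have "definable L M d {v \<in> pow M d. \<exists>x\<in>pow M n. x \<in> Z \<inter> N' \<and> coord_proj d s x = v}"
    by (intro definable_Collect dfn_Bex_pow dfn_conj dfn_mem[OF definable_Int[OF Z(2) N'(1)]] dfn_tup_eq[of d]
      dtup_coord_proj[of n] dtup_var s)
  moreover have "{v \<in> pow M d. \<exists>x\<in>pow M n. x \<in> Z \<inter> N' \<and> coord_proj d s x = v} = V'" (is "?A = _")
  proof
    show "?A \<subseteq> V'" using im inv by (auto simp: V'_def)
    show "V' \<subseteq> ?A"
    proof
      fix v assume v: "v \<in> V'"
      then have "\<theta> v \<in> Z \<inter> N'" "coord_proj d s (\<theta> v) = v" using im inv by (auto simp: V'_def)
      moreover have "v \<in> pow M d" using v definable_subset[OF V(1)] by (auto simp: V'_def)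
      moreover have "\<theta> v \<in> pow M n" using \<open>\<theta> v \<in> Z \<inter> N'\<close> definable_subset[OF Z(2)] by auto
      ultimately show "v \<in> ?A" by blast
    qed
  qed
  ultimately have def_V': "definable L M d V'" by simp
  have "graph_over n d s V' \<theta> N'' (Z \<inter> N')"
    unfolding graph_over_def
  proof (intro conjI ballI)
    show "definable L M d V'" "openin (pow_top S d) V'" "s ` {..<d} \<subseteq> {..<n}" by (fact def_V' open_V' s)+
    show "continuous_map (subtopology (pow_top S d) V') (pow_top S n) \<theta>"
      using cont by (rule continuous_map_from_subtopology_mono) (auto simp: V'_def)
    show "\<theta> ` V' = Z \<inter> N'" using im by (auto simp: V'_def)
    show "definable L M n N''" unfolding N''_def
      by (intro definable_Int definable_preimage_coord_proj def_V' s N N')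
    show "openin (pow_top S n) N''" unfolding N''_def
      by (intro openin_Int open_preimage_coord_proj open_V' s N N')
    show "Z \<inter> N' \<subseteq> N''"
      using im inv Z definable_subset[OF Z(2)] by (auto simp: N''_def V'_def)
    show "definable L M n (Z \<inter> N')" by (intro definable_Int Z N')
  qed (auto simp: V'_def N''_def inv)
  then show ?thesis unfolding N''_def by blast
qed

text \<open>Locally the correspondence has \<open>k\<close> continuous branches with distinct
  values. The Hausdorff property separates the branch through \<open>p\<close> from the others; over
  a small box \<open>V\<close> and inside a small box \<open>B\<close> only this branch
  remains.\<close>

lemma cell_graph_over:
  assumes C: "cell L M S n C" "p \<in> C"
  shows "\<exists>d s V \<theta> N Z. graph_over n d s V \<theta> N Z \<and> p \<in> Z \<and> Z = C \<inter> N"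
proof -
  obtain i k U f \<sigma> where *: "i \<le> n" "definable L M i U" "openin (pow_top S i) U"
     "correspondence k U (pow M (n - i)) f" "definable L M n (corr_graph i (n - i) U f)"
     "continuous_corr k (subtopology (pow_top S i) U) (pow_top S (n - i)) f"
     "\<sigma> permutes {..<n}" "C = coord_proj n \<sigma> ` corr_graph i (n - i) U f"
    using C(1) unfolding cell_def by (elim exE conjE)
  define m where "m = n - i"
  have n: "n = i + m" using *(1) by (simp add: m_def)
  note U = *(2,3) and corr = *(4)[folded m_def] and ccorr = *(6)[folded m_def] and \<sigma> = *(7) and C_eq = *(8)[folded m_def]
  obtain v0 y0 where v0: "v0 \<in> U" "y0 \<in> f v0" "p = coord_proj n \<sigma> (append_pt i m v0 y0)"
    using C(2) unfolding C_eq corr_graph_def by blast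
  have U_sub: "U \<subseteq> pow M i" using definable_subset[OF U(1)] .
  have f_sub: "f v \<subseteq> pow M m" "card (f v) = k" if "v \<in> U" for v
    using corr that by (auto simp: correspondence_def)
  have "v0 \<in> topspace (subtopology (pow_top S i) U)" using v0(1) U_sub by (auto simp: topspace_pow_top)
  from ccorr[unfolded continuous_corr_def, rule_format, OF this] obtain W g where
    W: "openin (subtopology (pow_top S i) U) W" "v0 \<in> W"
    "\<forall>j<k. continuous_map (subtopology (subtopology (pow_top S i) U) W) (pow_top S m) (g j)"
    "\<forall>v\<in>W. f v = {g j v |j. j < k}"
    by (elim exE conjE)
  have W_open: "openin (pow_top S i) W" and WU: "W \<subseteq> U"
    using W(1) U(2) openin_trans_full openin_imp_subset by blast+
  have g_cont: "continuous_map (subtopology (pow_top S i) W) (pow_top S m) (g j)" if "j < k" for j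
    using W(3) that WU by (simp add: subtopology_subtopology inf.absorb2)
  have f_eq: "f v = (\<lambda>j. g j v) ` {..<k}" if "v \<in> W" for v
    using W(4) that by auto
  \<comment> \<open>\<open>f v0\<close> has exactly \<open>k\<close> elements and is listed by
    \<open>k\<close> branches, so no two branches agree at \<open>v0\<close>.\<close>
  have "inj_on (\<lambda>j. g j v0) {..<k}"
    using f_eq[OF W(2)] f_sub(2)[OF v0(1)] by (intro eq_card_imp_inj_on) auto
  moreover obtain j0 where j0: "j0 < k" "y0 = g j0 v0" using v0(2) f_eq[OF W(2)] by auto
  ultimately have neq: "g j v0 \<noteq> y0" if "j < k" "j \<noteq> j0" for j
    using that by (auto dest: inj_onD)
  have g_in: "g j v0 \<in> topspace (pow_top S m)" if "j < k" for j
    using f_sub(1)[OF v0(1)] f_eq[OF W(2)] that by (auto simp: topspace_pow_top)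
  define I where "I = {..<k} - {j0}"
  have "\<forall>j. \<exists>PQ. j \<in> I \<longrightarrow> openin (pow_top S m) (fst PQ) \<and> openin (pow_top S m) (snd PQ) \<and>
      y0 \<in> fst PQ \<and> g j v0 \<in> snd PQ \<and> disjnt (fst PQ) (snd PQ)"
  proof
    fix j
    show "\<exists>PQ. j \<in> I \<longrightarrow> openin (pow_top S m) (fst PQ) \<and> openin (pow_top S m) (snd PQ) \<and>
      y0 \<in> fst PQ \<and> g j v0 \<in> snd PQ \<and> disjnt (fst PQ) (snd PQ)"
    proof (cases "j \<in> I")
      case True
      then have "j < k" "y0 \<noteq> g j v0" using neq by (auto simp: I_def)
      then have "\<exists>P Q. openin (pow_top S m) P \<and> openin (pow_top S m) Q \<and> y0 \<in> P \<and> g j v0 \<in> Q \<and> disjnt P Q"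
        using Hausdorff_pow[of m, unfolded Hausdorff_space_def, rule_format] g_in j0 by blast
      then show ?thesis by simp
    qed auto
  qed
  from choice[OF this] obtain PQ where
    PQ: "\<forall>j. j \<in> I \<longrightarrow> openin (pow_top S m) (fst (PQ j)) \<and> openin (pow_top S m) (snd (PQ j)) \<and>
      y0 \<in> fst (PQ j) \<and> g j v0 \<in> snd (PQ j) \<and> disjnt (fst (PQ j)) (snd (PQ j))" ..
  have finI: "finite I" by (simp add: I_def)
  have y0: "y0 \<in> topspace (pow_top S m)" using g_in[OF j0(1)] j0(2) by simp
  have "openin (pow_top S m) ((\<Inter>j\<in>I. fst (PQ j)) \<inter> topspace (pow_top S m))"
    using PQ by (intro openin_INT finI) auto
  moreover have "y0 \<in> (\<Inter>j\<in>I. fst (PQ j)) \<inter> topspace (pow_top S m)" using PQ y0 by auto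
  ultimately have "\<exists>b\<in>pow M (m * kb). y0 \<in> Box m b \<and> Box m b \<subseteq> (\<Inter>j\<in>I. fst (PQ j)) \<inter> topspace (pow_top S m)"
    by (rule Box_nbhd)
  then obtain b where b: "b \<in> pow M (m * kb)" "y0 \<in> Box m b" "\<And>j. j \<in> I \<Longrightarrow> Box m b \<subseteq> fst (PQ j)"
    by blast
  define B where "B = Box m b"
  have B: "definable L M m B" "openin (pow_top S m) B" "y0 \<in> B"
    using b definable_Box open_Box by (auto simp: B_def)
  have "openin (pow_top S i) ({v \<in> W. g j0 v \<in> B} \<inter> ((\<Inter>j\<in>I. {v \<in> W. g j v \<in> snd (PQ j)}) \<inter> topspace (pow_top S i)))"
    using PQ j0(1) B(2) W_open g_cont
    by (intro openin_Int openin_INT finI continuous_subtopology_openin[of "pow_top S i" W "pow_top S m"]) (auto simp: I_def)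
  moreover have "v0 \<in> {v \<in> W. g j0 v \<in> B} \<inter> ((\<Inter>j\<in>I. {v \<in> W. g j v \<in> snd (PQ j)}) \<inter> topspace (pow_top S i))"
    using W(2) B(3) j0(2) PQ v0(1) U_sub by (auto simp: topspace_pow_top)
  ultimately have "\<exists>c\<in>pow M (i * kb). v0 \<in> Box i c \<and> Box i c \<subseteq>
      {v \<in> W. g j0 v \<in> B} \<inter> ((\<Inter>j\<in>I. {v \<in> W. g j v \<in> snd (PQ j)}) \<inter> topspace (pow_top S i))"
    by (rule Box_nbhd)
  then obtain c where c: "c \<in> pow M (i * kb)" "v0 \<in> Box i c" "Box i c \<subseteq>
      {v \<in> W. g j0 v \<in> B} \<inter> ((\<Inter>j\<in>I. {v \<in> W. g j v \<in> snd (PQ j)}) \<inter> topspace (pow_top S i))"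
    by (elim bexE conjE)
  define V where "V = Box i c"
  have V: "definable L M i V" "openin (pow_top S i) V" "v0 \<in> V" "V \<subseteq> W"
    using c definable_Box open_Box by (auto simp: V_def)
  have V_B: "g j0 v \<in> B" if "v \<in> V" for v using that c(3) by (auto simp: V_def)
  have uniq: "y = g j0 v" if "v \<in> V" "y \<in> f v" "y \<in> B" for v y
  proof -
    have "y \<in> (\<lambda>j. g j v) ` {..<k}" using f_eq[OF subsetD[OF V(4) that(1)]] that(2) by simp
    then obtain j where j: "j < k" "y = g j v" by auto
    show ?thesis
    proof (cases "j = j0")
      case False
      then have jI: "j \<in> I" using j by (auto simp: I_def)
      then have "y \<in> snd (PQ j)" using that(1) c(3) j(2) by (auto simp: V_def)
      moreover have "y \<in> fst (PQ j)" using b(3)[OF jI] that(3) by (auto simp: B_def)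
      ultimately show ?thesis using PQ jI by (auto simp: disjnt_iff)
    qed (use j in simp)
  qed
  \<comment> \<open>The inverse permutation recovers from a point of the cell its base coordinates
    (the first \<open>i\<close>) and its fibre coordinates (the last \<open>m\<close>).\<close>
  define \<tau> where "\<tau> = inv_into UNIV \<sigma>"
  have \<tau>: "\<tau> permutes {..<n}" unfolding \<tau>_def by (rule permutes_inv[OF \<sigma>])
  have \<tau>1: "\<tau> ` {..<i} \<subseteq> {..<n}" by (rule permutes_lessThan[OF \<tau> *(1)])
  have \<tau>2: "(\<lambda>j. \<tau> (i + j)) ` {..<m} \<subseteq> {..<n}"
    using permutes_lessThan[OF \<tau> order_refl] by (auto simp: n image_subset_iff)
  have st: "\<sigma> (\<tau> j) = j" for j unfolding \<tau>_def by (rule permutes_inverses(1)[OF \<sigma>])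
  have p1: "coord_proj i \<tau> (coord_proj n \<sigma> z) = restrict z {..<i}" for z :: "'a point"
    unfolding coord_proj_comp[OF \<tau>1] by (simp add: coord_proj_def st)
  have p2: "coord_proj m (\<lambda>j. \<tau> (i + j)) (coord_proj n \<sigma> z) = coord_proj m ((+) i) z" for z :: "'a point"
    unfolding coord_proj_comp[OF \<tau>2] by (simp add: coord_proj_def st)
  define N where "N = {x \<in> pow M n. coord_proj i \<tau> x \<in> V} \<inter> {x \<in> pow M n. coord_proj m (\<lambda>j. \<tau> (i + j)) x \<in> B}"
  define \<theta> where "\<theta> v = coord_proj n \<sigma> (append_pt i m v (g j0 v))" for v
  have key: "coord_proj i \<tau> (coord_proj n \<sigma> (append_pt i m v y)) = v"
    "coord_proj m (\<lambda>j. \<tau> (i + j)) (coord_proj n \<sigma> (append_pt i m v y)) = y"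
    "coord_proj n \<sigma> (append_pt i m v y) \<in> pow M n" if "v \<in> pow M i" "y \<in> pow M m" for v y
    using that coord_proj_in[OF append_in[OF that, folded n] permutes_lessThan[OF \<sigma> order_refl]] unfolding p1 p2
    by (simp_all add: restrict_append drop_append)
  have gf: "g j0 v \<in> f v" "v \<in> U" if "v \<in> V" for v using that V(4) WU f_eq j0(1) by auto
  have gm: "v \<in> pow M i" "g j0 v \<in> pow M m" if "v \<in> V" for v
    using gf[OF that] f_sub(1) U_sub by blast+
  have CN: "\<theta> ` V = C \<inter> N"
  proof
    show "\<theta> ` V \<subseteq> C \<inter> N"
    proof
      fix x assume "x \<in> \<theta> ` V"
      then obtain v where v: "v \<in> V" "x = \<theta> v" by blast
      have "append_pt i m v (g j0 v) \<in> corr_graph i m U f"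
        using gf[OF v(1)] unfolding corr_graph_def by blast
      then have "x \<in> C" unfolding C_eq v(2) \<theta>_def by blast
      moreover have "x \<in> N"
        unfolding N_def v(2) \<theta>_def using key[OF gm[OF v(1)]] v(1) V_B[OF v(1)] by simp
      ultimately show "x \<in> C \<inter> N" by blast
    qed
    show "C \<inter> N \<subseteq> \<theta> ` V"
    proof
      fix x assume x: "x \<in> C \<inter> N"
      then obtain v y where vy: "v \<in> U" "y \<in> f v" "x = coord_proj n \<sigma> (append_pt i m v y)"
        unfolding C_eq corr_graph_def by blast
      have "v \<in> pow M i" "y \<in> pow M m" using vy U_sub f_sub by blast+
      note k = key[OF this]
      have "v \<in> V" "y \<in> B" using x k unfolding N_def vy(3) by auto
      then have "y = g j0 v" using uniq vy(2) by blast
      then show "x \<in> \<theta> ` V" using vy(3) \<open>v \<in> V\<close> by (auto simp: \<theta>_def)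
    qed
  qed
  have defN: "definable L M n N" unfolding N_def
    by (intro definable_Int definable_preimage_coord_proj V B \<tau>1 \<tau>2)
  have "graph_over n i \<tau> V \<theta> N (C \<inter> N)"
    unfolding graph_over_def
  proof (intro conjI ballI)
    show "continuous_map (subtopology (pow_top S i) V) (pow_top S n) \<theta>"
    proof -
      have "continuous_map (subtopology (pow_top S i) V) (pow_top S n) (\<lambda>v. append_pt i m v (g j0 v))"
        unfolding n
        by (intro continuous_append continuous_map_from_subtopology_mono[OF g_cont[OF j0(1)] V(4)]
          continuous_map_from_subtopology continuous_map_id[unfolded id_def])
      moreover have "continuous_map (pow_top S n) (pow_top S n) (coord_proj n \<sigma>)"
        by (intro continuous_coord_proj permutes_lessThan[OF \<sigma>] order_refl)
      ultimately have "continuous_map (subtopology (pow_top S i) V) (pow_top S n)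
          (coord_proj n \<sigma> \<circ> (\<lambda>v. append_pt i m v (g j0 v)))"
        by (rule continuous_map_compose)
      moreover have "\<theta> = coord_proj n \<sigma> \<circ> (\<lambda>v. append_pt i m v (g j0 v))"
        by (intro ext) (simp add: \<theta>_def)
      ultimately show ?thesis by simp
    qed
    show "openin (pow_top S n) N" unfolding N_def
      by (intro openin_Int open_preimage_coord_proj V B \<tau>1 \<tau>2)
    show "coord_proj i \<tau> (\<theta> v) = v" if "v \<in> V" for v
      unfolding \<theta>_def using key(1)[OF gm[OF that]] .
    show "definable L M n (C \<inter> N)" by (intro definable_Int definable_cell[OF C(1)] defN)
  qed (use V \<tau>1 CN defN in \<open>auto simp: N_def\<close>)
  moreover have "p \<in> C \<inter> N"
    using v0(3) V(3) j0(2) CN unfolding \<theta>_def by auto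
  ultimately show ?thesis by blast
qed

text \<open>\<open>Z\<close> is the set where two continuous maps into a Hausdorff space agree, the
  identity and \<open>\<theta>\<close> after the projection. So \<open>Z\<close> is closed in
  \<open>N\<close>.\<close>

lemma graph_over_closed:
  assumes g: "graph_over n d s V \<theta> N Z"
  shows "openin (pow_top S n) {x \<in> N. \<theta> (coord_proj d s x) \<noteq> x}"
proof -
  have N: "openin (pow_top S n) N" and s: "s ` {..<d} \<subseteq> {..<n}"
    and cont: "continuous_map (subtopology (pow_top S d) V) (pow_top S n) \<theta>"
    and NV: "coord_proj d s ` N \<subseteq> V"
    using g unfolding graph_over_def by auto
  have top: "topspace (subtopology (pow_top S n) N) = N"
    using openin_subset[OF N] by (simp add: inf.absorb2)
  have "continuous_map (subtopology (pow_top S n) N) (subtopology (pow_top S d) V) (coord_proj d s)"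
    using NV openin_subset[OF N]
    by (auto simp: continuous_map_in_subtopology intro: continuous_map_from_subtopology continuous_coord_proj[OF s])
  then have "continuous_map (subtopology (pow_top S n) N) (pow_top S n) (\<lambda>x. \<theta> (coord_proj d s x))"
    using continuous_map_compose[OF _ cont] by (simp add: comp_def)
  then have "closedin (subtopology (pow_top S n) N) {x \<in> topspace (subtopology (pow_top S n) N). \<theta> (coord_proj d s x) = x}"
    by (rule closedin_continuous_maps_eq[OF Hausdorff_pow])
      (rule continuous_map_from_subtopology[OF continuous_map_id[unfolded id_def]])
  from openin_diff[OF openin_topspace this]
  have "openin (subtopology (pow_top S n) N) (N - {x \<in> N. \<theta> (coord_proj d s x) = x})"
    unfolding top .
  then have "openin (pow_top S n) (N - {x \<in> N. \<theta> (coord_proj d s x) = x})"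
    by (rule openin_trans_full[OF _ N])
  moreover have "N - {x \<in> N. \<theta> (coord_proj d s x) = x} = {x \<in> N. \<theta> (coord_proj d s x) \<noteq> x}" by auto
  ultimately show ?thesis by simp
qed

text \<open>If \<open>C\<close> is not dense in \<open>A \<inter> W\<close>, removing its closure
  leaves a nonempty open part of \<open>A\<close> that the remaining sets cover.\<close>

lemma somewhere_dense:
  assumes "finite \<C>" "openin X W" "A \<inter> W \<noteq> {}" "A \<inter> W \<subseteq> \<Union>\<C>" "\<Union>\<C> \<subseteq> topspace X"
  shows "\<exists>C\<in>\<C>. \<exists>W'. openin X W' \<and> W' \<subseteq> W \<and> A \<inter> W' \<noteq> {} \<and> A \<inter> W' \<subseteq> X closure_of C"
  using assms
proof (induction \<C> arbitrary: W)
  case (insert C \<C>)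
  show ?case
  proof (cases "A \<inter> W \<subseteq> X closure_of C")
    case False
    let ?W = "W - X closure_of C"
    have "C \<subseteq> X closure_of C" using insert.prems(4) by (intro closure_of_subset) auto
    then have "A \<inter> ?W \<subseteq> \<Union>\<C>" using insert.prems(3) by auto
    moreover have "openin X ?W" using insert.prems(1) by (intro openin_diff) auto
    moreover have "A \<inter> ?W \<noteq> {}" using False by blast
    ultimately have "\<exists>C\<in>\<C>. \<exists>W'. openin X W' \<and> W' \<subseteq> ?W \<and> A \<inter> W' \<noteq> {} \<and> A \<inter> W' \<subseteq> X closure_of C"
      using insert.prems(4) by (intro insert.IH) auto
    then show ?thesis by blast
  qed (use insert.prems in blast)
qed auto

text \<open>Some cell \<open>C\<close> is dense in a nonempty open part of \<open>X\<close>. Near a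
  point of \<open>C\<close> the cell is a graph that is closed in its neighbourhood; being closed
  and dense there, it coincides with \<open>X\<close>.\<close>

lemma graph_over_dense:
  assumes "finite \<C>" "\<And>C. C \<in> \<C> \<Longrightarrow> cell L M S n C" "\<Union>\<C> = X" "openin (pow_top S n) W" "X \<inter> W \<noteq> {}"
  shows "\<exists>C\<in>\<C>. \<exists>d s V \<theta> N Z. graph_over n d s V \<theta> N Z \<and> N \<subseteq> W \<and> Z = X \<inter> N \<and> Z \<subseteq> C \<and> Z \<noteq> {}"
proof -
  have sub: "C \<subseteq> pow M n" if "C \<in> \<C>" for C using definable_subset[OF definable_cell[OF assms(2)[OF that]]] .
  then have "\<exists>C\<in>\<C>. \<exists>W'. openin (pow_top S n) W' \<and> W' \<subseteq> W \<and> X \<inter> W' \<noteq> {} \<and> X \<inter> W' \<subseteq> pow_top S n closure_of C"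
    using assms by (intro somewhere_dense) (auto simp: topspace_pow_top)
  then obtain C W' where C: "C \<in> \<C>" and W': "openin (pow_top S n) W'" "W' \<subseteq> W" "X \<inter> W' \<noteq> {}"
    "X \<inter> W' \<subseteq> pow_top S n closure_of C" by blast
  obtain x0 where x0: "x0 \<in> X \<inter> W'" using W'(3) by blast
  then have "x0 \<in> pow_top S n closure_of C" using W'(4) by blast
  then have "\<forall>T. x0 \<in> T \<and> openin (pow_top S n) T \<longrightarrow> (\<exists>y. y \<in> C \<and> y \<in> T)" by (simp add: in_closure_of)
  with x0 W'(1) obtain p where p: "p \<in> C" "p \<in> W'" by blast
  obtain d s V \<theta> N Z where g: "graph_over n d s V \<theta> N Z" "p \<in> Z" "Z = C \<inter> N"
    using cell_graph_over[OF assms(2)[OF C] p(1)] by blast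
  obtain b where b: "b \<in> pow M (n * kb)" "p \<in> Box n b" "Box n b \<subseteq> W'" using Box_nbhd[OF W'(1) p(2)] by blast
  obtain V' N' where g': "graph_over n d s V' \<theta> N' (Z \<inter> Box n b)" "N' \<subseteq> N \<inter> Box n b"
    using graph_over_shrink[OF g(1) definable_Box[OF b(1)] open_Box[OF b(1)]] by blast
  have im: "\<theta> ` V' = Z \<inter> Box n b" and inv: "\<And>v. v \<in> V' \<Longrightarrow> coord_proj d s (\<theta> v) = v"
    and NV: "\<And>x. x \<in> N' \<Longrightarrow> coord_proj d s x \<in> V'" and ZN: "Z \<inter> Box n b \<subseteq> N'"
    using g'(1) unfolding graph_over_def by auto
  have "X \<inter> N' \<subseteq> Z \<inter> Box n b"
  proof
    fix x assume x: "x \<in> X \<inter> N'"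
    have "\<theta> (coord_proj d s x) = x"
    proof (rule ccontr)
      assume "\<theta> (coord_proj d s x) \<noteq> x"
      then have xD: "x \<in> {x \<in> N'. \<theta> (coord_proj d s x) \<noteq> x}" using x by simp
      have "x \<in> pow_top S n closure_of C" using x g'(2) b(3) W'(4) by blast
      then have "\<forall>T. x \<in> T \<and> openin (pow_top S n) T \<longrightarrow> (\<exists>y. y \<in> C \<and> y \<in> T)" by (simp add: in_closure_of)
      from this[rule_format, OF conjI[OF xD graph_over_closed[OF g'(1)]]] obtain y where y: "y \<in> C" "y \<in> N'" "\<theta> (coord_proj d s y) \<noteq> y" by auto
      then have "y \<in> \<theta> ` V'" unfolding im using g'(2) g(3) by blast
      then show False using y(3) inv by auto
    qed
    then have "x \<in> \<theta> ` V'" using NV[of x] x by force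
    then show "x \<in> Z \<inter> Box n b" unfolding im .
  qed
  moreover have "Z \<inter> Box n b \<subseteq> X" using g(3) C assms(3) by blast
  ultimately have "Z \<inter> Box n b = X \<inter> N'" using ZN by blast
  moreover have "N' \<subseteq> W" using g'(2) b(3) W'(2) by blast
  moreover have "Z \<inter> Box n b \<subseteq> C" "Z \<inter> Box n b \<noteq> {}" using g(2,3) b(2) by blast+
  ultimately show ?thesis using g'(1) C by blast
qed

end

section \<open>Definable maps\<close>

context fo_structure
begin

text \<open>Unlike \<open>dtup\<close>, this admits values of definable functions: the graph is
  definable, with the value placed in block 0.\<close>

definition dterm :: "nat \<Rightarrow> ((nat \<Rightarrow> nat \<Rightarrow> 'a) \<Rightarrow> 'a point) \<Rightarrow> bool" where
  "dterm n t \<longleftrightarrow> (\<forall>w\<in>envs. t w \<in> pow M n) \<and> dfn (\<lambda>w. restrict (w 0) {..<n} = t (\<lambda>b. w (Suc b)))"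

text \<open>The term is eliminated by a quantifier over a tuple \<open>u\<close> equal to its
  value.\<close>

lemma dfn_term:
  assumes "dfn (\<lambda>w. P (\<lambda>b. w (Suc b)) (restrict (w 0) {..<n}))" "dterm n t"
  shows "dfn (\<lambda>w. P w (t w))"
proof (rule dfn_congI)
  show "dfn (\<lambda>w. \<exists>u\<in>pow M n. u = t w \<and> P w u)"
    using assms unfolding dterm_def by (intro dfn_Bex_pow dfn_conj) auto
qed (use assms(2) in \<open>auto simp: dterm_def\<close>)

lemma dterm_comp:
  assumes "dterm n t" "\<And>b i. delt (\<lambda>w. T w b i)"
  shows "dterm n (\<lambda>w. t (T w))"
proof -
  have T: "T w \<in> envs" if "w \<in> envs" for w using delt_in[OF assms(2) that] by auto
  have sh: "delt (\<lambda>w. T (\<lambda>b. w (Suc b)) b i)" for b i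
    using delt_comp[OF assms(2), of "\<lambda>w b. w (Suc b)"] by (simp add: delt_var)
  have "dfn (\<lambda>w. restrict (w 0) {..<n} = t (\<lambda>b. w (Suc b)))" using assms(1) by (simp add: dterm_def)
  from dfn_comp[OF this, of "\<lambda>w b i. if b = 0 then w 0 i else T (\<lambda>b. w (Suc b)) (b - 1) i"]
  have "dfn (\<lambda>w. restrict (w 0) {..<n} = t (\<lambda>b. T (\<lambda>b. w (Suc b)) b))"
    by (simp add: delt_if delt_var sh)
  then show ?thesis using assms(1) T by (simp add: dterm_def)
qed

lemma dterm_shift: "dterm n t \<Longrightarrow> dterm n (\<lambda>w. t (\<lambda>b. w (Suc b)))"
  using dterm_comp[of n t "\<lambda>w b. w (Suc b)"] by (simp add: delt_var)

lemma dterm_dtup: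
  assumes "dtup n t" shows "dterm n t"
  unfolding dterm_def
proof
  show "\<forall>w\<in>envs. t w \<in> pow M n" using dtup_in[OF assms] by blast
  have "dtup n (\<lambda>w. t (\<lambda>b. w (Suc b)))"
    unfolding dtup_def
  proof
    show "\<forall>w\<in>envs. t (\<lambda>b. w (Suc b)) \<in> extensional {..<n}"
      using assms unfolding dtup_def by simp
    show "\<forall>i<n. delt (\<lambda>w. t (\<lambda>b. w (Suc b)) i)"
    proof (intro allI impI)
      fix i assume "i < n"
      then show "delt (\<lambda>w. t (\<lambda>b. w (Suc b)) i)"
        using delt_comp[OF delt_nth[OF assms], of i "\<lambda>w b. w (Suc b)"] by (simp add: delt_var)
    qed
  qed
  then show "dfn (\<lambda>w. restrict (w 0) {..<n} = t (\<lambda>b. w (Suc b)))"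
    by (rule dfn_tup_eq[OF dtup_var])
qed

lemma dfn_mem_term:
  assumes "definable L M n X" "dterm n t" shows "dfn (\<lambda>w. t w \<in> X)"
  by (rule dfn_term[where P = "\<lambda>w u. u \<in> X", OF dfn_mem[OF assms(1) dtup_var] assms(2)])

lemma dfn_eq_term:
  assumes "dterm n s" "dterm n t" shows "dfn (\<lambda>w. s w = t w)"
proof (rule dfn_term[OF _ assms(1)])
  show "dfn (\<lambda>w. restrict (w 0) {..<n} = t (\<lambda>b. w (Suc b)))"
    using assms(2) by (simp add: dterm_def)
qed

definition dmap :: "nat \<Rightarrow> nat \<Rightarrow> ('a point \<Rightarrow> 'a point) \<Rightarrow> bool" where
  "dmap d m F \<longleftrightarrow> (\<forall>x\<in>pow M d. F x \<in> pow M m) \<and> dterm m (\<lambda>w. F (restrict (w 0) {..<d}))"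

lemma dmap_in: "dmap d m F \<Longrightarrow> x \<in> pow M d \<Longrightarrow> F x \<in> pow M m"
  by (auto simp: dmap_def)

lemma dterm_dmap:
  assumes "dmap d m F" "dterm d s"
  shows "dterm m (\<lambda>w. F (s w))"
  unfolding dterm_def
proof
  show "\<forall>w\<in>envs. F (s w) \<in> pow M m"
    using assms by (auto simp: dterm_def dmap_def)
  have "dterm m (\<lambda>w. F (restrict (w 0) {..<d}))" using assms(1) by (simp add: dmap_def)
  then have "dfn (\<lambda>w. restrict (w (Suc 0)) {..<m} = F (restrict (w 0) {..<d}))"
    by (intro dfn_eq_term[of m] dterm_dtup[OF dtup_var])
  then show "dfn (\<lambda>w. restrict (w 0) {..<m} = F (s (\<lambda>b. w (Suc b))))"
    by (rule dfn_term[OF _ dterm_shift[OF assms(2)]])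
qed

lemma dmapI: "dterm m (\<lambda>w. F (restrict (w 0) {..<d})) \<Longrightarrow> dmap d m F"
proof -
  assume t: "dterm m (\<lambda>w. F (restrict (w 0) {..<d}))"
  have "F x \<in> pow M m" if x: "x \<in> pow M d" for x
  proof -
    obtain c where c: "c \<in> Dom M" using Dom_ne by blast
    define w where "w b i = (if i < d then x i else c)" for b i :: nat
    have "w \<in> envs" using x c by (auto simp: w_def)
    then have "F (restrict (w 0) {..<d}) \<in> pow M m" using t by (simp add: dterm_def)
    moreover have "restrict (w 0) {..<d} = x"
      using x by (auto simp: w_def pow_def PiE_def extensional_def fun_eq_iff)
    ultimately show ?thesis by simp
  qed
  with t show ?thesis by (simp add: dmap_def)
qed

lemma dmap_comp: "dmap d m F \<Longrightarrow> dmap m k H \<Longrightarrow> dmap d k (\<lambda>x. H (F x))"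
  by (rule dmapI) (rule dterm_dmap[OF _ dterm_dmap[OF _ dterm_dtup[OF dtup_var]]])

lemma definable_graph:
  assumes "definable L M d X" "dmap d m F"
  shows "definable L M (d + m) {append_pt d m x (F x) | x. x \<in> X}"
proof -
  have "definable L M (d + m) {z \<in> pow M (d + m). restrict z {..<d} \<in> X \<and>
      coord_proj m ((+) d) z = F (restrict z {..<d})}"
    by (intro definable_Collect dfn_conj dfn_mem[OF assms(1)] dtup_restrict[of "d + m"] dtup_var
      dfn_eq_term[of m] dterm_dtup[OF dtup_coord_proj[of "d + m"]] dterm_dmap[OF assms(2)]
      dterm_dtup[OF dtup_restrict[of "d + m"]]) auto
  moreover have "{z \<in> pow M (d + m). restrict z {..<d} \<in> X \<and> coord_proj m ((+) d) z = F (restrict z {..<d})} =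
      {append_pt d m x (F x) | x. x \<in> X}" (is "?A = ?B")
  proof
    show "?A \<subseteq> ?B"
    proof
      fix z assume "z \<in> ?A"
      then show "z \<in> ?B" using append_split[of z M d m] by (intro CollectI exI[of _ "restrict z {..<d}"]) auto
    qed
    show "?B \<subseteq> ?A"
    proof
      fix z assume "z \<in> ?B"
      then obtain x where x: "x \<in> X" "z = append_pt d m x (F x)" by blast
      then have "x \<in> pow M d" "F x \<in> pow M m"
        using definable_subset[OF assms(1)] dmap_in[OF assms(2)] by blast+
      then show "z \<in> ?A" using x by (simp add: append_in restrict_append drop_append)
    qed
  qed
  ultimately show ?thesis by simp
qed

lemma append_inject:
  "x \<in> pow M d \<Longrightarrow> x' \<in> pow M d \<Longrightarrow> y \<in> pow M m \<Longrightarrow> y' \<in> pow M m \<Longrightarrow>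
    append_pt d m x y = append_pt d m x' y' \<Longrightarrow> x = x' \<and> y = y'"
  using restrict_append[of x M d m y] restrict_append[of x' M d m y'] drop_append[of y M m d x]
    drop_append[of y' M m d x'] by simp

text \<open>\<open>dmap\<close> asks for maps on the whole power, so a partial definable map is
  completed by a constant.\<close>

lemma dmap_of_graph:
  assumes "definable L M d X" "definable L M (d + m) {append_pt d m x (F x) | x. x \<in> X}"
    "F ` X \<subseteq> pow M m" "c \<in> pow M m"
  shows "dmap d m (\<lambda>x. if x \<in> X then F x else c)"
proof (rule dmapI, unfold dterm_def, intro conjI ballI)
  let ?G = "{append_pt d m x (F x) | x. x \<in> X}"
  show "(if restrict (w 0) {..<d} \<in> X then F (restrict (w 0) {..<d}) else c) \<in> pow M m" for w
    using assms(3,4) by auto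
  show "dfn (\<lambda>w. restrict (w 0) {..<m} =
      (if restrict (w (Suc 0)) {..<d} \<in> X then F (restrict (w (Suc 0)) {..<d}) else c))"
  proof (rule dfn_congI)
    show "dfn (\<lambda>w. (restrict (w (Suc 0)) {..<d} \<in> X \<and>
        append_pt d m (restrict (w (Suc 0)) {..<d}) (restrict (w 0) {..<m}) \<in> ?G) \<or>
        (restrict (w (Suc 0)) {..<d} \<notin> X \<and> restrict (w 0) {..<m} = c))"
      by (intro dfn_disj dfn_conj dfn_neg dfn_mem[OF assms(1)] dfn_mem[OF assms(2)] dtup_append dtup_var
        dfn_tup_eq[of m] dtup_const assms(4))
    fix w :: "nat \<Rightarrow> nat \<Rightarrow> 'a" assume w: "w \<in> envs"
    let ?x = "restrict (w (Suc 0)) {..<d}" and ?y = "restrict (w 0) {..<m}"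
    have xy: "?x \<in> pow M d" "?y \<in> pow M m" using w by (auto simp: pow_def)
    have "append_pt d m ?x ?y \<in> ?G \<longleftrightarrow> ?y = F ?x" if "?x \<in> X"
    proof
      assume "append_pt d m ?x ?y \<in> ?G"
      then obtain x where x: "x \<in> X" "append_pt d m ?x ?y = append_pt d m x (F x)" by blast
      have "x \<in> pow M d" "F x \<in> pow M m" using x(1) assms(3) definable_subset[OF assms(1)] by blast+
      then show "?y = F ?x" using append_inject[OF xy(1) _ xy(2) _ x(2)] by blast
    next
      assume "?y = F ?x"
      then show "append_pt d m ?x ?y \<in> ?G" using that by (intro CollectI exI[of _ ?x] conjI) simp_all
    qed
    then show "(?x \<in> X \<and> append_pt d m ?x ?y \<in> ?G) \<or> (?x \<notin> X \<and> ?y = c) \<longleftrightarrow>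
        ?y = (if ?x \<in> X then F ?x else c)" by auto
  qed
qed

end

section \<open>Definable groups with a definable topology\<close>

locale definable_group_space =
  tame_structure L M S Bs kb + group G
  for L :: "('f, 'r) language" and M :: "('f, 'r, 'a) struct" and S :: "'a topology" and Bs kb
    and G :: "'a point monoid" (structure) +
  fixes n :: nat and \<tau> :: "'a point topology"
  assumes definable_group: "definable_group L M n G"
    and space: "definable_space L M n (carrier G) \<tau>"
    and semimanifold: "definable_semimanifold L M S n (carrier G) \<tau>"
    and left_continuous: "\<And>a. a \<in> carrier G \<Longrightarrow> continuous_map \<tau> \<tau> (\<lambda>x. a \<otimes> x)"
begin

lemma definable_carrier: "definable L M n (carrier G)"
  using definable_group by (simp add: definable_group_def)

lemma topspace_\<tau>: "topspace \<tau> = carrier G"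
  using space by (simp add: definable_space_def)

lemma carrier_pow: "x \<in> carrier G \<Longrightarrow> x \<in> pow M n"
  using definable_subset[OF definable_carrier] by blast

text \<open>Total versions of the group operations: \<open>dterm\<close> requires a value in
  \<open>pow M n\<close> at every valuation.\<close>

definition gm :: "'a point \<Rightarrow> 'a point \<Rightarrow> 'a point" where
  "gm x y = (if x \<in> carrier G \<and> y \<in> carrier G then x \<otimes> y else \<one>)"

definition gi :: "'a point \<Rightarrow> 'a point" where
  "gi x = (if x \<in> carrier G then m_inv G x else \<one>)"

lemma gm_closed: "gm x y \<in> carrier G" by (simp add: gm_def)
lemma gi_closed: "gi x \<in> carrier G" by (simp add: gi_def)

lemma dterm_gm:
  assumes "dterm n s" "dterm n t"
  shows "dterm n (\<lambda>w. gm (s w) (t w))"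
  unfolding dterm_def
proof
  show "\<forall>w\<in>envs. gm (s w) (t w) \<in> pow M n" using gm_closed carrier_pow by blast
  let ?G = "{append_pt (n + n) n (append_pt n n x y) (x \<otimes> y) | x y. x \<in> carrier G \<and> y \<in> carrier G}"
  have defG: "definable L M (n + n + n) ?G" using definable_group by (simp add: definable_group_def)
  have "dfn (\<lambda>w. restrict (w (Suc (Suc 0))) {..<n} = gm (restrict (w (Suc 0)) {..<n}) (restrict (w 0) {..<n}))"
  proof (rule dfn_congI)
    show "dfn (\<lambda>w. (restrict (w (Suc 0)) {..<n} \<in> carrier G \<and> restrict (w 0) {..<n} \<in> carrier G \<and>
        append_pt (n + n) n (append_pt n n (restrict (w (Suc 0)) {..<n}) (restrict (w 0) {..<n}))
          (restrict (w (Suc (Suc 0))) {..<n}) \<in> ?G) \<or>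
        (\<not> (restrict (w (Suc 0)) {..<n} \<in> carrier G \<and> restrict (w 0) {..<n} \<in> carrier G) \<and>
          restrict (w (Suc (Suc 0))) {..<n} = \<one>))"
      by (intro dfn_disj dfn_conj dfn_neg dfn_mem[OF definable_carrier] dfn_mem[OF defG] dtup_append dtup_var
        dfn_tup_eq[of n] dtup_const carrier_pow one_closed)
    fix w :: "nat \<Rightarrow> nat \<Rightarrow> 'a" assume w: "w \<in> envs"
    let ?x = "restrict (w (Suc 0)) {..<n}" and ?y = "restrict (w 0) {..<n}" and ?z = "restrict (w (Suc (Suc 0))) {..<n}"
    have xyz: "?x \<in> pow M n" "?y \<in> pow M n" "?z \<in> pow M n" using w by (auto simp: pow_def)
    have "append_pt (n + n) n (append_pt n n ?x ?y) ?z \<in> ?G \<longleftrightarrow> ?z = ?x \<otimes> ?y"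
      if "?x \<in> carrier G" "?y \<in> carrier G"
    proof
      assume "append_pt (n + n) n (append_pt n n ?x ?y) ?z \<in> ?G"
      then obtain x y where x: "x \<in> carrier G" "y \<in> carrier G"
        "append_pt (n + n) n (append_pt n n ?x ?y) ?z = append_pt (n + n) n (append_pt n n x y) (x \<otimes> y)" by blast
      have p: "x \<in> pow M n" "y \<in> pow M n" "x \<otimes> y \<in> pow M n" using x carrier_pow by auto
      have "append_pt n n ?x ?y = append_pt n n x y \<and> ?z = x \<otimes> y"
        by (rule append_inject[OF append_in[OF xyz(1,2)] append_in[OF p(1,2)] xyz(3) p(3) x(3)])
      moreover then have "?x = x \<and> ?y = y" using append_inject[OF xyz(1) p(1) xyz(2) p(2)] by blast
      ultimately show "?z = ?x \<otimes> ?y" by simp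
    next
      assume "?z = ?x \<otimes> ?y"
      then show "append_pt (n + n) n (append_pt n n ?x ?y) ?z \<in> ?G"
        using that by (intro CollectI exI[of _ ?x] exI[of _ ?y] conjI) simp_all
    qed
    then show "(?x \<in> carrier G \<and> ?y \<in> carrier G \<and> append_pt (n + n) n (append_pt n n ?x ?y) ?z \<in> ?G) \<or>
        (\<not> (?x \<in> carrier G \<and> ?y \<in> carrier G) \<and> ?z = \<one>) \<longleftrightarrow> ?z = gm ?x ?y"
      by (auto simp: gm_def)
  qed
  then have "dfn (\<lambda>w. restrict (w (Suc 0)) {..<n} = gm (restrict (w 0) {..<n}) (t (\<lambda>b. w (Suc (Suc b)))))"
    by (rule dfn_term[OF _ dterm_shift[OF dterm_shift[OF assms(2)]]])
  then show "dfn (\<lambda>w. restrict (w 0) {..<n} = gm (s (\<lambda>b. w (Suc b))) (t (\<lambda>b. w (Suc b))))"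
    by (rule dfn_term[OF _ dterm_shift[OF assms(1)]])
qed

lemma dmap_gi: "dmap n n gi"
proof (rule dmapI, unfold dterm_def, intro conjI ballI)
  show "gi (restrict (w 0) {..<n}) \<in> pow M n" for w using gi_closed carrier_pow by blast
  show "dfn (\<lambda>w. restrict (w 0) {..<n} = gi (restrict (w (Suc 0)) {..<n}))"
  proof (rule dfn_congI)
    show "dfn (\<lambda>w. (restrict (w (Suc 0)) {..<n} \<in> carrier G \<and> restrict (w 0) {..<n} \<in> carrier G \<and>
          gm (restrict (w (Suc 0)) {..<n}) (restrict (w 0) {..<n}) = \<one>) \<or>
        (restrict (w (Suc 0)) {..<n} \<notin> carrier G \<and> restrict (w 0) {..<n} = \<one>))"
      by (intro dfn_disj dfn_conj dfn_neg dfn_mem[OF definable_carrier] dtup_var dfn_eq_term[of n]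
        dterm_gm dterm_dtup[OF dtup_var] dterm_dtup[OF dtup_const] carrier_pow one_closed)
    fix w :: "nat \<Rightarrow> nat \<Rightarrow> 'a"
    let ?x = "restrict (w (Suc 0)) {..<n}" and ?y = "restrict (w 0) {..<n}"
    have "?y \<in> carrier G \<and> gm ?x ?y = \<one> \<longleftrightarrow> ?y = m_inv G ?x" if x: "?x \<in> carrier G"
    proof
      assume "?y \<in> carrier G \<and> gm ?x ?y = \<one>"
      then have y: "?y \<in> carrier G" "?x \<otimes> ?y = \<one>" using x by (auto simp: gm_def)
      then show "?y = m_inv G ?x"
        using inv_equality[OF inv_comm[OF y(2) x y(1)] x y(1)] by simp
    qed (use x in \<open>simp add: gm_def\<close>)
    then show "(?x \<in> carrier G \<and> ?y \<in> carrier G \<and> gm ?x ?y = \<one>) \<or> (?x \<notin> carrier G \<and> ?y = \<one>) \<longleftrightarrow> ?y = gi ?x"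
      by (auto simp: gi_def)
  qed
qed

section \<open>Charts, local parametrizations and generic continuity in the group\<close>

definition chart :: "'a point set \<Rightarrow> nat \<Rightarrow> 'a point set \<Rightarrow> ('a point \<Rightarrow> 'a point) \<Rightarrow> bool" where
  "chart U m X h \<longleftrightarrow> definable L M n U \<and> openin \<tau> U \<and> definable L M m X \<and> definable_chart L M S n \<tau> U m X h"

lemma charts:
  obtains \<U> where "finite \<U>" "\<Union>\<U> = carrier G" "\<forall>U\<in>\<U>. \<exists>m X h. chart U m X h"
  using semimanifold unfolding definable_semimanifold_def chart_def by metis

lemma chart_facts:
  assumes c: "chart U m X h"
  shows "h ` U = X" "inj_on h U" "X \<subseteq> pow M m"
    "\<And>W. openin (pow_top S m) W \<Longrightarrow> openin \<tau> {u \<in> U. h u \<in> W}"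
    "\<And>O'. openin \<tau> O' \<Longrightarrow> \<exists>W. openin (pow_top S m) W \<and> (\<forall>u\<in>U. u \<in> O' \<longleftrightarrow> h u \<in> W)"
    "definable L M (n + m) {append_pt n m x (h x) | x. x \<in> U}"
proof -
  have U: "openin \<tau> U" and hom: "homeomorphic_map (subtopology \<tau> U) (subtopology (pow_top S m) X) h"
    using c by (auto simp: chart_def definable_chart_def)
  show X: "X \<subseteq> pow M m" using c definable_subset unfolding chart_def by blast
  have tU: "topspace (subtopology \<tau> U) = U" using openin_subset[OF U] by (simp add: inf.absorb2)
  have tX: "topspace (subtopology (pow_top S m) X) = X" using X by (simp add: topspace_pow_top inf.absorb2)
  show im: "h ` U = X" using homeomorphic_imp_surjective_map[OF hom] by (simp only: tU tX)
  show inj: "inj_on h U" using homeomorphic_imp_injective_map[OF hom] by (simp only: tU)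
  show "openin \<tau> {u \<in> U. h u \<in> W}" if W: "openin (pow_top S m) W" for W
  proof -
    have "continuous_map (subtopology \<tau> U) (pow_top S m) h"
      using homeomorphic_imp_continuous_map[OF hom] continuous_map_into_fulltopology by blast
    then show ?thesis using U W by (rule continuous_subtopology_openin)
  qed
  show "\<exists>W. openin (pow_top S m) W \<and> (\<forall>u\<in>U. u \<in> O' \<longleftrightarrow> h u \<in> W)" if O': "openin \<tau> O'" for O'
  proof -
    have "openin (subtopology \<tau> U) (O' \<inter> U)" using O' by (auto simp: openin_subtopology)
    then have "openin (subtopology (pow_top S m) X) (h ` (O' \<inter> U))"
      using homeomorphic_imp_open_map[OF hom] by (simp add: open_map_def)
    then obtain W where W: "openin (pow_top S m) W" "h ` (O' \<inter> U) = W \<inter> X"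
      by (auto simp: openin_subtopology)
    have "u \<in> O' \<longleftrightarrow> h u \<in> W" if u: "u \<in> U" for u
    proof
      assume "u \<in> O'" then show "h u \<in> W" using W(2) u by blast
    next
      assume "h u \<in> W"
      then have "h u \<in> h ` (O' \<inter> U)" using W(2) im u by blast
      then show "u \<in> O'" using inj u by (auto dest: inj_onD)
    qed
    then show ?thesis using W(1) by blast
  qed
  show "definable L M (n + m) {append_pt n m x (h x) | x. x \<in> U}"
    using c by (simp add: chart_def definable_chart_def)
qed

lemma chart_dmap:
  assumes "chart U m X h"
  obtains h' where "dmap n m h'" "\<And>x. x \<in> U \<Longrightarrow> h' x = h x"
proof -
  obtain c where "c \<in> pow M m" using pow_nonempty by blast
  moreover have "h ` U \<subseteq> pow M m" using chart_facts(1,3)[OF assms] by simp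
  moreover have "definable L M n U" using assms by (simp add: chart_def)
  ultimately have "dmap n m (\<lambda>x. if x \<in> U then h x else c)"
    using chart_facts(6)[OF assms] by (intro dmap_of_graph)
  then show ?thesis by (rule that) simp
qed

text \<open>In a chart with image \<open>X\<close>, the part belonging to \<open>O'\<close> is
  relatively open, and \<open>graph_over_dense\<close> finds in it a relatively open piece
  \<open>Z\<close> that is a graph over an open \<open>V\<close>. Following the graph map by the
  inverse of the chart gives a definable map from \<open>V\<close> that sends open sets to
  \<open>\<tau>\<close>-open sets; this carries statements about interior in a power over to the
  group.\<close>

lemma local_parametrization:
  assumes O': "openin \<tau> O'" "O' \<noteq> {}"
  obtains d V \<theta> where "definable L M d V" "openin (pow_top S d) V" "V \<noteq> {}" "dmap d n \<theta>" "\<theta> ` V \<subseteq> O'"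
    "\<And>A. openin (pow_top S d) A \<Longrightarrow> A \<subseteq> V \<Longrightarrow> openin \<tau> (\<theta> ` A)"
proof -
  obtain \<U> where \<U>: "finite \<U>" "\<Union>\<U> = carrier G" "\<forall>U\<in>\<U>. \<exists>m X h. chart U m X h" by (rule charts)
  obtain u0 where u0: "u0 \<in> O'" using O'(2) by blast
  then have "u0 \<in> carrier G" using openin_subset[OF O'(1)] topspace_\<tau> by blast
  then obtain U where U: "U \<in> \<U>" "u0 \<in> U" using \<U>(2) by blast
  then obtain m X h where c: "chart U m X h" using \<U>(3) by blast
  note cf = chart_facts[OF c]
  obtain W where W: "openin (pow_top S m) W" "\<forall>u\<in>U. u \<in> O' \<longleftrightarrow> h u \<in> W" using cf(5)[OF O'(1)] by blast
  have XW: "X \<inter> W \<noteq> {}" using u0 U(2) W(2) cf(1) by blast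
  have defX: "definable L M m X" using c by (simp add: chart_def)
  obtain \<C> where \<C>: "finite \<C>" "\<forall>C\<in>\<C>. cell L M S m C" "\<Union>\<C> = X" using cell_decomposition[OF defX] by blast
  have "\<exists>C\<in>\<C>. \<exists>d s V \<theta> N Z. graph_over m d s V \<theta> N Z \<and> N \<subseteq> W \<and> Z = X \<inter> N \<and> Z \<subseteq> C \<and> Z \<noteq> {}"
    using \<C>(2) by (intro graph_over_dense[OF \<C>(1) _ \<C>(3) W(1) XW]) blast
  then obtain d s V \<theta> N Z where g: "graph_over m d s V \<theta> N Z" "N \<subseteq> W" "Z = X \<inter> N" "Z \<noteq> {}"
    by (elim bexE exE conjE)
  have V: "definable L M d V" "openin (pow_top S d) V" and s: "s ` {..<d} \<subseteq> {..<m}"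
    and im: "\<theta> ` V = Z" and inv: "\<And>v. v \<in> V \<Longrightarrow> coord_proj d s (\<theta> v) = v"
    and N: "openin (pow_top S m) N" "\<And>x. x \<in> N \<Longrightarrow> coord_proj d s x \<in> V" and Z: "definable L M m Z"
    using g(1) unfolding graph_over_def by auto
  define k where "k = inv_into U h"
  have hk: "h (k x) = x" "k x \<in> U" if "x \<in> X" for x
    using that f_inv_into_f[of x h U] inv_into_into[of x h U] by (simp_all add: k_def cf(1))
  have \<theta>X: "\<theta> v \<in> X" "\<theta> v \<in> N" if "v \<in> V" for v using that im g(3) by blast+
  let ?H = "{append_pt n m x (h x) | x. x \<in> U}"
  have Un: "U \<subseteq> pow M n" using c definable_subset unfolding chart_def by blast
  have Vd: "V \<subseteq> pow M d" using definable_subset[OF V(1)] .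
  \<comment> \<open>The graph of the composite is expressed through a point \<open>x\<close> of the
    definable set \<open>Z\<close> and the definable graph of the chart \<open>h\<close>.\<close>
  have "definable L M (d + n) {z \<in> pow M (d + n). \<exists>x\<in>pow M m. x \<in> Z \<and> coord_proj d s x = restrict z {..<d} \<and>
      append_pt n m (coord_proj n ((+) d) z) x \<in> ?H}"
    by (intro definable_Collect dfn_Bex_pow dfn_conj dfn_mem[OF Z] dfn_mem[OF cf(6)] dfn_tup_eq[of d]
      dtup_append dtup_var dtup_coord_proj[of m] dtup_coord_proj[of "d + n"] dtup_restrict[of "d + n"] s) auto
  moreover have "{z \<in> pow M (d + n). \<exists>x\<in>pow M m. x \<in> Z \<and> coord_proj d s x = restrict z {..<d} \<and>
      append_pt n m (coord_proj n ((+) d) z) x \<in> ?H} = {append_pt d n v (k (\<theta> v)) | v. v \<in> V}" (is "?A = ?B")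
  proof
    show "?A \<subseteq> ?B"
    proof
      fix z assume "z \<in> ?A"
      then obtain x where z: "z \<in> pow M (d + n)" and x: "x \<in> pow M m" "x \<in> Z" "coord_proj d s x = restrict z {..<d}"
        "append_pt n m (coord_proj n ((+) d) z) x \<in> ?H" by blast
      obtain v where v: "v \<in> V" "x = \<theta> v" using x(2) im by blast
      then have rz: "restrict z {..<d} = v" using inv x(3) by simp
      obtain u where u: "u \<in> U" "append_pt n m (coord_proj n ((+) d) z) x = append_pt n m u (h u)" using x(4) by blast
      have "coord_proj n ((+) d) z = u \<and> x = h u"
        using u Un cf(1,3) x(1) by (intro append_inject[OF drop_in[OF z]]) auto
      moreover have "k (h u) = u" using cf(2) u(1) by (simp add: k_def)
      ultimately have "coord_proj n ((+) d) z = k (\<theta> v)" using v(2) by simp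
      then have "z = append_pt d n v (k (\<theta> v))" using append_split[OF z] rz by simp
      then show "z \<in> ?B" using v(1) by blast
    qed
    show "?B \<subseteq> ?A"
    proof
      fix z assume "z \<in> ?B"
      then obtain v where v: "v \<in> V" "z = append_pt d n v (k (\<theta> v))" by blast
      have "v \<in> pow M d" "k (\<theta> v) \<in> pow M n" "\<theta> v \<in> pow M m"
        using v(1) Vd hk(2)[OF \<theta>X(1)] Un \<theta>X(1) cf(3) by blast+
      moreover have "append_pt n m (k (\<theta> v)) (\<theta> v) \<in> ?H"
        using hk[OF \<theta>X(1)[OF v(1)]] by (intro CollectI exI[of _ "k (\<theta> v)"]) simp
      moreover have "\<theta> v \<in> Z" using v(1) im by blast
      ultimately show "z \<in> ?A"
        using v inv[OF v(1)] by (auto simp: append_in restrict_append drop_append intro!: bexI[of _ "\<theta> v"])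
    qed
  qed
  ultimately have graph: "definable L M (d + n) {append_pt d n v (k (\<theta> v)) | v. v \<in> V}" by simp
  define \<Theta> where "\<Theta> v = (if v \<in> V then k (\<theta> v) else \<one>)" for v
  have "dmap d n \<Theta>"
    unfolding \<Theta>_def using V(1) graph
  proof (rule dmap_of_graph)
    show "(\<lambda>v. k (\<theta> v)) ` V \<subseteq> pow M n" using hk(2)[OF \<theta>X(1)] Un by blast
  qed (rule carrier_pow[OF one_closed])
  moreover have "\<Theta> ` V \<subseteq> O'"
  proof
    fix x assume "x \<in> \<Theta> ` V"
    then obtain v where v: "v \<in> V" "x = k (\<theta> v)" by (auto simp: \<Theta>_def)
    then show "x \<in> O'" using W(2) hk[OF \<theta>X(1)[OF v(1)]] \<theta>X(2)[OF v(1)] g(2) by auto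
  qed
  moreover have "openin \<tau> (\<Theta> ` A)" if A: "openin (pow_top S d) A" "A \<subseteq> V" for A
  proof -
    \<comment> \<open>The projection along \<open>s\<close> inverts the graph map, so the image of
      \<open>A\<close> is the preimage under the chart of an open set.\<close>
    have "\<Theta> ` A = {u \<in> U. h u \<in> N \<inter> {x \<in> pow M m. coord_proj d s x \<in> A}}"
    proof
      show "\<Theta> ` A \<subseteq> {u \<in> U. h u \<in> N \<inter> {x \<in> pow M m. coord_proj d s x \<in> A}}"
      proof
        fix u assume "u \<in> \<Theta> ` A"
        then obtain v where v: "v \<in> A" "v \<in> V" "u = k (\<theta> v)" using A(2) by (auto simp: \<Theta>_def)
        then show "u \<in> {u \<in> U. h u \<in> N \<inter> {x \<in> pow M m. coord_proj d s x \<in> A}}"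
          using hk[OF \<theta>X(1)[OF v(2)]] \<theta>X[OF v(2)] inv[OF v(2)] cf(3) by auto
      qed
      show "{u \<in> U. h u \<in> N \<inter> {x \<in> pow M m. coord_proj d s x \<in> A}} \<subseteq> \<Theta> ` A"
      proof
        fix u assume u: "u \<in> {u \<in> U. h u \<in> N \<inter> {x \<in> pow M m. coord_proj d s x \<in> A}}"
        then have "h u \<in> Z" using g(3) cf(1) by blast
        then obtain v where v: "v \<in> V" "h u = \<theta> v" using im by blast
        then have "v \<in> A" using u inv[OF v(1)] by auto
        moreover have "k (h u) = u" using cf(2) u by (simp add: k_def)
        ultimately show "u \<in> \<Theta> ` A" using v by (force simp: \<Theta>_def)
      qed
    qed
    then show ?thesis using cf(4)[OF openin_Int[OF N(1) open_preimage_coord_proj[OF A(1) s]]] by simp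
  qed
  moreover have "V \<noteq> {}" using g(4) im by blast
  ultimately show ?thesis using that[of d V \<Theta>] V by simp
qed

text \<open>Niceness concerns maps into powers of the structure. The finitely many preimages of
  chart domains cover \<open>V\<close>, so one of them has interior; there \<open>F\<close> followed
  by the chart is such a map, and the chart turns its continuity into continuity for
  \<open>\<tau>\<close>.\<close>

lemma generic_continuity_\<tau>:
  assumes V: "definable L M d V" "openin (pow_top S d) V" "V \<noteq> {}" and F: "dmap d n F" "F ` V \<subseteq> carrier G"
  obtains V1 where "V1 \<subseteq> V" "openin (pow_top S d) V1" "V1 \<noteq> {}"
    "\<And>W. openin \<tau> W \<Longrightarrow> openin (pow_top S d) {v \<in> V1. F v \<in> W}"
proof -
  obtain \<U> where \<U>: "finite \<U>" "\<Union>\<U> = carrier G" "\<forall>U\<in>\<U>. \<exists>m X h. chart U m X h" by (rule charts)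
  have "hasint d (\<Union>U\<in>\<U>. {v \<in> V. F v \<in> U})"
    using F(2) \<U>(2) by (intro hasintI[OF V(2,3)]) blast
  then have "\<exists>U\<in>\<U>. hasint d {v \<in> V. F v \<in> U}"
  proof (intro hasint_UN[OF \<U>(1)])
    fix U assume "U \<in> \<U>"
    then have "definable L M n U" using \<U>(3) unfolding chart_def by blast
    then show "definable L M d {v \<in> V. F v \<in> U}"
      by (intro definable_sub_Collect V(1) dfn_mem_term[of n] dterm_dmap[OF F(1)] dterm_dtup[OF dtup_var])
  qed
  then obtain U where U: "U \<in> \<U>" "hasint d {v \<in> V. F v \<in> U}" by blast
  obtain m X h where c: "chart U m X h" using \<U>(3) U(1) by blast
  note cf = chart_facts[OF c]
  obtain h' where h': "dmap n m h'" "\<And>x. x \<in> U \<Longrightarrow> h' x = h x" using chart_dmap[OF c] by blast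
  obtain V' where V': "definable L M d V'" "openin (pow_top S d) V'" "V' \<noteq> {}" "V' \<subseteq> {v \<in> V. F v \<in> U}"
    using U(2) by (rule hasintE)
  have H: "dmap d m (\<lambda>v. h' (F v))" using F(1) h'(1) by (rule dmap_comp)
  have "(\<lambda>v. h' (F v)) ` V' \<subseteq> pow M m" using dmap_in[OF H] definable_subset[OF V'(1)] by blast
  with V'(1,2) obtain V1 where V1: "V1 \<subseteq> V'" "definable L M d V1" "openin (pow_top S d) V1" "\<not> hasint d (V' - V1)"
    "continuous_map (subtopology (pow_top S d) V1) (pow_top S m) (\<lambda>v. h' (F v))"
    using definable_graph[OF V'(1) H] by (rule generic_continuity)
  have ne: "V1 \<noteq> {}" using V1(4) hasintI[OF V'(2,3), of V'] by auto
  have "openin (pow_top S d) {v \<in> V1. F v \<in> W}" if W: "openin \<tau> W" for W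
  proof -
    obtain W' where W': "openin (pow_top S m) W'" "\<forall>u\<in>U. u \<in> W \<longleftrightarrow> h u \<in> W'" using cf(5)[OF W] by blast
    have "{v \<in> V1. F v \<in> W} = {v \<in> V1. h' (F v) \<in> W'}" using V1(1) V'(4) W'(2) h'(2) by auto
    then show ?thesis using continuous_subtopology_openin[OF V1(5,3) W'(1)] by simp
  qed
  then show ?thesis using that[of V1] V1(1,3) V'(4) ne by blast
qed

end

context tame_structure
begin

text \<open>A box in \<open>d + e\<close> coordinates is a product, so its factors are found by
  fixing the other component at that of \<open>z\<close>.\<close>

lemma open_rectangle:
  assumes Q: "openin (pow_top S (d + e)) Q" "z \<in> Q"
  shows "\<exists>A B. openin (pow_top S d) A \<and> openin (pow_top S e) B \<and> restrict z {..<d} \<in> A \<and>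
    coord_proj e ((+) d) z \<in> B \<and> (\<forall>x\<in>A. \<forall>y\<in>B. append_pt d e x y \<in> Q)"
proof -
  obtain c where c: "c \<in> pow M ((d + e) * kb)" "z \<in> Box (d + e) c" "Box (d + e) c \<subseteq> Q"
    using Box_nbhd[OF Q] by blast
  have z: "z \<in> pow M (d + e)" using c(2) by (simp add: Box_def)
  let ?x = "restrict z {..<d}" and ?y = "coord_proj e ((+) d) z"
  have xy: "?x \<in> pow M d" "?y \<in> pow M e" "append_pt d e ?x ?y = z"
    using restrict_in[OF z, of d] drop_in[OF z] append_split[OF z] by simp_all
  let ?A = "{x \<in> topspace (pow_top S d). append_pt d e x ?y \<in> Box (d + e) c}"
  let ?B = "{y \<in> topspace (pow_top S e). append_pt d e ?x y \<in> Box (d + e) c}"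
  have "openin (pow_top S d) ?A"
    using xy(2) by (intro openin_preimage[OF continuous_append open_Box[OF c(1)]] continuous_map_id[unfolded id_def])
      (simp add: topspace_pow_top)
  moreover have "openin (pow_top S e) ?B"
    using xy(1) by (intro openin_preimage[OF continuous_append open_Box[OF c(1)]] continuous_map_id[unfolded id_def])
      (simp add: topspace_pow_top)
  moreover have "append_pt d e x y \<in> Q" if "x \<in> ?A" "y \<in> ?B" for x y
  proof -
    have x: "x \<in> pow M d" "append_pt d e x ?y \<in> Box (d + e) c" and y: "y \<in> pow M e" "append_pt d e ?x y \<in> Box (d + e) c"
      using that by (auto simp: topspace_pow_top)
    have "append_pt d e x y i \<in> Bs (crd i c)" if i: "i < d + e" for i
    proof -
      have "append_pt d e x ?y i \<in> Bs (crd i c)" "append_pt d e ?x y i \<in> Bs (crd i c)"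
        using x(2) y(2) i by (auto simp: Box_def)
      then show ?thesis using i by (cases "i < d") (simp_all add: append_pt_def)
    qed
    then have "append_pt d e x y \<in> Box (d + e) c" using append_in[OF x(1) y(1)] by (simp add: Box_def)
    then show ?thesis using c(3) by blast
  qed
  moreover have "?x \<in> ?A" "?y \<in> ?B" using xy c(2) by (simp_all add: topspace_pow_top)
  ultimately show ?thesis by blast
qed

end

context definable_group_space
begin

section \<open>Joint continuity of multiplication\<close>

lemma basis:
  obtains k Y R where "definable L M k Y" "definable L M (n + k) R"
    "\<forall>b\<in>Y. openin \<tau> {x \<in> pow M n. append_pt n k x b \<in> R}"
    "\<forall>W x. openin \<tau> W \<and> x \<in> W \<longrightarrow> (\<exists>b\<in>Y. append_pt n k x b \<in> R \<and> {y \<in> pow M n. append_pt n k y b \<in> R} \<subseteq> W)"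
proof -
  from space obtain \<B> where \<B>: "definable_family L M n \<B>" "base_of \<tau> \<B>"
    by (auto simp: definable_space_def)
  from \<B>(1) obtain k Y R where kYR: "definable L M k Y" "definable L M (n + k) R"
    "\<B> = {{x \<in> pow M n. append_pt n k x b \<in> R} | b. b \<in> Y}"
    by (auto simp: definable_family_def)
  have op: "openin \<tau> B" if "B \<in> \<B>" for B
    using \<B>(2) that unfolding base_of_def by (auto intro: arbitrary_union_of_inc)
  have nb: "\<exists>B\<in>\<B>. x \<in> B \<and> B \<subseteq> W" if "openin \<tau> W" "x \<in> W" for W x
  proof -
    have "(arbitrary union_of (\<lambda>B. B \<in> \<B>)) W" using \<B>(2) that(1) by (simp add: base_of_def)
    then obtain \<V> where "\<V> \<subseteq> \<B>" "\<Union>\<V> = W" by (auto simp: union_of_def arbitrary_def)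
    then show ?thesis using that(2) by blast
  qed
  show ?thesis
  proof (rule that[OF kYR(1,2)])
    show "\<forall>b\<in>Y. openin \<tau> {x \<in> pow M n. append_pt n k x b \<in> R}"
      by (intro ballI op) (auto simp: kYR(3))
    show "\<forall>W x. openin \<tau> W \<and> x \<in> W \<longrightarrow> (\<exists>b\<in>Y. append_pt n k x b \<in> R \<and> {y \<in> pow M n. append_pt n k y b \<in> R} \<subseteq> W)"
    proof (intro allI impI, elim conjE)
      fix W x assume W: "openin \<tau> W" "x \<in> W"
      obtain B where "B \<in> \<B>" "x \<in> B" "B \<subseteq> W" using nb[OF W] by blast
      then show "\<exists>b\<in>Y. append_pt n k x b \<in> R \<and> {y \<in> pow M n. append_pt n k y b \<in> R} \<subseteq> W"
        unfolding kYR(3) by blast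
    qed
  qed
qed

lemma open_carrier: "openin \<tau> (carrier G)"
  using openin_topspace[of \<tau>] by (simp add: topspace_\<tau>)

lemma open_sub_carrier: "openin \<tau> W \<Longrightarrow> W \<subseteq> carrier G"
  using openin_subset[of \<tau> W] by (simp add: topspace_\<tau>)

lemma left_open: "a \<in> carrier G \<Longrightarrow> openin \<tau> W \<Longrightarrow> openin \<tau> {x \<in> carrier G. a \<otimes> x \<in> W}"
  using openin_preimage[OF left_continuous] by (simp add: topspace_\<tau>)

definition mcont :: "'a point \<Rightarrow> 'a point \<Rightarrow> bool" where
  "mcont a b \<longleftrightarrow> (\<forall>W. openin \<tau> W \<and> a \<otimes> b \<in> W \<longrightarrow>
     (\<exists>A B. openin \<tau> A \<and> openin \<tau> B \<and> a \<in> A \<and> b \<in> B \<and> (\<forall>x\<in>A. \<forall>y\<in>B. x \<otimes> y \<in> W)))"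

lemma mcontD:
  assumes "mcont a b" "openin \<tau> W" "a \<otimes> b \<in> W"
  obtains A B where "openin \<tau> A" "openin \<tau> B" "a \<in> A" "b \<in> B" "\<And>x y. x \<in> A \<Longrightarrow> y \<in> B \<Longrightarrow> x \<otimes> y \<in> W"
  using assms unfolding mcont_def by meson

text \<open>With \<open>c = a \<otimes> inv g\<close> one has \<open>x \<otimes> y = inv c \<otimes>
  ((c \<otimes> x) \<otimes> y)\<close>. For \<open>x\<close> near \<open>g\<close> the factor
  \<open>c \<otimes> x\<close> is near \<open>a\<close>, and both outer operations are left
  translations.\<close>

lemma mcont_left:
  assumes "mcont a b" "a \<in> carrier G" "b \<in> carrier G" "g \<in> carrier G"
  shows "mcont g b"
  unfolding mcont_def
proof (intro allI impI, elim conjE)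
  fix W assume W: "openin \<tau> W" "g \<otimes> b \<in> W"
  define c where "c = a \<otimes> inv g"
  have c: "c \<in> carrier G" "c \<otimes> g = a" "inv c \<otimes> (a \<otimes> b) = g \<otimes> b"
    using assms by (auto simp: c_def m_assoc inv_mult_group) (simp add: m_assoc[symmetric])
  have "openin \<tau> {x \<in> carrier G. inv c \<otimes> x \<in> W}" using c W by (intro left_open) auto
  moreover have "a \<otimes> b \<in> {x \<in> carrier G. inv c \<otimes> x \<in> W}" using c W assms by simp
  ultimately obtain A B where AB: "openin \<tau> A" "openin \<tau> B" "a \<in> A" "b \<in> B"
    "\<And>x y. x \<in> A \<Longrightarrow> y \<in> B \<Longrightarrow> x \<otimes> y \<in> {x \<in> carrier G. inv c \<otimes> x \<in> W}"
    using mcontD[OF assms(1)] by blast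
  have "openin \<tau> {x \<in> carrier G. c \<otimes> x \<in> A}" using c AB by (intro left_open) auto
  moreover have "g \<in> {x \<in> carrier G. c \<otimes> x \<in> A}" using c AB assms by simp
  moreover have "x \<otimes> y \<in> W" if "x \<in> {x \<in> carrier G. c \<otimes> x \<in> A}" "y \<in> B" for x y
  proof -
    have y: "y \<in> carrier G" using open_sub_carrier[OF AB(2)] that by blast
    have x: "x \<in> carrier G" "c \<otimes> x \<in> A" using that by auto
    have "inv c \<otimes> ((c \<otimes> x) \<otimes> y) \<in> W" using AB(5)[OF x(2) that(2)] by blast
    moreover have "inv c \<otimes> ((c \<otimes> x) \<otimes> y) = x \<otimes> y" using x y c(1) by (simp add: m_assoc[symmetric])
    ultimately show ?thesis by simp
  qed
  ultimately show "\<exists>A B. openin \<tau> A \<and> openin \<tau> B \<and> g \<in> A \<and> b \<in> B \<and> (\<forall>x\<in>A. \<forall>y\<in>B. x \<otimes> y \<in> W)"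
    using AB by blast
qed

text \<open>Write \<open>x \<otimes> y = (x \<otimes> b) \<otimes> (inv b \<otimes> y)\<close> for
  \<open>x\<close> near \<open>\<one>\<close> and \<open>y\<close> near
  \<open>b \<otimes> c\<close>. The first factor is near \<open>b\<close> by the hypothesis on
  \<open>b\<close>, the second is near \<open>c\<close> by left translation, and multiplication is
  continuous at \<open>(b, c)\<close> by \<open>mcont_left\<close>.\<close>

lemma mcont_mult:
  assumes b: "b \<in> carrier G" "mcont \<one> b" and c: "c \<in> carrier G" "mcont \<one> c"
  shows "mcont \<one> (b \<otimes> c)"
  unfolding mcont_def
proof (intro allI impI, elim conjE)
  fix W assume W: "openin \<tau> W" "\<one> \<otimes> (b \<otimes> c) \<in> W"
  have "mcont b c" using mcont_left[OF c(2) one_closed c(1) b(1)] .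
  moreover have "b \<otimes> c \<in> W" using W b c by simp
  ultimately obtain A B where AB: "openin \<tau> A" "openin \<tau> B" "b \<in> A" "c \<in> B"
    "\<And>x y. x \<in> A \<Longrightarrow> y \<in> B \<Longrightarrow> x \<otimes> y \<in> W" using mcontD W(1) by metis
  have "\<one> \<otimes> b \<in> A" using AB b by simp
  then obtain A1 B1 where AB1: "openin \<tau> A1" "\<one> \<in> A1" "b \<in> B1" "\<And>x y. x \<in> A1 \<Longrightarrow> y \<in> B1 \<Longrightarrow> x \<otimes> y \<in> A"
    using mcontD[OF b(2) AB(1)] by metis
  have "openin \<tau> {y \<in> carrier G. inv b \<otimes> y \<in> B}" using b AB by (intro left_open) auto
  moreover have "b \<otimes> c \<in> {y \<in> carrier G. inv b \<otimes> y \<in> B}" using b c AB by (simp add: m_assoc[symmetric])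
  moreover have "x \<otimes> y \<in> W" if "x \<in> A1" "y \<in> {y \<in> carrier G. inv b \<otimes> y \<in> B}" for x y
  proof -
    have x: "x \<in> carrier G" using open_sub_carrier[OF AB1(1)] that by blast
    have y: "y \<in> carrier G" "inv b \<otimes> y \<in> B" using that by auto
    have "(x \<otimes> b) \<otimes> (inv b \<otimes> y) \<in> W" using AB(5)[OF AB1(4)[OF that(1) AB1(3)] y(2)] .
    moreover have "(x \<otimes> b) \<otimes> (inv b \<otimes> y) = x \<otimes> y"
      using x y(1) b(1) by (simp add: m_assoc) (simp add: m_assoc[symmetric])
    ultimately show ?thesis by simp
  qed
  ultimately show "\<exists>A B. openin \<tau> A \<and> openin \<tau> B \<and> \<one> \<in> A \<and> b \<otimes> c \<in> B \<and> (\<forall>x\<in>A. \<forall>y\<in>B. x \<otimes> y \<in> W)"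
    using AB1 by blast
qed

text \<open>Parametrise an open piece of the group for the left factor and one of \<open>O'\<close>
  for the right factor. In these parameters multiplication is continuous near some point; open
  rectangles there are mapped to products of \<open>\<tau>\<close>-open sets, because both
  parametrizations are open. Finally the left factor is moved to \<open>\<one>\<close>.\<close>

lemma mcont_somewhere:
  assumes O': "openin \<tau> O'" "O' \<noteq> {}"
  shows "\<exists>b\<in>O'. mcont \<one> b"
proof -
  have ne: "carrier G \<noteq> {}" using one_closed by blast
  obtain d V \<theta> where V: "definable L M d V" "openin (pow_top S d) V" "V \<noteq> {}" "dmap d n \<theta>" "\<theta> ` V \<subseteq> carrier G"
    "\<And>A. openin (pow_top S d) A \<Longrightarrow> A \<subseteq> V \<Longrightarrow> openin \<tau> (\<theta> ` A)"
    using local_parametrization[OF open_carrier ne] by blast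
  obtain e V' \<theta>' where V': "definable L M e V'" "openin (pow_top S e) V'" "V' \<noteq> {}" "dmap e n \<theta>'" "\<theta>' ` V' \<subseteq> O'"
    "\<And>A. openin (pow_top S e) A \<Longrightarrow> A \<subseteq> V' \<Longrightarrow> openin \<tau> (\<theta>' ` A)"
    using local_parametrization[OF O'] by blast
  define F where "F z = gm (\<theta> (restrict z {..<d})) (\<theta>' (coord_proj e ((+) d) z))" for z
  have F: "dmap (d + e) n F"
    unfolding F_def
    by (rule dmapI, intro dterm_gm dterm_dmap[OF V(4)] dterm_dmap[OF V'(4)] dterm_dtup dtup_restrict[of "d + e"]
      dtup_coord_proj[of "d + e"] dtup_var) auto
  define P where "P = {z \<in> pow M (d + e). coord_proj d id z \<in> V} \<inter> {z \<in> pow M (d + e). coord_proj e ((+) d) z \<in> V'}"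
  have "definable L M (d + e) P" unfolding P_def
    by (intro definable_Int definable_preimage_coord_proj V(1) V'(1)) auto
  moreover have "openin (pow_top S (d + e)) P" unfolding P_def
    by (intro openin_Int open_preimage_coord_proj V(2) V'(2)) auto
  moreover have "P \<noteq> {}"
  proof -
    obtain v v' where "v \<in> V" "v' \<in> V'" using V(3) V'(3) by blast
    moreover then have "v \<in> pow M d" "v' \<in> pow M e" using V(1) V'(1) definable_subset by blast+
    ultimately have "append_pt d e v v' \<in> P"
      by (simp add: P_def append_in restrict_eq_coord_proj[symmetric] restrict_append drop_append)
    then show ?thesis by blast
  qed
  moreover have "F ` P \<subseteq> carrier G" using gm_closed by (auto simp: F_def)
  ultimately obtain V1 where V1: "V1 \<subseteq> P" "openin (pow_top S (d + e)) V1" "V1 \<noteq> {}"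
    "\<And>W. openin \<tau> W \<Longrightarrow> openin (pow_top S (d + e)) {v \<in> V1. F v \<in> W}"
    using generic_continuity_\<tau>[OF _ _ _ F] by blast
  obtain z where z: "z \<in> V1" using V1(3) by blast
  define a b where "a = \<theta> (restrict z {..<d})" and "b = \<theta>' (coord_proj e ((+) d) z)"
  have zP: "restrict z {..<d} \<in> V" "coord_proj e ((+) d) z \<in> V'"
    using z V1(1) by (auto simp: P_def restrict_eq_coord_proj)
  have ab: "a \<in> carrier G" "b \<in> O'" "b \<in> carrier G"
    using zP V(5) V'(5) open_sub_carrier[OF O'(1)] by (auto simp: a_def b_def)
  have "mcont a b"
    unfolding mcont_def
  proof (intro allI impI, elim conjE)
    fix W assume W: "openin \<tau> W" "a \<otimes> b \<in> W"
    have "F z \<in> W" using W(2) ab by (simp add: F_def gm_def a_def[symmetric] b_def[symmetric])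
    then have "\<exists>A B. openin (pow_top S d) A \<and> openin (pow_top S e) B \<and> restrict z {..<d} \<in> A \<and>
      coord_proj e ((+) d) z \<in> B \<and> (\<forall>x\<in>A. \<forall>y\<in>B. append_pt d e x y \<in> {v \<in> V1. F v \<in> W})"
      using z by (intro open_rectangle[OF V1(4)[OF W(1)]]) simp
    then obtain A B where AB: "openin (pow_top S d) A" "openin (pow_top S e) B" "restrict z {..<d} \<in> A"
      "coord_proj e ((+) d) z \<in> B" "\<forall>x\<in>A. \<forall>y\<in>B. append_pt d e x y \<in> {v \<in> V1. F v \<in> W}"
      by (elim exE conjE)
    have "openin \<tau> (\<theta> ` (A \<inter> V))" using AB(1) V(2) by (intro V(6)) auto
    moreover have "openin \<tau> (\<theta>' ` (B \<inter> V'))" using AB(2) V'(2) by (intro V'(6)) auto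
    moreover have "a \<in> \<theta> ` (A \<inter> V)" "b \<in> \<theta>' ` (B \<inter> V')" using AB zP by (auto simp: a_def b_def)
    moreover have "x \<otimes> y \<in> W" if xy: "x \<in> \<theta> ` (A \<inter> V)" "y \<in> \<theta>' ` (B \<inter> V')" for x y
    proof -
      from xy(1) obtain v where "v \<in> A" "v \<in> V" "x = \<theta> v" by blast
      moreover from xy(2) obtain v' where "v' \<in> B" "v' \<in> V'" "y = \<theta>' v'" by blast
      ultimately have v: "v \<in> A" "v \<in> V" "x = \<theta> v" "v' \<in> B" "v' \<in> V'" "y = \<theta>' v'" by simp_all
      have "v \<in> pow M d" "v' \<in> pow M e" using v V(1) V'(1) definable_subset by blast+
      then have "F (append_pt d e v v') = gm x y" by (simp add: F_def restrict_append drop_append v)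
      moreover have "append_pt d e v v' \<in> {v \<in> V1. F v \<in> W}" using bspec[OF bspec[OF AB(5) v(1)] v(4)] .
      moreover have "gm x y = x \<otimes> y" using v V(5) V'(5) open_sub_carrier[OF O'(1)] by (auto simp: gm_def)
      ultimately show ?thesis by simp
    qed
    ultimately show "\<exists>A B. openin \<tau> A \<and> openin \<tau> B \<and> a \<in> A \<and> b \<in> B \<and> (\<forall>x\<in>A. \<forall>y\<in>B. x \<otimes> y \<in> W)" by blast
  qed
  then show ?thesis using mcont_left[OF _ ab(1,3) one_closed] ab(2) by blast
qed

lemma definable_mcont: "definable L M n {b \<in> carrier G. mcont \<one> b}"
proof -
  obtain k Y R where B': "definable L M k Y" "definable L M (n + k) R"
    "\<forall>b\<in>Y. openin \<tau> {x \<in> pow M n. append_pt n k x b \<in> R}"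
    "\<forall>W x. openin \<tau> W \<and> x \<in> W \<longrightarrow> (\<exists>b\<in>Y. append_pt n k x b \<in> R \<and> {y \<in> pow M n. append_pt n k y b \<in> R} \<subseteq> W)"
    by (rule basis)
  note B = B'(1,2) B'(3)[rule_format] B'(4)[rule_format, OF conjI]
  have sub: "x \<in> carrier G" if "c \<in> Y" "x \<in> pow M n" "append_pt n k x c \<in> R" for x c
    using open_sub_carrier[OF B(3)[OF that(1)]] that by blast
  \<comment> \<open>Open sets are quantified through indices of the definable basis. The product
    gets its own variable \<open>z\<close>, since membership in \<open>R\<close> is expressed for
    tuples of variables.\<close>
  let ?r = "\<lambda>b. \<forall>c\<in>Y. append_pt n k b c \<in> R \<longrightarrow> (\<exists>c1\<in>Y. \<exists>c2\<in>Y. append_pt n k \<one> c1 \<in> R \<and>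
      append_pt n k b c2 \<in> R \<and> (\<forall>x\<in>pow M n. \<forall>y\<in>pow M n. append_pt n k x c1 \<in> R \<longrightarrow> append_pt n k y c2 \<in> R \<longrightarrow>
        (\<exists>z\<in>pow M n. z = gm x y \<and> append_pt n k z c \<in> R)))"
  have eq: "mcont \<one> b \<longleftrightarrow> ?r b"
    if b: "b \<in> carrier G" for b
  proof
    assume m: "mcont \<one> b"
    show "?r b"
    proof (intro ballI impI)
      fix c assume c: "c \<in> Y" "append_pt n k b c \<in> R"
      have "\<one> \<otimes> b \<in> {x \<in> pow M n. append_pt n k x c \<in> R}" using c b carrier_pow by simp
      from m[unfolded mcont_def, rule_format, OF conjI[OF B(3)[OF c(1)] this]]
      obtain A B' where AB': "openin \<tau> A" "openin \<tau> B'" "\<one> \<in> A" "b \<in> B'"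
        "\<forall>x\<in>A. \<forall>y\<in>B'. x \<otimes> y \<in> {x \<in> pow M n. append_pt n k x c \<in> R}"
        by (elim exE conjE)
      note AB = AB'(1-4) AB'(5)[rule_format]
      obtain c1 where c1: "c1 \<in> Y" "append_pt n k \<one> c1 \<in> R" "{y \<in> pow M n. append_pt n k y c1 \<in> R} \<subseteq> A"
        using B(4)[OF AB(1,3)] by blast
      obtain c2 where c2: "c2 \<in> Y" "append_pt n k b c2 \<in> R" "{y \<in> pow M n. append_pt n k y c2 \<in> R} \<subseteq> B'"
        using B(4)[OF AB(2,4)] by blast
      have "\<exists>z\<in>pow M n. z = gm x y \<and> append_pt n k z c \<in> R"
        if "x \<in> pow M n" "y \<in> pow M n" "append_pt n k x c1 \<in> R" "append_pt n k y c2 \<in> R" for x y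
      proof -
        have "x \<in> A" "y \<in> B'" using that c1 c2 by blast+
        moreover have "gm x y = x \<otimes> y" using sub that c1 c2 by (simp add: gm_def)
        ultimately show ?thesis using AB(5)[of x y] by auto
      qed
      then show "\<exists>c1\<in>Y. \<exists>c2\<in>Y. append_pt n k \<one> c1 \<in> R \<and>
        append_pt n k b c2 \<in> R \<and> (\<forall>x\<in>pow M n. \<forall>y\<in>pow M n. append_pt n k x c1 \<in> R \<longrightarrow> append_pt n k y c2 \<in> R \<longrightarrow>
        (\<exists>z\<in>pow M n. z = gm x y \<and> append_pt n k z c \<in> R))"
        using c1(1,2) c2(1,2) by (intro bexI[of _ c1] bexI[of _ c2]) simp_all
    qed
  next
    assume r: "?r b"
    show "mcont \<one> b"
      unfolding mcont_def
    proof (intro allI impI, elim conjE)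
      fix W assume W: "openin \<tau> W" "\<one> \<otimes> b \<in> W"
      then have "b \<in> W" using b by simp
      then obtain c where c: "c \<in> Y" "append_pt n k b c \<in> R" "{y \<in> pow M n. append_pt n k y c \<in> R} \<subseteq> W"
        using B(4)[OF W(1)] by blast
      obtain c1 c2 where c12: "c1 \<in> Y" "c2 \<in> Y" "append_pt n k \<one> c1 \<in> R" "append_pt n k b c2 \<in> R"
        "\<forall>x\<in>pow M n. \<forall>y\<in>pow M n. append_pt n k x c1 \<in> R \<longrightarrow> append_pt n k y c2 \<in> R \<longrightarrow>
          (\<exists>z\<in>pow M n. z = gm x y \<and> append_pt n k z c \<in> R)"
        using r[rule_format, OF c(1,2)] by (elim bexE conjE)
      have "x \<otimes> y \<in> W" if "x \<in> {x \<in> pow M n. append_pt n k x c1 \<in> R}" "y \<in> {x \<in> pow M n. append_pt n k x c2 \<in> R}" for x y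
      proof -
        have "gm x y \<in> pow M n \<and> append_pt n k (gm x y) c \<in> R" using c12(5) that by blast
        moreover have "gm x y = x \<otimes> y" using sub that c12 by (simp add: gm_def)
        ultimately show ?thesis using c(3) by auto
      qed
      moreover have "\<one> \<in> {x \<in> pow M n. append_pt n k x c1 \<in> R}" "b \<in> {x \<in> pow M n. append_pt n k x c2 \<in> R}"
        using c12 carrier_pow b by auto
      ultimately show "\<exists>A B. openin \<tau> A \<and> openin \<tau> B \<and> \<one> \<in> A \<and> b \<in> B \<and> (\<forall>x\<in>A. \<forall>y\<in>B. x \<otimes> y \<in> W)"
        using B(3) c12(1,2) by blast
    qed
  qed
  have "definable L M n {b \<in> carrier G. ?r b}"
    by (intro definable_sub_Collect definable_carrier dfn_Ball_set[OF B(1)] dfn_Bex_set[OF B(1)] dfn_imp dfn_conj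
      dfn_Ball_pow dfn_Bex_pow dfn_mem[OF B(2)] dtup_append dtup_var dtup_const carrier_pow[OF one_closed]
      dfn_eq_term[of n] dterm_gm dterm_dtup)
  moreover have "{b \<in> carrier G. mcont \<one> b} = {b \<in> carrier G. ?r b}"
    using eq by (intro Collect_cong conj_cong refl)
  ultimately show ?thesis by simp
qed

text \<open>The set \<open>F\<close> is taken among the images \<open>g j\<close> of a countable
  grid. If no finite part sufficed, saturation would give one \<open>h\<close> with all
  \<open>inv h \<otimes> g j\<close> outside \<open>Q\<close>. Then the parameters \<open>v\<close>
  with \<open>inv h \<otimes> \<theta> v\<close> outside \<open>Q\<close> contain the grid, so they
  have interior, and a left translate of its image is a nonempty open set that misses
  \<open>Q\<close>.\<close>

lemma finite_translates:
  assumes Q: "definable L M n Q" and dense: "\<And>W. openin \<tau> W \<Longrightarrow> W \<noteq> {} \<Longrightarrow> W \<inter> Q \<noteq> {}"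
  shows "\<exists>F. finite F \<and> F \<subseteq> carrier G \<and> (\<forall>h\<in>carrier G. \<exists>f\<in>F. inv h \<otimes> f \<in> Q)"
proof -
  have ne: "carrier G \<noteq> {}" using one_closed by blast
  obtain d V \<theta> where V: "definable L M d V" "openin (pow_top S d) V" "V \<noteq> {}" "dmap d n \<theta>" "\<theta> ` V \<subseteq> carrier G"
    "\<And>A. openin (pow_top S d) A \<Longrightarrow> A \<subseteq> V \<Longrightarrow> openin \<tau> (\<theta> ` A)"
    using local_parametrization[OF open_carrier ne] by blast
  obtain v0 where "v0 \<in> V" using V(3) by blast
  then obtain c where c: "c \<in> pow M (d * kb)" "v0 \<in> Box d c" "Box d c \<subseteq> V" using Box_nbhd[OF V(2)] by blast
  have "\<forall>i. \<exists>A. i < d \<longrightarrow> infinite A \<and> countable A \<and> A \<subseteq> Bs (crd i c)"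
  proof
    fix i
    show "\<exists>A. i < d \<longrightarrow> infinite A \<and> countable A \<and> A \<subseteq> Bs (crd i c)"
    proof (cases "i < d")
      case True
      then have "Bs (crd i c) \<noteq> {}" using c(2) by (auto simp: Box_def)
      then have "infinite (Bs (crd i c))" using infinite_open[OF openin_Bs[OF crd_in[OF c(1) True]]] by blast
      then show ?thesis using infinite_countable_subset' by metis
    qed auto
  qed
  from choice[OF this] obtain A where A: "\<forall>i. i < d \<longrightarrow> infinite (A i) \<and> countable (A i) \<and> A i \<subseteq> Bs (crd i c)" ..
  \<comment> \<open>Countability of the factors makes the grid countable; it can then be enumerated,
    and the failure sets \<open>H N\<close> below form a sequence.\<close>
  define grid where "grid = Pi\<^sub>E {..<d} A"
  have "countable grid" unfolding grid_def using A by (intro countable_PiE) auto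
  moreover have "grid \<noteq> {}" unfolding grid_def PiE_eq_empty_iff using A by (metis finite.emptyI lessThan_iff)
  ultimately have range: "range (from_nat_into grid) = grid" by (intro range_from_nat_into)
  have gridV: "grid \<subseteq> V"
  proof -
    have "grid \<subseteq> Box d c" unfolding grid_def Box_eq[OF c(1)] using A by (intro PiE_mono) simp
    then show ?thesis using c(3) by blast
  qed
  define g where "g j = \<theta> (from_nat_into grid j)" for j
  have g: "g j \<in> carrier G" for j
  proof -
    have "from_nat_into grid j \<in> V" using range gridV by blast
    then show ?thesis using V(5) by (auto simp: g_def)
  qed
  define H where "H N = {h \<in> carrier G. \<forall>j\<in>{..N}. gm (gi h) (g j) \<notin> Q}" for N
  have defH: "definable L M n (H N)" for N
    unfolding H_def
    by (intro definable_sub_Collect definable_carrier dfn_finite_all finite_atMost dfn_neg dfn_mem_term[OF Q]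
      dterm_gm dterm_dmap[OF dmap_gi] dterm_dtup dtup_var dtup_const carrier_pow g)
  have "\<exists>N. H N = {}"
  proof (rule ccontr)
    assume "\<nexists>N. H N = {}"
    then have "(\<Inter>N. H N) \<noteq> {}" by (intro decreasing[OF defH]) (auto simp: H_def)
    then obtain h where h: "\<And>N. h \<in> H N" by blast
    have hC: "h \<in> carrier G" using h[of 0] by (simp add: H_def)
    define E where "E = {v \<in> V. gm (gi h) (\<theta> v) \<notin> Q}"
    have "hasint d E"
    proof (rule hasint_grid)
      show "definable L M d E" unfolding E_def
        by (intro definable_sub_Collect V(1) dfn_neg dfn_mem_term[OF Q] dterm_gm dterm_dmap[OF V(4)] dterm_dtup
          dtup_var dtup_const carrier_pow gi_closed)
      show "infinite (A i)" if "i < d" for i using A that by blast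
      show "A i \<subseteq> Dom M" if i: "i < d" for i
        using A i openin_subset[OF openin_Bs[OF crd_in[OF c(1) i]]] topspace_S by blast
      show "{x \<in> pow M d. \<forall>i<d. x i \<in> A i} \<subseteq> E"
      proof
        fix x assume x: "x \<in> {x \<in> pow M d. \<forall>i<d. x i \<in> A i}"
        then have "x \<in> grid" by (auto simp: grid_def pow_def PiE_iff)
        moreover then obtain j where "x = from_nat_into grid j" using range by blast
        ultimately show "x \<in> E" using h[of j] gridV by (auto simp: E_def H_def g_def)
      qed
    qed
    then obtain U where U: "definable L M d U" "openin (pow_top S d) U" "U \<noteq> {}" "U \<subseteq> E" by (rule hasintE)
    have UV: "U \<subseteq> V" using U(4) by (auto simp: E_def)
    have "openin \<tau> {y \<in> carrier G. h \<otimes> y \<in> \<theta> ` U}" by (intro left_open hC V(6) U(2) UV)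
    moreover have "{y \<in> carrier G. h \<otimes> y \<in> \<theta> ` U} \<noteq> {}"
    proof -
      obtain u where u: "u \<in> U" using U(3) by blast
      then have "\<theta> u \<in> carrier G" using UV V(5) by blast
      then have "h \<otimes> (inv h \<otimes> \<theta> u) = \<theta> u" "inv h \<otimes> \<theta> u \<in> carrier G" using hC by (simp_all add: m_assoc[symmetric])
      then show ?thesis using u by force
    qed
    ultimately have "{y \<in> carrier G. h \<otimes> y \<in> \<theta> ` U} \<inter> Q \<noteq> {}" by (rule dense)
    then obtain y where y: "y \<in> carrier G" "h \<otimes> y \<in> \<theta> ` U" "y \<in> Q" by blast
    then obtain u where u: "u \<in> U" "h \<otimes> y = \<theta> u" by blast
    have "gm (gi h) (\<theta> u) = inv h \<otimes> (h \<otimes> y)" using hC y(1) by (simp add: gm_def gi_def u(2)[symmetric])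
    also have "\<dots> = y" using hC y(1) by (simp add: m_assoc[symmetric])
    finally show False using u(1) U(4) y(3) by (auto simp: E_def)
  qed
  then obtain N where N: "H N = {}" by blast
  have "\<exists>f\<in>g ` {..N}. inv h \<otimes> f \<in> Q" if h: "h \<in> carrier G" for h
  proof -
    obtain j where "j \<le> N" "gm (gi h) (g j) \<in> Q" using N h by (auto simp: H_def)
    then show ?thesis using h g by (auto simp: gm_def gi_def)
  qed
  then show ?thesis using g by (intro exI[of _ "g ` {..N}"]) auto
qed

text \<open>The good set is dense and closed under products. It remains to write \<open>g\<close> as
  a product of two good elements, and for this its inverse must contain, up to a translation, an
  open set.\<close>

lemma mcont_everywhere:
  assumes g: "g \<in> carrier G"
  shows "mcont \<one> g"
proof -
  let ?B = "{b \<in> carrier G. mcont \<one> b}"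
  have dense: "W \<inter> ?B \<noteq> {}" if "openin \<tau> W" "W \<noteq> {}" for W
    using mcont_somewhere[OF that] open_sub_carrier[OF that(1)] by blast
  obtain F where F: "finite F" "F \<subseteq> carrier G" "\<And>h. h \<in> carrier G \<Longrightarrow> \<exists>f\<in>F. inv h \<otimes> f \<in> ?B"
    using finite_translates[OF definable_mcont dense] by auto
  have ne: "carrier G \<noteq> {}" using one_closed by blast
  obtain d V \<theta> where V: "definable L M d V" "openin (pow_top S d) V" "V \<noteq> {}" "dmap d n \<theta>" "\<theta> ` V \<subseteq> carrier G"
    "\<And>A. openin (pow_top S d) A \<Longrightarrow> A \<subseteq> V \<Longrightarrow> openin \<tau> (\<theta> ` A)"
    using local_parametrization[OF open_carrier ne] by blast
  \<comment> \<open>The choice of \<open>F\<close> puts every \<open>\<theta> v\<close> into one of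
    finitely many sets of elements \<open>h\<close> with \<open>inv h \<otimes> f\<close> good. One
    of the definable pullbacks therefore has interior.\<close>
  have "hasint d (\<Union>f\<in>F. {v \<in> V. gm (gi (\<theta> v)) f \<in> ?B})"
  proof (rule hasintI[OF V(2,3)], rule subsetI)
    fix v assume v: "v \<in> V"
    then have \<theta>: "\<theta> v \<in> carrier G" using V(5) by blast
    then obtain f where f: "f \<in> F" "inv (\<theta> v) \<otimes> f \<in> ?B" using F(3) by blast
    then have "gm (gi (\<theta> v)) f \<in> ?B" using \<theta> F(2) by (auto simp: gm_def gi_def)
    then show "v \<in> (\<Union>f\<in>F. {v \<in> V. gm (gi (\<theta> v)) f \<in> ?B})" using v f(1) by blast
  qed
  then have "\<exists>f\<in>F. hasint d {v \<in> V. gm (gi (\<theta> v)) f \<in> ?B}"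
  proof (intro hasint_UN[OF F(1)])
    fix f assume "f \<in> F"
    then have "f \<in> carrier G" using F(2) by blast
    then show "definable L M d {v \<in> V. gm (gi (\<theta> v)) f \<in> ?B}"
      by (intro definable_sub_Collect V(1) dfn_mem_term[OF definable_mcont] dterm_gm dterm_dmap[OF dmap_gi]
        dterm_dmap[OF V(4)] dterm_dtup dtup_var dtup_const carrier_pow)
  qed
  then obtain f where f: "f \<in> F" "hasint d {v \<in> V. gm (gi (\<theta> v)) f \<in> ?B}" by blast
  have fC: "f \<in> carrier G" using f(1) F(2) by blast
  obtain U where U: "definable L M d U" "openin (pow_top S d) U" "U \<noteq> {}" "U \<subseteq> {v \<in> V. gm (gi (\<theta> v)) f \<in> ?B}"
    using f(2) by (rule hasintE)
  have UV: "U \<subseteq> V" using U(4) by blast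
  \<comment> \<open>A good \<open>y\<close> with \<open>c \<otimes> y\<close> in the image of
    \<open>U\<close> exists by density. For it,
    \<open>inv (c \<otimes> y) \<otimes> f = inv y \<otimes> g\<close> is good, and \<open>g\<close>
    is the product of \<open>y\<close> and this element.\<close>
  define c where "c = f \<otimes> inv g"
  have c: "c \<in> carrier G" using fC g by (simp add: c_def)
  have "openin \<tau> {y \<in> carrier G. c \<otimes> y \<in> \<theta> ` U}" by (intro left_open c V(6) U(2) UV)
  moreover have "{y \<in> carrier G. c \<otimes> y \<in> \<theta> ` U} \<noteq> {}"
  proof -
    obtain u where u: "u \<in> U" using U(3) by blast
    then have "\<theta> u \<in> carrier G" using UV V(5) by blast
    then have "c \<otimes> (inv c \<otimes> \<theta> u) = \<theta> u" "inv c \<otimes> \<theta> u \<in> carrier G" using c by (simp_all add: m_assoc[symmetric])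
    then show ?thesis using u by force
  qed
  ultimately have "{y \<in> carrier G. c \<otimes> y \<in> \<theta> ` U} \<inter> ?B \<noteq> {}" by (rule dense)
  then obtain y where y: "y \<in> carrier G" "c \<otimes> y \<in> \<theta> ` U" "mcont \<one> y" by blast
  then obtain u where u: "u \<in> U" "c \<otimes> y = \<theta> u" by blast
  have "gm (gi (\<theta> u)) f = inv (c \<otimes> y) \<otimes> f" using c y(1) fC by (simp add: gm_def gi_def u(2)[symmetric])
  also have "\<dots> = inv y \<otimes> g"
    using c y(1) fC g unfolding c_def by (simp add: inv_mult_group m_assoc)
  finally have "mcont \<one> (inv y \<otimes> g)" using u(1) U(4) by auto
  then have "mcont \<one> (y \<otimes> (inv y \<otimes> g))" using y(1) g by (intro mcont_mult[OF y(1,3) _]) simp_all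
  then show ?thesis using y(1) g by (simp add: m_assoc[symmetric])
qed

lemma continuous_mult: "continuous_map (prod_topology \<tau> \<tau>) \<tau> (\<lambda>(x, y). x \<otimes> y)"
proof -
  have "openin (prod_topology \<tau> \<tau>) {p \<in> topspace (prod_topology \<tau> \<tau>). (case p of (x, y) \<Rightarrow> x \<otimes> y) \<in> W}"
    if W: "openin \<tau> W" for W
    unfolding openin_prod_topology_alt
  proof (intro allI impI)
    fix a b assume "(a, b) \<in> {p \<in> topspace (prod_topology \<tau> \<tau>). (case p of (x, y) \<Rightarrow> x \<otimes> y) \<in> W}"
    then have ab: "a \<in> carrier G" "b \<in> carrier G" "a \<otimes> b \<in> W" by (auto simp: topspace_\<tau>)
    have "mcont a b" by (rule mcont_left[OF mcont_everywhere[OF ab(2)] one_closed ab(2,1)])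
    from this[unfolded mcont_def, rule_format, OF conjI[OF W ab(3)]]
    obtain A B where AB: "openin \<tau> A" "openin \<tau> B" "a \<in> A" "b \<in> B" "\<forall>x\<in>A. \<forall>y\<in>B. x \<otimes> y \<in> W"
      by (elim exE conjE)
    have "A \<times> B \<subseteq> {p \<in> topspace (prod_topology \<tau> \<tau>). (case p of (x, y) \<Rightarrow> x \<otimes> y) \<in> W}"
      using AB(5) open_sub_carrier[OF AB(1)] open_sub_carrier[OF AB(2)] by (auto simp: topspace_\<tau>)
    then show "\<exists>U V. openin \<tau> U \<and> openin \<tau> V \<and> a \<in> U \<and> b \<in> V \<and>
        U \<times> V \<subseteq> {p \<in> topspace (prod_topology \<tau> \<tau>). (case p of (x, y) \<Rightarrow> x \<otimes> y) \<in> W}"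
      using AB(1-4) by blast
  qed
  then show ?thesis by (auto simp: continuous_map_def topspace_\<tau>)
qed

text \<open>Generic continuity along an open parametrization makes inversion continuous at some
  \<open>a\<close>. For another point \<open>g\<close> put \<open>c = a \<otimes> inv g\<close> and
  use \<open>inv x = inv (c \<otimes> x) \<otimes> c\<close>: for \<open>x\<close> near
  \<open>g\<close> the element \<open>c \<otimes> x\<close> is near \<open>a\<close>, and right
  multiplication by \<open>c\<close> is covered by the continuity of multiplication at
  \<open>(inv a, c)\<close>.\<close>

lemma continuous_inv: "continuous_map \<tau> \<tau> (\<lambda>x. inv x)"
proof -
  have ne: "carrier G \<noteq> {}" using one_closed by blast
  obtain d V \<theta> where V: "definable L M d V" "openin (pow_top S d) V" "V \<noteq> {}" "dmap d n \<theta>" "\<theta> ` V \<subseteq> carrier G"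
    "\<And>A. openin (pow_top S d) A \<Longrightarrow> A \<subseteq> V \<Longrightarrow> openin \<tau> (\<theta> ` A)"
    using local_parametrization[OF open_carrier ne] by blast
  have "(\<lambda>v. gi (\<theta> v)) ` V \<subseteq> carrier G" using gi_closed by blast
  then obtain V1 where V1: "V1 \<subseteq> V" "openin (pow_top S d) V1" "V1 \<noteq> {}"
    "\<And>W. openin \<tau> W \<Longrightarrow> openin (pow_top S d) {v \<in> V1. gi (\<theta> v) \<in> W}"
    using generic_continuity_\<tau>[OF V(1-3) dmap_comp[OF V(4) dmap_gi]] by blast
  obtain v where v: "v \<in> V1" using V1(3) by blast
  define a where "a = \<theta> v"
  have a: "a \<in> carrier G" using v V1(1) V(5) by (auto simp: a_def)
  have icont: "\<exists>A. openin \<tau> A \<and> a \<in> A \<and> (\<forall>x\<in>A. inv x \<in> W)" if W: "openin \<tau> W" "inv a \<in> W" for W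
  proof (intro exI conjI ballI)
    show "openin \<tau> (\<theta> ` {v \<in> V1. gi (\<theta> v) \<in> W})" using V1(1) by (intro V(6) V1(4) W(1)) auto
    show "a \<in> \<theta> ` {v \<in> V1. gi (\<theta> v) \<in> W}" using v W(2) a by (auto simp: a_def gi_def)
    show "inv x \<in> W" if x: "x \<in> \<theta> ` {v \<in> V1. gi (\<theta> v) \<in> W}" for x
    proof -
      from x obtain v where "v \<in> V1" "x = \<theta> v" "gi (\<theta> v) \<in> W" by blast
      moreover then have "\<theta> v \<in> carrier G" using V1(1) V(5) by blast
      ultimately show ?thesis by (simp add: gi_def)
    qed
  qed
  have "openin \<tau> {x \<in> carrier G. inv x \<in> W}" if W: "openin \<tau> W" for W
  proof (subst openin_subopen, rule ballI)
    fix g assume "g \<in> {x \<in> carrier G. inv x \<in> W}"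
    then have g: "g \<in> carrier G" "inv g \<in> W" by auto
    define c where "c = a \<otimes> inv g"
    have c: "c \<in> carrier G" using a g by (simp add: c_def)
    have ac: "inv a \<otimes> c \<in> W" using a g by (simp add: c_def m_assoc[symmetric])
    have "mcont (inv a) c" by (rule mcont_left[OF mcont_everywhere[OF c] one_closed c inv_closed[OF a]])
    from this[unfolded mcont_def, rule_format, OF conjI[OF W ac]]
    obtain A B where AB: "openin \<tau> A" "openin \<tau> B" "inv a \<in> A" "c \<in> B" "\<forall>x\<in>A. \<forall>y\<in>B. x \<otimes> y \<in> W"
      by (elim exE conjE)
    obtain A2 where A2: "openin \<tau> A2" "a \<in> A2" "\<forall>x\<in>A2. inv x \<in> A" using icont[OF AB(1,3)] by blast
    have "openin \<tau> {x \<in> carrier G. c \<otimes> x \<in> A2}" by (rule left_open[OF c A2(1)])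
    moreover have "g \<in> {x \<in> carrier G. c \<otimes> x \<in> A2}" using g(1) a A2(2) by (simp add: c_def m_assoc)
    moreover have "{x \<in> carrier G. c \<otimes> x \<in> A2} \<subseteq> {x \<in> carrier G. inv x \<in> W}"
    proof
      fix x assume "x \<in> {x \<in> carrier G. c \<otimes> x \<in> A2}"
      then have x: "x \<in> carrier G" "c \<otimes> x \<in> A2" by auto
      then have "inv (c \<otimes> x) \<otimes> c \<in> W" using A2(3) AB(4,5) by blast
      then show "x \<in> {x \<in> carrier G. inv x \<in> W}" using x(1) c by (simp add: inv_mult_group m_assoc)
    qed
    ultimately show "\<exists>T. openin \<tau> T \<and> g \<in> T \<and> T \<subseteq> {x \<in> carrier G. inv x \<in> W}" by blast
  qed
  then show ?thesis by (auto simp: continuous_map_def topspace_\<tau>)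
qed

section \<open>Covering the group by charts modelled on cells\<close>

definition manifold_chart :: "'a point set \<Rightarrow> bool" where
  "manifold_chart D \<longleftrightarrow> definable L M n D \<and> openin \<tau> D \<and>
     (\<exists>m C V h. cell L M S m C \<and> openin (subtopology (pow_top S m) C) V \<and> definable_chart L M S n \<tau> D m V h)"

text \<open>Within one chart of the semimanifold, decompose the image \<open>X\<close> into cells
  and keep of each cell its interior relative to \<open>X\<close>. By
  \<open>graph_over_dense\<close> these interiors are dense in \<open>X\<close> taken together, so
  their preimages are dense in the chart domain.\<close>

lemma dense_manifold_charts:
  obtains \<P> where "finite \<P>" "\<forall>D\<in>\<P>. manifold_chart D" "\<forall>W. openin \<tau> W \<and> W \<noteq> {} \<longrightarrow> W \<inter> \<Union>\<P> \<noteq> {}"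
proof -
  obtain \<U> where \<U>: "finite \<U>" "\<Union>\<U> = carrier G" "\<forall>U\<in>\<U>. \<exists>m X h. chart U m X h" by (rule charts)
  have "\<forall>U. \<exists>\<P>. U \<in> \<U> \<longrightarrow> finite \<P> \<and> (\<forall>D\<in>\<P>. manifold_chart D) \<and>
      (\<forall>W. openin \<tau> W \<and> W \<inter> U \<noteq> {} \<longrightarrow> W \<inter> \<Union>\<P> \<noteq> {})"
  proof
    fix U
    show "\<exists>\<P>. U \<in> \<U> \<longrightarrow> finite \<P> \<and> (\<forall>D\<in>\<P>. manifold_chart D) \<and>
      (\<forall>W. openin \<tau> W \<and> W \<inter> U \<noteq> {} \<longrightarrow> W \<inter> \<Union>\<P> \<noteq> {})"
    proof (cases "U \<in> \<U>")
      case True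
      then obtain m X h where c: "chart U m X h" using \<U>(3) by blast
      note cf = chart_facts[OF c]
      obtain h' where h': "dmap n m h'" "\<And>x. x \<in> U \<Longrightarrow> h' x = h x" using chart_dmap[OF c] by blast
      have defX: "definable L M m X" and defU: "definable L M n U" and openU: "openin \<tau> U"
        and hom: "homeomorphic_map (subtopology \<tau> U) (subtopology (pow_top S m) X) h"
        using c by (simp_all add: chart_def definable_chart_def)
      obtain \<C> where \<C>: "finite \<C>" "\<forall>C\<in>\<C>. cell L M S m C" "\<Union>\<C> = X" using cell_decomposition[OF defX] by blast
      \<comment> \<open>\<open>X \<inter> I C\<close> is the interior of \<open>C\<close> relative
        to \<open>X\<close>; boxes describe it because this makes it definable.\<close>
      define Q where "Q C = {b \<in> pow M (m * kb). X \<inter> Box m b \<subseteq> C}" for C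
      define I where "I C = (\<Union>b\<in>Q C. Box m b)" for C
      define D where "D C = {u \<in> U. h u \<in> I C}" for C
      have openI: "openin (pow_top S m) (I C)" for C
        unfolding I_def Q_def by (intro openin_clauses(3)) (auto intro: open_Box)
      have XI: "X \<inter> I C \<subseteq> C" for C by (auto simp: I_def Q_def)
      have chartD: "manifold_chart (D C)" if C: "C \<in> \<C>" for C
      proof -
        have cell: "cell L M S m C" using \<C>(2) C by blast
        have CX: "C \<subseteq> X" using \<C>(3) C by blast
        have "definable L M m {x \<in> pow M m. \<exists>b\<in>pow M (m * kb). (\<forall>y\<in>pow M m. y \<in> X \<longrightarrow> y \<in> Box m b \<longrightarrow> y \<in> C) \<and> x \<in> Box m b}"
          by (intro definable_Collect dfn_Bex_pow dfn_conj dfn_Ball_pow dfn_imp dfn_mem[OF defX]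
            dfn_mem[OF definable_cell[OF cell]] dfn_Box dtup_var)
        moreover have "{x \<in> pow M m. \<exists>b\<in>pow M (m * kb). (\<forall>y\<in>pow M m. y \<in> X \<longrightarrow> y \<in> Box m b \<longrightarrow> y \<in> C) \<and> x \<in> Box m b} = I C"
          using cf(3) unfolding I_def Q_def Box_def by blast
        ultimately have defI: "definable L M m (I C)" by simp
        have "definable L M n {u \<in> U. h' u \<in> I C}"
          by (intro definable_sub_Collect defU dfn_mem_term[OF defI] dterm_dmap[OF h'(1)] dterm_dtup dtup_var)
        moreover have "{u \<in> U. h' u \<in> I C} = D C" using h'(2) by (auto simp: D_def)
        ultimately have defD: "definable L M n (D C)" by simp
        have openD: "openin \<tau> (D C)" unfolding D_def by (rule cf(4)[OF openI])
        have DU: "D C \<subseteq> U" by (auto simp: D_def)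
        have "homeomorphic_map (subtopology (subtopology \<tau> U) (D C)) (subtopology (subtopology (pow_top S m) X) (X \<inter> I C)) h"
        proof (rule homeomorphic_map_subtopologies[OF hom])
          have "topspace (subtopology \<tau> U) = U" using openin_subset[OF openU] by (simp add: inf.absorb2)
          moreover have "topspace (subtopology (pow_top S m) X) = X" using cf(3) by (simp add: topspace_pow_top inf.absorb2)
          ultimately show "h ` (topspace (subtopology \<tau> U) \<inter> D C) = topspace (subtopology (pow_top S m) X) \<inter> (X \<inter> I C)"
            using cf(1) by (auto simp: D_def)
        qed
        then have "homeomorphic_map (subtopology \<tau> (D C)) (subtopology (pow_top S m) (X \<inter> I C)) h"
          using DU by (simp add: subtopology_subtopology inf.absorb2 Int_assoc[symmetric])
        moreover have "{append_pt n m x (h x) | x. x \<in> D C} = {append_pt n m x (h' x) | x. x \<in> D C}"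
          using h'(2) DU by (metis (no_types, opaque_lifting) subsetD)
        then have "definable L M (n + m) {append_pt n m x (h x) | x. x \<in> D C}"
          using definable_graph[OF defD h'(1)] by simp
        ultimately have "definable_chart L M S n \<tau> (D C) m (X \<inter> I C) h" by (simp add: definable_chart_def)
        moreover have "openin (subtopology (pow_top S m) C) (X \<inter> I C)"
        proof -
          have "X \<inter> I C = I C \<inter> C" using XI CX by blast
          then show ?thesis using openI by (auto simp: openin_subtopology)
        qed
        ultimately show ?thesis unfolding manifold_chart_def using defD openD cell by blast
      qed
      have "W \<inter> \<Union>(D ` \<C>) \<noteq> {}" if W: "openin \<tau> W" "W \<inter> U \<noteq> {}" for W
      proof -
        obtain W' where W': "openin (pow_top S m) W'" "\<forall>u\<in>U. u \<in> W \<longleftrightarrow> h u \<in> W'" using cf(5)[OF W(1)] by blast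
        have XW: "X \<inter> W' \<noteq> {}" using W(2) W'(2) cf(1) by blast
        have "\<exists>C\<in>\<C>. \<exists>d s V \<theta> N Z. graph_over m d s V \<theta> N Z \<and> N \<subseteq> W' \<and> Z = X \<inter> N \<and> Z \<subseteq> C \<and> Z \<noteq> {}"
          using \<C>(2) by (intro graph_over_dense[OF \<C>(1) _ \<C>(3) W'(1) XW]) blast
        then obtain C d s V \<theta> N Z where g: "C \<in> \<C>" "graph_over m d s V \<theta> N Z" "N \<subseteq> W'" "Z = X \<inter> N" "Z \<subseteq> C" "Z \<noteq> {}"
          by (elim bexE exE conjE)
        have "openin (pow_top S m) N" using g(2) by (simp add: graph_over_def)
        obtain x where x: "x \<in> X" "x \<in> N" using g(4,6) by blast
        obtain b where b: "b \<in> pow M (m * kb)" "x \<in> Box m b" "Box m b \<subseteq> N"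
          using Box_nbhd[OF \<open>openin (pow_top S m) N\<close> x(2)] by blast
        have "b \<in> Q C" using b g(4,5) by (auto simp: Q_def)
        then have "x \<in> I C" using b(2) by (auto simp: I_def)
        obtain u where u: "u \<in> U" "h u = x" using cf(1) x(1) by blast
        then have "u \<in> D C" "u \<in> W" using \<open>x \<in> I C\<close> W'(2) g(3) x(2) by (auto simp: D_def)
        then show ?thesis using g(1) by blast
      qed
      then show ?thesis using chartD \<C>(1) by (intro exI[of _ "D ` \<C>"]) simp
    qed simp
  qed
  from choice[OF this] obtain \<P> where \<P>: "\<forall>U. U \<in> \<U> \<longrightarrow> finite (\<P> U) \<and> (\<forall>D\<in>\<P> U. manifold_chart D) \<and>
      (\<forall>W. openin \<tau> W \<and> W \<inter> U \<noteq> {} \<longrightarrow> W \<inter> \<Union>(\<P> U) \<noteq> {})" ..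
  have "W \<inter> \<Union>(\<Union>U\<in>\<U>. \<P> U) \<noteq> {}" if W: "openin \<tau> W" "W \<noteq> {}" for W
  proof -
    obtain U where U: "U \<in> \<U>" "W \<inter> U \<noteq> {}" using W open_sub_carrier[OF W(1)] \<U>(2) by blast
    then have "W \<inter> \<Union>(\<P> U) \<noteq> {}" using \<P> W(1) by blast
    then show ?thesis using U(1) by blast
  qed
  then show ?thesis using that[of "\<Union>U\<in>\<U>. \<P> U"] \<P> \<U>(1) by auto
qed

text \<open>The chart is composed with left translation by \<open>c\<close>, a homeomorphism whose
  inverse is left translation by \<open>inv c\<close>.\<close>

lemma manifold_chart_translate:
  assumes D: "manifold_chart D" and c: "c \<in> carrier G"
  shows "manifold_chart {x \<in> carrier G. c \<otimes> x \<in> D}"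
proof -
  let ?D = "{x \<in> carrier G. c \<otimes> x \<in> D}"
  obtain m C V h where h: "cell L M S m C" "openin (subtopology (pow_top S m) C) V"
    "homeomorphic_map (subtopology \<tau> D) (subtopology (pow_top S m) V) h"
    "definable L M (n + m) {append_pt n m x (h x) | x. x \<in> D}"
    and defD: "definable L M n D" and openD: "openin \<tau> D"
    using D unfolding manifold_chart_def definable_chart_def by blast
  have cdmap: "dmap n n (gm c)"
    by (rule dmapI, intro dterm_gm dterm_dtup dtup_const carrier_pow c dtup_var)
  have "definable L M n {x \<in> carrier G. gm c x \<in> D}"
    by (intro definable_sub_Collect definable_carrier dfn_mem_term[OF defD] dterm_gm dterm_dtup dtup_const
      carrier_pow c dtup_var)
  moreover have "{x \<in> carrier G. gm c x \<in> D} = ?D" using c by (auto simp: gm_def)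
  ultimately have defD': "definable L M n ?D" by simp
  have DC: "D \<subseteq> carrier G" by (rule open_sub_carrier[OF openD])
  have "homeomorphic_maps \<tau> \<tau> (\<lambda>x. c \<otimes> x) (\<lambda>x. inv c \<otimes> x)"
    using c by (auto simp: homeomorphic_maps_def topspace_\<tau> m_assoc[symmetric] intro: left_continuous)
  then have "homeomorphic_map \<tau> \<tau> (\<lambda>x. c \<otimes> x)" by (auto simp: homeomorphic_map_maps)
  then have "homeomorphic_map (subtopology \<tau> ?D) (subtopology \<tau> D) (\<lambda>x. c \<otimes> x)"
  proof (rule homeomorphic_map_subtopologies)
    have "y \<in> (\<lambda>x. c \<otimes> x) ` ?D" if "y \<in> D" for y
    proof (rule image_eqI)
      have y: "y \<in> carrier G" using that DC by blast
      show "y = c \<otimes> (inv c \<otimes> y)" using c y by (simp add: m_assoc[symmetric])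
      then show "inv c \<otimes> y \<in> ?D" using c y that by simp
    qed
    then show "(\<lambda>x. c \<otimes> x) ` (topspace \<tau> \<inter> ?D) = topspace \<tau> \<inter> D"
      using DC by (auto simp: topspace_\<tau>)
  qed
  then have "homeomorphic_map (subtopology \<tau> ?D) (subtopology (pow_top S m) V) (h \<circ> (\<lambda>x. c \<otimes> x))"
    using h(3) by (rule homeomorphic_map_compose)
  moreover have "definable L M (n + m) {append_pt n m x ((h \<circ> (\<lambda>x. c \<otimes> x)) x) | x. x \<in> ?D}"
  proof -
    have "topspace (subtopology \<tau> D) = D" using DC by (simp add: topspace_\<tau> inf.absorb2)
    then have "h ` D \<subseteq> pow M m"
      using homeomorphic_imp_surjective_map[OF h(3)] by (simp add: topspace_pow_top)
    moreover obtain e where "e \<in> pow M m" using pow_nonempty by blast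
    ultimately have "dmap n m (\<lambda>x. if x \<in> D then h x else e)" by (rule dmap_of_graph[OF defD h(4)])
    then have "dmap n m (\<lambda>x. if gm c x \<in> D then h (gm c x) else e)" by (rule dmap_comp[OF cdmap])
    note gr = definable_graph[OF defD' this]
    have "(if gm c x \<in> D then h (gm c x) else e) = (h \<circ> (\<lambda>x. c \<otimes> x)) x" if "x \<in> ?D" for x
      using that c by (auto simp: gm_def)
    then have "{append_pt n m x (if gm c x \<in> D then h (gm c x) else e) | x. x \<in> ?D} =
        {append_pt n m x ((h \<circ> (\<lambda>x. c \<otimes> x)) x) | x. x \<in> ?D}"
      unfolding Setcompr_eq_image by (intro image_cong refl) (simp only:)
    then show ?thesis using gr by simp
  qed
  ultimately have "definable_chart L M S n \<tau> ?D m V (h \<circ> (\<lambda>x. c \<otimes> x))" by (simp add: definable_chart_def)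
  then show ?thesis
    unfolding manifold_chart_def using h(1,2) defD' left_open[OF c openD] by blast
qed

lemma manifold: "definable_manifold L M S n (carrier G) \<tau>"
proof -
  obtain \<P> where \<P>: "finite \<P>" "\<forall>D\<in>\<P>. manifold_chart D" "\<forall>W. openin \<tau> W \<and> W \<noteq> {} \<longrightarrow> W \<inter> \<Union>\<P> \<noteq> {}"
    by (rule dense_manifold_charts)
  have "definable L M n (\<Union>D\<in>\<P>. D)" using \<P>(1,2) by (intro definable_UN) (auto simp: manifold_chart_def)
  then have defP: "definable L M n (\<Union>\<P>)" by simp
  \<comment> \<open>\<open>finite_translates\<close> will give \<open>inv h \<otimes> f\<close> in
    \<open>Q\<close>, which by the choice of \<open>Q\<close> means \<open>inv f \<otimes> h\<close>
    in \<open>\<Union>\<P>\<close>: every \<open>h\<close> lies in the translate by \<open>f\<close>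
    of some chart domain. Inversion is continuous, so \<open>Q\<close> is as dense as
    \<open>\<Union>\<P>\<close>.\<close>
  define Q where "Q = {x \<in> carrier G. gi x \<in> \<Union>\<P>}"
  have defQ: "definable L M n Q" unfolding Q_def
    by (intro definable_sub_Collect definable_carrier dfn_mem_term[OF defP] dterm_dmap[OF dmap_gi] dterm_dtup dtup_var)
  have denseQ: "W \<inter> Q \<noteq> {}" if W: "openin \<tau> W" "W \<noteq> {}" for W
  proof -
    have "openin \<tau> {x \<in> topspace \<tau>. inv x \<in> W}" by (rule openin_preimage[OF continuous_inv W(1)])
    moreover obtain w where w: "w \<in> W" "w \<in> carrier G" using W open_sub_carrier by blast
    then have "inv w \<in> {x \<in> topspace \<tau>. inv x \<in> W}" by (simp add: topspace_\<tau>)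
    ultimately have "{x \<in> topspace \<tau>. inv x \<in> W} \<inter> \<Union>\<P> \<noteq> {}" using \<P>(3) by blast
    then obtain x where x: "x \<in> carrier G" "inv x \<in> W" "x \<in> \<Union>\<P>" by (auto simp: topspace_\<tau>)
    then have "inv x \<in> Q" by (simp add: Q_def gi_def)
    then show "W \<inter> Q \<noteq> {}" using x(2) by blast
  qed
  have "\<exists>F. finite F \<and> F \<subseteq> carrier G \<and> (\<forall>h\<in>carrier G. \<exists>f\<in>F. inv h \<otimes> f \<in> Q)"
    by (rule finite_translates[OF defQ]) (rule denseQ)
  then obtain F where F: "finite F" "F \<subseteq> carrier G" "\<forall>h\<in>carrier G. \<exists>f\<in>F. inv h \<otimes> f \<in> Q"
    by (elim exE conjE)
  define T where "T f D = {x \<in> carrier G. inv f \<otimes> x \<in> D}" for f D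
  let ?\<U> = "(\<lambda>(f, D). T f D) ` (F \<times> \<P>)"
  have "\<Union>?\<U> = carrier G"
  proof
    show "carrier G \<subseteq> \<Union>?\<U>"
    proof
      fix h assume h: "h \<in> carrier G"
      then obtain f where f: "f \<in> F" "inv h \<otimes> f \<in> Q" using F(3) by blast
      have fC: "f \<in> carrier G" using f(1) F(2) by blast
      have "inv (inv h \<otimes> f) \<in> \<Union>\<P>" using f(2) h fC by (simp add: Q_def gi_def)
      then have "inv f \<otimes> h \<in> \<Union>\<P>" using h fC by (simp add: inv_mult_group)
      then obtain D where "D \<in> \<P>" "inv f \<otimes> h \<in> D" by blast
      then have "T f D \<in> ?\<U>" "h \<in> T f D" using h f(1) by (auto simp: T_def)
      then show "h \<in> \<Union>?\<U>" by (rule UnionI)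
    qed
  qed (auto simp: T_def)
  moreover have "manifold_chart (T f D)" if "f \<in> F" "D \<in> \<P>" for f D
    unfolding T_def using that \<P>(2) F(2) by (intro manifold_chart_translate inv_closed) auto
  then have "\<forall>U\<in>?\<U>. manifold_chart U" by auto
  moreover have "finite ?\<U>" using F(1) \<P>(1) by simp
  ultimately show ?thesis
    unfolding definable_manifold_def using space unfolding manifold_chart_def by (intro conjI exI[of _ ?\<U>]) auto
qed

lemma topological: "topological_group G \<tau>"
  unfolding topological_group_def using is_group topspace_\<tau> continuous_mult continuous_inv by simp

end

section \<open>From the monster model to the abstract setting\<close>

lemma tame_structure_monster:
  fixes L :: "('f, 'r) language" and M :: "('f, 'r, 'a) struct"
  assumes "t_minimal L T \<TT>" "monster_model L T M" "nice L M (\<TT> M)"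
  obtains Bs k where "tame_structure L M (\<TT> M) Bs k"
proof -
  from assms(2) obtain \<kappa> :: "'a rel" where model: "is_model L T M"
    and \<kappa>: "|{\<phi> :: ('f, 'r) fm. wf_fm L \<phi>}| <o \<kappa>" "saturated \<kappa> L M"
    by (auto simp: monster_model_def)
  interpret fo_structure L M
    using model by unfold_locales (simp add: is_model_def)
  from assms(1) obtain \<phi> k where \<phi>: "wf_fm L \<phi>" and "\<forall>M. is_model L T M \<longrightarrow> (\<exists>e. range e \<subseteq> Dom M \<and>
      base_of (\<TT> M) {{a \<in> Dom M. sat M (case_nat a (\<lambda>i. if i < k then b i else e i)) \<phi>} | b. b \<in> pow M k})"
    and top: "\<forall>M. is_model L T M \<longrightarrow> topspace (\<TT> M) = Dom M \<and> Hausdorff_space (\<TT> M) \<and>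
        (\<forall>D\<subseteq>Dom M. definable L M 1 {x \<in> pow M 1. x 0 \<in> D} \<longrightarrow> (\<TT> M interior_of D \<noteq> {} \<longleftrightarrow> infinite D))"
    unfolding t_minimal_def by (elim exE conjE)
  then obtain e where e: "range e \<subseteq> Dom M"
    "base_of (\<TT> M) {{a \<in> Dom M. sat M (case_nat a (\<lambda>i. if i < k then b i else e i)) \<phi>} | b. b \<in> pow M k}"
    using model by blast
  \<comment> \<open>The basis formula with its parameters \<open>e\<close> fixed for this model, so
    that only the index tuple \<open>b\<close> remains as an argument.\<close>
  define Bs where "Bs b = {a \<in> Dom M. sat M (case_nat a (\<lambda>i. if i < k then b i else e i)) \<phi>}" for b
  have "tame_structure L M (\<TT> M) Bs k"
  proof unfold_locales
    show "(\<Inter>j. X j) \<noteq> {}" if "\<And>j. definable L M m (X j)" "\<And>j :: nat. X j \<noteq> {}" "\<And>i j. i \<le> j \<Longrightarrow> X j \<subseteq> X i" for X m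
      using \<kappa>(2,1) that by (rule saturated_decreasing)
    have "Bs ` pow M k = {{a \<in> Dom M. sat M (case_nat a (\<lambda>i. if i < k then b i else e i)) \<phi>} | b. b \<in> pow M k}"
      by (auto simp: Bs_def)
    then show "base_of (\<TT> M) (Bs ` pow M k)" using e(2) by simp
    show "dfn (\<lambda>w. t w \<in> Bs (s w))" if t: "delt t" and s: "dtup k s" for t s
    proof (rule dfn_congI)
      show "dfn (\<lambda>w. sat M (case_nat (t w) (\<lambda>i. if i < k then s w i else e i)) \<phi>)"
      proof (rule dfn_sat[OF \<phi>])
        fix v
        show "delt (\<lambda>w. case_nat (t w) (\<lambda>i. if i < k then s w i else e i) v)"
          using e(1) by (cases v) (auto intro!: delt_if t delt_nth[OF s] delt_const)
      qed
    qed (use delt_in[OF t] in \<open>simp add: Bs_def\<close>)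
  qed (use top model assms(3) in blast)+
  then show ?thesis by (rule that)
qed

theorem theorem7p8:
  fixes L :: "('f, 'r) language"
    and T :: "('f, 'r) fm set"
    and \<TT> :: "('f, 'r, 'a) struct \<Rightarrow> 'a topology"
    and \<MM> :: "('f, 'r, 'a) struct"
    and n :: nat
    and G :: "'a point monoid"
    and \<tau> :: "'a point topology"
  assumes "complete_theory TYPE('a) L T"
    and "t_minimal L T \<TT>"
    and "monster_model L T \<MM>"
    and "nice L \<MM> (\<TT> \<MM>)"
    and "definable_group L \<MM> n G"
    and "definable_space L \<MM> n (carrier G) \<tau>"
    and "definable_semimanifold L \<MM> (\<TT> \<MM>) n (carrier G) \<tau>"
    and "\<And>a. a \<in> carrier G \<Longrightarrow> continuous_map \<tau> \<tau> (\<lambda>x. a \<otimes>\<^bsub>G\<^esub> x)"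
  shows "definable_manifold L \<MM> (\<TT> \<MM>) n (carrier G) \<tau> \<and> topological_group G \<tau>"
proof -
  obtain Bs k where tame: "tame_structure L \<MM> (\<TT> \<MM>) Bs k"
    using tame_structure_monster[OF assms(2,3,4)] .
  have "group G" using assms(5) by (simp add: definable_group_def)
  then interpret definable_group_space L \<MM> "\<TT> \<MM>" Bs k G n \<tau>
    using tame assms(5-8) by (simp add: definable_group_space_def definable_group_space_axioms_def)
  show ?thesis using manifold topological by blast
qed

end
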